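(* Let $r \geq 3$ and $\ell \geq 2$ be integers. There exist a constant $c > 0$ (depending on $r$, resp. $\ell$) and $k_0$ such that for every fixed integer $k \geq k_0$ the following holds. For each $n$ let $G = G_n$ be an $n$-vertex graph with maximum degree $\Delta := \Delta(n)$ and let $m := m(n)$ be an integer with $m \geq 3k^2\Delta$. (a) If $G$ is $K_r$-free and $m / \left(n^{c k^{-(2r-3)/(r-2)} (\log k)^{1/(r-2)}} \Delta^{2/k}\right) \to \infty$, then $G$ is a.a.s. $(k,m)$-colourable. (b) If $G$ is $C_{2\ell+1}$-free and $m / \left(n^{c k^{-(\ell+2)} (\log k)^{\ell}} \Delta^{2/k}\right) \to \infty$, then $G$ is a.a.s. $(k,m)$-colourable. (c) If $G$ is $C_{2\ell}$-free and $m / \left(n^{c k^{-(\ell+1)}} \Delta^{2/k}\right) \to \infty$, then $G$ is a.a.s. $(k,m)$-colourable.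
   Context: A random $(k,m)$-list-assignment $\mathcal{L} = \{L(v)\}$ of a graph $G$ assigns to each vertex a uniformly random $k$-element subset of $\{1,\ldots,m\}$, independently over vertices. $G$ is a.a.s. $(k,m)$-colourable if $\lim_{n\to\infty}\mathbb{P}(G$ has a proper colouring $c$ with $c(v)\in L(v)$ for all $v) = 1$. $H$-free means containing no (not necessarily induced) copy of $H$. $\log$ is the natural logarithm. *)

theory Defs
  imports Complex_Main "HOL-Library.FuncSet"
begin

definition graph_on :: "nat \<Rightarrow> (nat \<Rightarrow> nat \<Rightarrow> bool) \<Rightarrow> bool" where
  "graph_on n E \<longleftrightarrow> (\<forall>u v. E u v \<longrightarrow> u < n \<and> v < n \<and> u \<noteq> v \<and> E v u)"

definition degree :: "(nat \<Rightarrow> nat \<Rightarrow> bool) \<Rightarrow> nat \<Rightarrow> nat" where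
  "degree E u = card {v. E u v}"

definition max_degree :: "nat \<Rightarrow> (nat \<Rightarrow> nat \<Rightarrow> bool) \<Rightarrow> nat" where
  "max_degree n E = Max (insert 0 (degree E ` {0..<n}))"

definition has_clique :: "nat \<Rightarrow> (nat \<Rightarrow> nat \<Rightarrow> bool) \<Rightarrow> nat \<Rightarrow> bool" where
  "has_clique n E r \<longleftrightarrow> (\<exists>f. inj_on f {0..<r} \<and> f ` {0..<r} \<subseteq> {0..<n} \<and>
      (\<forall>i<r. \<forall>j<r. i \<noteq> j \<longrightarrow> E (f i) (f j)))"

definition has_cycle :: "nat \<Rightarrow> (nat \<Rightarrow> nat \<Rightarrow> bool) \<Rightarrow> nat \<Rightarrow> bool" where
  "has_cycle n E len \<longleftrightarrow> (\<exists>f. inj_on f {0..<len} \<and> f ` {0..<len} \<subseteq> {0..<n} \<and>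
      (\<forall>i<len. E (f i) (f ((i + 1) mod len))))"

definition list_assignments :: "nat \<Rightarrow> nat \<Rightarrow> nat \<Rightarrow> (nat \<Rightarrow> nat set) set" where
  "list_assignments n k m = Pi\<^sub>E {0..<n} (\<lambda>_. {S. S \<subseteq> {1..m} \<and> card S = k})"

definition list_colourable :: "nat \<Rightarrow> (nat \<Rightarrow> nat \<Rightarrow> bool) \<Rightarrow> (nat \<Rightarrow> nat set) \<Rightarrow> bool" where
  "list_colourable n E L \<longleftrightarrow> (\<exists>c :: nat \<Rightarrow> nat. (\<forall>v<n. c v \<in> L v) \<and>
      (\<forall>u<n. \<forall>v<n. E u v \<longrightarrow> c u \<noteq> c v))"

text \<open>Probability that a uniformly random (k,m)-list-assignment (independent uniform
  k-subsets at each vertex = uniform on the product set) admits a proper L-colouring.\<close>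
definition colour_prob :: "nat \<Rightarrow> (nat \<Rightarrow> nat \<Rightarrow> bool) \<Rightarrow> nat \<Rightarrow> nat \<Rightarrow> real" where
  "colour_prob n E k m =
     real (card {L \<in> list_assignments n k m. list_colourable n E L})
     / real (card (list_assignments n k m))"

definition aas_colourable :: "(nat \<Rightarrow> nat \<Rightarrow> nat \<Rightarrow> bool) \<Rightarrow> nat \<Rightarrow> (nat \<Rightarrow> nat) \<Rightarrow> bool" where
  "aas_colourable G k m \<longleftrightarrow> (\<lambda>n. colour_prob n (G n) k (m n)) \<longlonglongrightarrow> 1"

text \<open>f(n)/g(n) \<rightarrow> \<infinity> for nonnegative g, with g(n)=0 read as ratio +\<infinity> (f(n)>0).\<close>
definition ratio_to_infty :: "(nat \<Rightarrow> real) \<Rightarrow> (nat \<Rightarrow> real) \<Rightarrow> bool" where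
  "ratio_to_infty f g \<longleftrightarrow> (\<forall>B::real. eventually (\<lambda>n. B * g n < f n) sequentially)"

end

(*
If G has no proper colouring from random lists L, take a minimal set U of vertices that cannot be
coloured. Then U is connected by edges whose two lists meet, and every colour occurring on U occurs
at least twice, so that at most k |U| / 2 colours occur. Since m >= 3 k^2 Delta, exploring the
graph of edges with meeting lists is dominated by a branching process of mean 1/3, and its trees
with s vertices have expected number at most about (e/3)^s; hence |U| = O(log n). Below that size
there are at most (e Delta)^u candidates through a given vertex, each with probability at most
(k u)^(k u) m^(-k u / 2). So U only exists if it is smaller than a constant s0 determined by the
exponent of n, and it remains to see that H-free graphs on s0 vertices are k-choosable.

For C_2l this is degeneracy. For K_r and C_(2l+1), first use up single colours on large independent
sets; afterwards the vertices carrying one colour induce a graph without large independent sets.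
In such a graph, Ramsey-type arguments give for every weight function an independent set carrying a
proportion q of the weight, and colouring greedily with respect to the weights (1-q)^|L(v)|
finishes the job with log |V| / q colours.

Both cycle cases rest on ordering a layer of a breadth-first tree depth-first: on a monotone
sequence of vertices of the layer one can prescribe the length of a window in terms of the height
of the common ancestor of its ends, and still find such a window. The tree paths to that ancestor
then close a monotone path in the window to a cycle of exactly the forbidden length.
*)
theory Submission
  imports Defs "HOL-Real_Asymp.Real_Asymp"
begin

subsection \<open>List colourings and fractional independence\<close>

text \<open>Complete bipartite graphs satisfy the hypotheses of (a) and (b), so degeneracy is
  useless there. In the greedy process the remaining lists differ in length, which is why
  independent sets must be large for every weight function and not only in cardinality. The
  exponents record how many vertices N an H-free graph may have and still be colourable from all
  lists of k colours. With half of each list reserved for large independent sets, those left have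
  fewer than t = O(1 + N/k) vertices, and the greedy phase needs log N < q k up to constants, with q
  of order t^-(r-2) in (a) and t^(-1/l) in (b). So N may reach order k^((r-1)/(r-2)) / (log
  k)^(1/(r-2)) in (a), k^(l+1) / (log k)^l in (b), and k^l in (c). If m exceeds n^\<gamma>
  Delta^(2/k), a critical set of u vertices costs n^(-\<gamma> k u / 2), where Delta^(2/k) has
  cancelled the factor Delta^u for the choice of the set; this beats the n choices of a root once u
  exceeds a constant over \<gamma> k. Hence \<gamma> is a constant over k N, which gives the three
  exponents.\<close>

definition lcol :: "('a \<Rightarrow> 'a \<Rightarrow> bool) \<Rightarrow> 'a set \<Rightarrow> ('a \<Rightarrow> 'b set) \<Rightarrow> bool" where
  "lcol E U L \<longleftrightarrow> (\<exists>c. (\<forall>v\<in>U. c v \<in> L v) \<and> (\<forall>u\<in>U. \<forall>v\<in>U. E u v \<longrightarrow> c u \<noteq> c v))"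

definition indep :: "('a \<Rightarrow> 'a \<Rightarrow> bool) \<Rightarrow> 'a set \<Rightarrow> bool" where
  "indep E I \<longleftrightarrow> (\<forall>x\<in>I. \<forall>y\<in>I. \<not> E x y)"

text \<open>By linear programming duality, for finite \<open>U\<close> and positive \<open>q\<close>
  this says that the graph induced on \<open>U\<close> has fractional chromatic number at most
  \<open>1 / q\<close>.\<close>

definition fractional :: "('a \<Rightarrow> 'a \<Rightarrow> bool) \<Rightarrow> real \<Rightarrow> 'a set \<Rightarrow> bool" where
  "fractional E q U \<longleftrightarrow> (\<forall>w. (\<forall>v\<in>U. 0 \<le> w v) \<longrightarrow> (\<exists>I\<subseteq>U. indep E I \<and> q * sum w U \<le> sum w I))"

lemma lcol_empty [simp]: "lcol E {} L"
  by (simp add: lcol_def)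

lemma lcol_remove_indep:
  assumes "I \<subseteq> V" "indep E I" "\<And>v. v \<in> I \<Longrightarrow> a \<in> L v" "lcol E (V - I) (\<lambda>v. L v - {a})"
  shows "lcol E V L"
proof -
  obtain c where c: "\<And>v. v \<in> V - I \<Longrightarrow> c v \<in> L v - {a}"
    "\<And>u v. u \<in> V - I \<Longrightarrow> v \<in> V - I \<Longrightarrow> E u v \<Longrightarrow> c u \<noteq> c v"
    using assms(4) unfolding lcol_def by blast
  let ?d = "\<lambda>v. if v \<in> I then a else c v"
  have "?d v \<in> L v" if "v \<in> V" for v using that assms(3) c(1)[of v] by auto
  moreover have "?d u \<noteq> ?d v" if "u \<in> V" "v \<in> V" "E u v" for u v
    using that c(1)[of u] c(1)[of v] c(2)[of u v] assms(2) unfolding indep_def by auto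
  ultimately show ?thesis unfolding lcol_def by (intro exI[of _ ?d]) blast
qed

lemma degenerate_lcol:
  assumes "finite V" and sym: "\<And>u v. E u v \<Longrightarrow> E v u" and irr: "\<And>u. \<not> E u u"
    and deg: "\<And>U. U \<subseteq> V \<Longrightarrow> U \<noteq> {} \<Longrightarrow> \<exists>v\<in>U. card {u\<in>U. E v u} < k"
    and L: "\<And>v. v \<in> V \<Longrightarrow> finite (L v) \<and> card (L v) = k"
  shows "lcol E V L"
proof -
  have "U \<subseteq> V \<Longrightarrow> lcol E U L" for U
  proof (induction "card U" arbitrary: U)
    case 0
    then show ?case using finite_subset[OF _ assms(1)] by fastforce
  next
    case (Suc j)
    have fU: "finite U" using Suc finite_subset[OF _ assms(1)] by blast
    have ne: "U \<noteq> {}" using Suc by auto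
    obtain v where v: "v \<in> U" "card {u\<in>U. E v u} < k" using deg[OF Suc.prems ne] by blast
    have "lcol E (U - {v}) L" using Suc v fU by (intro Suc.hyps) auto
    then obtain c where c: "\<And>x. x \<in> U - {v} \<Longrightarrow> c x \<in> L x"
      "\<And>x y. x \<in> U - {v} \<Longrightarrow> y \<in> U - {v} \<Longrightarrow> E x y \<Longrightarrow> c x \<noteq> c y"
      unfolding lcol_def by blast
    have "card (c ` {u\<in>U. E v u}) < card (L v)"
      using v L[of v] Suc.prems card_image_le[of "{u\<in>U. E v u}" c] fU by fastforce
    then have "\<not> L v \<subseteq> c ` {u\<in>U. E v u}"
      using card_mono[of "c ` {u\<in>U. E v u}" "L v"] fU by fastforce
    then obtain a where a: "a \<in> L v" "a \<notin> c ` {u\<in>U. E v u}" by blast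
    let ?d = "c(v := a)"
    have "?d x \<in> L x" if "x \<in> U" for x using a c(1) that by auto
    moreover have "?d x \<noteq> ?d y" if "x \<in> U" "y \<in> U" "E x y" for x y
      using that a c(2)[of x y] sym[of x y] irr by (cases "x = v"; cases "y = v") auto
    ultimately show ?case unfolding lcol_def by (intro exI[of _ ?d]) blast
  qed
  then show ?thesis by blast
qed

text \<open>The colours are used up one at a time; the potential
  \<open>\<Sum>v. (1 - q) ^ card (L v)\<close> of the uncoloured vertices never increases.\<close>
lemma fractional_lcol:
  assumes "finite C" "finite V" "0 \<le> q" "q \<le> 1"
    and "\<And>v. v \<in> V \<Longrightarrow> L v \<subseteq> C"
    and "\<And>a U. U \<subseteq> {v\<in>V. a \<in> L v} \<Longrightarrow> fractional E q U"
    and "(\<Sum>v\<in>V. (1 - q) ^ card (L v)) < 1"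
  shows "lcol E V L"
  using assms
proof (induction C arbitrary: V L rule: finite_induct)
  case empty
  have "(\<Sum>v\<in>V. (1 - q) ^ card (L v)) = (\<Sum>v\<in>V. 1)"
    using empty by (intro sum.cong) auto
  then have "V = {}" using empty by auto
  then show ?case by simp
next
  case (insert a C)
  define U where "U = {v\<in>V. a \<in> L v}"
  \<comment> \<open>\<open>w\<close> is the potential after \<open>a\<close> has been struck from
    all lists. On \<open>U\<close> the new total exceeds the old by the share \<open>q\<close>, and
    the set \<open>I\<close> that leaves carries at least this share.\<close>
  define w where "w = (\<lambda>v. (1 - q) ^ card (L v - {a}))"
  have w0: "0 \<le> w v" for v using insert.prems unfolding w_def by simp
  obtain I where I: "I \<subseteq> U" "indep E I" "q * sum w U \<le> sum w I"
    using insert.prems(5)[of U a] w0 unfolding fractional_def U_def by blast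
  have fU: "finite U" "U \<subseteq> V" using insert.prems unfolding U_def by auto
  have IV: "I \<subseteq> V" using I fU by auto
  have fL: "finite (L v)" if "v \<in> V" for v
    using insert.prems(4)[OF that] insert.hyps finite_subset by auto
  have wU: "(1 - q) ^ card (L v) = (1 - q) * w v" if "v \<in> U" for v
  proof -
    have "card (L v) = Suc (card (L v - {a}))"
      using that fL fU unfolding U_def by (metis (no_types, lifting) card.remove mem_Collect_eq)
    then show ?thesis unfolding w_def by simp
  qed
  have wV: "(1 - q) ^ card (L v) = w v" if "v \<in> V - U" for v
    using that unfolding w_def U_def by simp
  have "(\<Sum>v\<in>V - I. w v) = sum w (V - U) + (sum w U - sum w I)"
  proof -
    have "sum w (V - I) = sum w V - sum w I" using IV insert.prems by (simp add: sum_diff)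
    moreover have "sum w V = sum w (V - U) + sum w U"
      using fU insert.prems by (simp add: sum.subset_diff)
    ultimately show ?thesis by simp
  qed
  also have "\<dots> \<le> sum w (V - U) + (1 - q) * sum w U" using I(3) by (simp add: algebra_simps)
  also have "\<dots> = (\<Sum>v\<in>V. (1 - q) ^ card (L v))"
    using fU insert.prems(1) by (simp add: sum.subset_diff[of U V] wU wV sum_distrib_left)
  also have "\<dots> < 1" by (rule insert.prems(6))
  finally have pot: "(\<Sum>v\<in>V - I. w v) < 1" .
  have "lcol E (V - I) (\<lambda>v. L v - {a})"
  proof (rule insert.IH)
    show "finite (V - I)" "0 \<le> q" "q \<le> 1" using insert.prems by auto
    show "L v - {a} \<subseteq> C" if "v \<in> V - I" for v using insert.prems(4)[of v] that by auto
    show "fractional E q W" if "W \<subseteq> {v \<in> V - I. b \<in> L v - {a}}" for b W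
      using that by (intro insert.prems(5)[of W b]) auto
    show "(\<Sum>v\<in>V - I. (1 - q) ^ card (L v - {a})) < 1" using pot unfolding w_def .
  qed
  then show ?case using I IV by (intro lcol_remove_indep[of I V E a L]) (auto simp: U_def)
qed

text \<open>Each round colours at least \<open>t\<close> vertices with one colour and costs every
  remaining list at most that colour. The hypothesis on \<open>card (L v)\<close> is the invariant:
  \<open>k\<close> colours in reserve, and one for each of the at most \<open>card V / t\<close>
  rounds still possible. When no colour has \<open>t\<close> independent vertices left, the vertices
  sharing a colour induce \<open>fractional\<close> sets and the reserve suffices.\<close>

lemma strip_lcol:
  assumes "finite V" "0 \<le> q" "q \<le> 1" "0 < t"
    and "\<And>U. U \<subseteq> V \<Longrightarrow> (\<And>I. I \<subseteq> U \<Longrightarrow> indep E I \<Longrightarrow> card I < t) \<Longrightarrow> fractional E q U"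
    and "\<And>v. v \<in> V \<Longrightarrow> finite (L v) \<and> real k + real (card V) / real t \<le> real (card (L v))"
    and "real (card V) * (1 - q) ^ k < 1"
  shows "lcol E V L"
  using assms
proof (induction "card V" arbitrary: V L rule: less_induct)
  case less
  show ?case
  proof (cases "\<exists>a I. I \<subseteq> {v\<in>V. a \<in> L v} \<and> indep E I \<and> t \<le> card I")
    case True
    then obtain a I where I: "I \<subseteq> {v\<in>V. a \<in> L v}" "indep E I" "t \<le> card I" by blast
    have IV: "I \<subseteq> V" using I(1) by blast
    have fI: "finite I" using IV less.prems(1) by (rule finite_subset)
    have card: "card (V - I) = card V - card I" "card I \<le> card V"
      using IV fI less.prems(1) by (auto simp: card_Diff_subset card_mono)
    have c: "real (card (V - I)) / real t \<le> real (card V) / real t - 1"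
    proof -
      have "real (card (V - I)) \<le> real (card V) - real t" using card I(3) by linarith
      then have "real (card (V - I)) / real t \<le> (real (card V) - real t) / real t"
        by (simp add: divide_right_mono)
      then show ?thesis using less.prems(4) by (simp add: diff_divide_distrib)
    qed
    have "lcol E (V - I) (\<lambda>v. L v - {a})"
    proof (rule less.hyps)
      show "card (V - I) < card V" using card I(3) less.prems(4) by linarith
      show "finite (V - I)" "0 \<le> q" "q \<le> 1" "0 < t" using less.prems by auto
      show "fractional E q U"
        if "U \<subseteq> V - I" "\<And>I. I \<subseteq> U \<Longrightarrow> indep E I \<Longrightarrow> card I < t" for U
        using that by (intro less.prems(5)) auto
      show "finite (L v - {a}) \<and> real k + real (card (V - I)) / real t \<le> real (card (L v - {a}))"
        if "v \<in> V - I" for v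
      proof -
        have "card (L v) \<le> Suc (card (L v - {a}))"
          using less.prems(6)[of v] that by (simp add: card_Diff_singleton_if) linarith
        then have "real (card (L v)) \<le> real (card (L v - {a})) + 1" by linarith
        moreover have "finite (L v)" "real k + real (card V) / real t \<le> real (card (L v))"
          using less.prems(6)[of v] that by auto
        ultimately show ?thesis using c by simp
      qed
      have "real (card (V - I)) * (1 - q) ^ k \<le> real (card V) * (1 - q) ^ k"
        using less.prems(3) card by (intro mult_right_mono) auto
      then show "real (card (V - I)) * (1 - q) ^ k < 1" using less.prems(7) by linarith
    qed
    then show ?thesis using I IV by (intro lcol_remove_indep[of I V E a L]) auto
  next
    case False
    have "(1 - q) ^ card (L v) \<le> (1 - q) ^ k" if "v \<in> V" for v
    proof (rule power_decreasing)
      have "0 \<le> real (card V) / real t" by simp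
      then have "real k \<le> real (card (L v))" using less.prems(6)[OF that] by linarith
      then show "k \<le> card (L v)" by simp
    qed (use less.prems in auto)
    then have "(\<Sum>v\<in>V. (1 - q) ^ card (L v)) \<le> real (card V) * (1 - q) ^ k"
      by (rule sum_bounded_above)
    then have 1: "(\<Sum>v\<in>V. (1 - q) ^ card (L v)) < 1" using less.prems(7) by linarith
    show ?thesis
    proof (rule fractional_lcol[OF _ less.prems(1-3) _ _ 1])
      show "finite (\<Union>v\<in>V. L v)" using less.prems(1,6) by simp
      show "L v \<subseteq> (\<Union>v\<in>V. L v)" if "v \<in> V" for v using that by blast
      show "fractional E q U" if "U \<subseteq> {v \<in> V. a \<in> L v}" for a U
      proof (rule less.prems(5))
        show "card I < t" if "I \<subseteq> U" "indep E I" for I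
        proof (rule ccontr)
          assume "\<not> card I < t"
          then show False using False that \<open>U \<subseteq> {v \<in> V. a \<in> L v}\<close>
            by (meson not_less order_trans)
        qed
        show "U \<subseteq> V" using that by blast
      qed
    qed
  qed
qed

text \<open>\<open>B\<close> contains all neighbours of \<open>I\<close> in \<open>W\<close>, so an
  independent set found in \<open>W - B\<close> can be added to \<open>I\<close>, and the
  proportions on \<open>B\<close> and \<open>W - B\<close> add up. A local choice of
  \<open>I\<close> and \<open>B\<close> is thus enough.\<close>

lemma fractional_peel:
  assumes "finite U" and sym: "\<And>u v. E u v \<Longrightarrow> E v u"
    and "\<And>W w. W \<subseteq> U \<Longrightarrow> W \<noteq> {} \<Longrightarrow> \<forall>v\<in>W. 0 \<le> w v \<Longrightarrow>
      \<exists>I B. I \<subseteq> B \<and> B \<subseteq> W \<and> B \<noteq> {} \<and> indep E I \<and> (\<forall>x\<in>I. \<forall>y\<in>W. E x y \<longrightarrow> y \<in> B) \<and>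
        q * sum w B \<le> sum (w::'a \<Rightarrow> real) I"
  shows "fractional E q U"
proof -
  have "\<exists>I\<subseteq>W. indep E I \<and> q * sum w W \<le> sum w I"
    if "W \<subseteq> U" "\<forall>v\<in>W. 0 \<le> w v" for W w
    using that
  proof (induction "card W" arbitrary: W rule: less_induct)
    case less
    show ?case
    proof (cases "W = {}")
      case True
      then show ?thesis by (auto simp: indep_def)
    next
      case False
      have fW: "finite W" using less.prems(1) assms(1) by (rule finite_subset)
      obtain I B where B: "I \<subseteq> B" "B \<subseteq> W" "B \<noteq> {}" "indep E I"
        "\<forall>x\<in>I. \<forall>y\<in>W. E x y \<longrightarrow> y \<in> B" "q * sum w B \<le> sum w I"
        using assms(3)[where w = w, OF less.prems(1) False less.prems(2)] by (elim exE conjE)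
      have "W - B \<subset> W" using B by blast
      then have "card (W - B) < card W" using fW psubset_card_mono by blast
      then obtain J where J: "J \<subseteq> W - B" "indep E J" "q * sum w (W - B) \<le> sum w J"
      proof -
        have "W - B \<subseteq> U" "\<forall>v\<in>W - B. 0 \<le> w v" using less.prems by auto
        from less.hyps[OF \<open>card (W - B) < card W\<close> this] show ?thesis using that by blast
      qed
      have IJ: "I \<inter> J = {}" using B(1) J(1) by blast
      have fin: "finite I" "finite J"
        using finite_subset[OF _ fW] B(1,2) J(1) by (meson Diff_subset order_trans)+
      have "indep E (I \<union> J)"
        unfolding indep_def
      proof (intro ballI)
        have *: "\<not> E x y" if "x \<in> I" "y \<in> J" for x y
          using B(2,5) J(1) that by blast
        fix x y assume "x \<in> I \<union> J" "y \<in> I \<union> J"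
        then show "\<not> E x y" using * sym[of x y] B(4) J(2) unfolding indep_def by blast
      qed
      moreover have "sum w W = sum w (W - B) + sum w B"
        using B(2) fW by (simp add: sum.subset_diff)
      then have "q * sum w W \<le> sum w (I \<union> J)"
        using B(6) J(3) fin IJ by (simp add: sum.union_disjoint algebra_simps)
      ultimately show ?thesis using B J by (intro exI[of _ "I \<union> J"] conjI) auto
    qed
  qed
  then show ?thesis unfolding fractional_def by blast
qed

text \<open>A maximum independent set has fewer than \<open>t\<close> vertices and dominates
  \<open>U\<close>, while neighbourhoods contain no clique on \<open>a - 1\<close> vertices. The
  strict bound for neighbourhoods leaves room for the dominating vertex itself, which yields a pure
  power of \<open>t\<close>.\<close>

lemma ramsey_bound:
  assumes "finite U" "0 < t" and sym: "\<And>u v. E u v \<Longrightarrow> E v u" and irr: "\<And>u. \<not> E u u"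
    and "\<And>K. K \<subseteq> U \<Longrightarrow> card K = a \<Longrightarrow> \<exists>x\<in>K. \<exists>y\<in>K. x \<noteq> y \<and> \<not> E x y"
    and "\<And>I. I \<subseteq> U \<Longrightarrow> indep E I \<Longrightarrow> card I < t" and "0 < a"
  shows "card U < t ^ (a - 1)"
  using assms
proof (induction "a - 1" arbitrary: a U)
  case 0
  then have a: "a = 1" by simp
  have "U = {}"
  proof (rule ccontr)
    assume "U \<noteq> {}"
    then obtain x where "x \<in> U" by blast
    then show False using 0(6)[of "{x}"] a by auto
  qed
  then show ?case using a by simp
next
  case (Suc b)
  have ab: "a = Suc (Suc b)" using Suc by simp
  have nb: "card {y\<in>U. E x y} < t ^ b" if "x \<in> U" for x
  proof -
    have "card {y\<in>U. E x y} < t ^ (Suc b - 1)"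
    proof (rule Suc.hyps(1))
      show "finite {y\<in>U. E x y}" "0 < t" using Suc.prems by auto
      show "\<exists>u\<in>K. \<exists>v\<in>K. u \<noteq> v \<and> \<not> E u v" if K: "K \<subseteq> {y\<in>U. E x y}" "card K = Suc b" for K
      proof -
        have "finite K" using K card.infinite by fastforce
        moreover have "x \<notin> K" using K irr by auto
        ultimately have "card (insert x K) = a" using K ab by simp
        moreover have "insert x K \<subseteq> U" using K \<open>x \<in> U\<close> by auto
        ultimately obtain u v where "u \<in> insert x K" "v \<in> insert x K" "u \<noteq> v" "\<not> E u v"
          using Suc.prems(5) by blast
        then show ?thesis using K sym by (intro bexI[of _ u] bexI[of _ v]) auto
      qed
      show "card I < t" if "I \<subseteq> {y\<in>U. E x y}" "indep E I" for I
        using that by (intro Suc.prems(6)) auto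
    qed (use sym irr in auto)
    then show ?thesis by simp
  qed
  define P where "P = (\<lambda>I. I \<subseteq> U \<and> indep E I)"
  have "P {}" unfolding P_def indep_def by simp
  moreover have "\<forall>I. P I \<longrightarrow> card I < t" unfolding P_def using Suc.prems(6) by auto
  ultimately obtain I where I: "P I" "\<And>J. P J \<Longrightarrow> card J \<le> card I"
    using ex_has_greatest_nat[of P "{}" card t] by (meson less_imp_le)
  have fI: "finite I" using I(1) Suc.prems(1) finite_subset unfolding P_def by blast
  have cov: "U \<subseteq> (\<Union>x\<in>I. insert x {y\<in>U. E x y})"
  proof
    fix u assume u: "u \<in> U"
    show "u \<in> (\<Union>x\<in>I. insert x {y\<in>U. E x y})"
    proof (rule ccontr)
      assume n: "\<not> ?thesis"
      then have "P (insert u I)" using I(1) u irr sym unfolding P_def indep_def by auto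
      then have "card (insert u I) \<le> card I" by (rule I(2))
      moreover have "u \<notin> I" using n by auto
      ultimately show False using fI by simp
    qed
  qed
  have "card U \<le> card (\<Union>x\<in>I. insert x {y\<in>U. E x y})"
    using cov Suc.prems(1) fI by (intro card_mono) auto
  also have "\<dots> \<le> (\<Sum>x\<in>I. card (insert x {y\<in>U. E x y}))" using fI by (rule card_UN_le)
  also have "\<dots> \<le> (\<Sum>x\<in>I. t ^ b)"
  proof (rule sum_mono)
    fix x assume "x \<in> I"
    then have "card {y\<in>U. E x y} < t ^ b" using nb I(1) unfolding P_def by blast
    then show "card (insert x {y\<in>U. E x y}) \<le> t ^ b"
      using Suc.prems(1) irr by simp
  qed
  also have "\<dots> = card I * t ^ b" by simp
  also have "\<dots> < t * t ^ b"
    using I(1) Suc.prems(2,6) unfolding P_def by simp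
  finally show ?case using ab by simp
qed

text \<open>A heaviest vertex \<open>v\<close> is compared with its closed neighbourhood: by
  \<open>ramsey_bound\<close> for cliques of size \<open>r - 1\<close> this has at most
  \<open>t ^ (r - 2)\<close> vertices, none heavier than \<open>v\<close>.\<close>

lemma fractional_clique_free:
  assumes "finite U" "0 < t" and sym: "\<And>u v. E u v \<Longrightarrow> E v u" and irr: "\<And>u. \<not> E u u"
    and cf: "\<And>K. K \<subseteq> U \<Longrightarrow> card K = r \<Longrightarrow> \<exists>x\<in>K. \<exists>y\<in>K. x \<noteq> y \<and> \<not> E x y" and r: "2 \<le> r"
    and ind: "\<And>I. I \<subseteq> U \<Longrightarrow> indep E I \<Longrightarrow> card I < t"
  shows "fractional E (1 / real (t ^ (r - 2))) U"
proof (rule fractional_peel[OF assms(1) sym])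
  fix W and w :: "'a \<Rightarrow> real" assume W: "W \<subseteq> U" "W \<noteq> {}" "\<forall>v\<in>W. 0 \<le> w v"
  have fW: "finite W" using W(1) assms(1) by (rule finite_subset)
  obtain v where v: "v \<in> W" "\<And>u. u \<in> W \<Longrightarrow> w u \<le> w v"
    using obtains_MAX[OF fW W(2), of w] fW by (metis Max_ge finite_imageI image_eqI)
  let ?B = "insert v {y\<in>W. E v y}"
  have "card {y\<in>W. E v y} < t ^ (r - 1 - 1)"
  proof (rule ramsey_bound)
    show "finite {y\<in>W. E v y}" using fW by simp
    show "\<exists>x\<in>K. \<exists>y\<in>K. x \<noteq> y \<and> \<not> E x y" if K: "K \<subseteq> {y\<in>W. E v y}" "card K = r - 1" for K
    proof -
      have "finite K" using K fW finite_subset by fastforce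
      moreover have "v \<notin> K" using K irr by auto
      ultimately have "card (insert v K) = r" using K r by simp
      moreover have "insert v K \<subseteq> U" using K v W by auto
      ultimately obtain x y where "x \<in> insert v K" "y \<in> insert v K" "x \<noteq> y" "\<not> E x y"
        using cf by blast
      then show ?thesis using K sym by (intro bexI[of _ x] bexI[of _ y]) auto
    qed
    show "card I < t" if "I \<subseteq> {y\<in>W. E v y}" "indep E I" for I
      using that W by (intro ind) auto
  qed (use assms in auto)
  then have cB: "card ?B \<le> t ^ (r - 2)" using fW irr by (simp add: numeral_2_eq_2)
  have "sum w ?B \<le> real (card ?B) * w v" using v by (intro sum_bounded_above) auto
  also have "\<dots> \<le> real (t ^ (r - 2)) * w v" using cB W v by (intro mult_right_mono) auto
  finally have "1 / real (t ^ (r - 2)) * sum w ?B \<le> sum w {v}"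
    using assms(2) by (simp add: field_simps)
  then show "\<exists>I B. I \<subseteq> B \<and> B \<subseteq> W \<and> B \<noteq> {} \<and> indep E I \<and> (\<forall>x\<in>I. \<forall>y\<in>W. E x y \<longrightarrow> y \<in> B) \<and>
        1 / real (t ^ (r - 2)) * sum w B \<le> sum w I"
    using v irr by (intro exI[of _ "{v}"] exI[of _ ?B]) (auto simp: indep_def)
qed

subsection \<open>Closing paths to cycles through a layered tree\<close>

lemma strict_increasing_upto:
  fixes g :: "nat \<Rightarrow> nat"
  assumes "\<And>j. j < q \<Longrightarrow> g j < g (Suc j)" "a < b" "b \<le> q"
  shows "g a < g b"
  using assms(2,3)
proof (induction b)
  case (Suc b)
  then have "g b < g (Suc b)" using assms(1) by simp
  then show ?case using Suc by (cases "a = b") auto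
qed simp

text \<open>Lists replace the indexed form of \<open>has_cycle\<close> because the cycles arise by
  concatenating a path with two tree paths.\<close>

definition cycle_list :: "('a \<Rightarrow> 'a \<Rightarrow> bool) \<Rightarrow> 'a list \<Rightarrow> bool" where
  "cycle_list E xs \<longleftrightarrow> xs \<noteq> [] \<and> distinct xs \<and> successively E xs \<and> E (last xs) (hd xs)"

lemma cycle_list_has_cycle:
  assumes "cycle_list E xs" "set xs \<subseteq> {0..<n}"
  shows "has_cycle n E (length xs)"
proof -
  have "inj_on ((!) xs) {0..<length xs}"
    using assms(1) unfolding cycle_list_def by (simp add: inj_on_nth)
  moreover have "(!) xs ` {0..<length xs} \<subseteq> {0..<n}" using assms(2) nth_mem by fastforce
  moreover have "E (xs ! i) (xs ! ((i + 1) mod length xs))" if "i < length xs" for i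
  proof (cases "Suc i < length xs")
    case True
    then show ?thesis using assms(1) unfolding cycle_list_def successively_conv_nth by simp
  next
    case False
    then have "Suc i = length xs" using that by simp
    then have "i = length xs - 1" "(i + 1) mod length xs = 0" by auto
    then show ?thesis
      using assms(1) unfolding cycle_list_def by (metis One_nat_def hd_conv_nth last_conv_nth)
  qed
  ultimately show ?thesis unfolding has_cycle_def by blast
qed

text \<open>The tree consists of one chosen edge from each vertex to the preceding layer. The bound
  \<open>n\<close> on the vertex labels is the base of the numbers in \<open>key\<close>.\<close>

locale layered_tree =
  fixes E :: "nat \<Rightarrow> nat \<Rightarrow> bool" and N :: "nat \<Rightarrow> nat set" and par :: "nat \<Rightarrow> nat"
    and root n :: nat
  assumes sym: "E u v \<Longrightarrow> E v u"
    and layer_0: "N 0 = {root}"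
    and layers_disjoint: "i \<noteq> j \<Longrightarrow> N i \<inter> N j = {}"
    and par: "u \<in> N (Suc j) \<Longrightarrow> par u \<in> N j \<and> E u (par u)"
    and layer_less: "N j \<subseteq> {0..<n}"
begin

text \<open>The base-\<open>n\<close> number whose digits are the labels on the tree path from the root. Dividing by
  \<open>n ^ d\<close> passes to the ancestor \<open>d\<close> levels up, so in this order the descendants of a
  vertex within a layer form an interval.\<close>
primrec key :: "nat \<Rightarrow> nat \<Rightarrow> nat" where
  "key 0 x = 0"
| "key (Suc j) x = key j (par x) * n + x"

lemma ancestor_in_layer: "x \<in> N i \<Longrightarrow> d \<le> i \<Longrightarrow> (par ^^ d) x \<in> N (i - d)"
proof (induction d)
  case (Suc d)
  then have "(par ^^ d) x \<in> N (Suc (i - Suc d))" by (simp add: Suc_diff_Suc)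
  then show ?case using par by simp
qed simp

lemma key_div: "x \<in> N i \<Longrightarrow> d \<le> i \<Longrightarrow> key i x div n ^ d = key (i - d) ((par ^^ d) x)"
proof (induction d arbitrary: i x)
  case (Suc d)
  then obtain i' where i: "i = Suc i'" by (cases i) auto
  have x: "x < n" using Suc.prems(1) layer_less by fastforce
  have p: "par x \<in> N i'" using Suc.prems(1) par unfolding i by blast
  have "key i x div n ^ Suc d = (key i' (par x) * n + x) div n div n ^ d"
    unfolding i by (simp add: div_mult2_eq)
  also have "(key i' (par x) * n + x) div n = key i' (par x)" using x by simp
  also have "key i' (par x) div n ^ d = key (i' - d) ((par ^^ d) (par x))"
    using Suc.IH[OF p] Suc.prems(2) i by simp
  finally show ?case unfolding i by (simp add: funpow_swap1)
qed simp

lemma key_inj: "x \<in> N i \<Longrightarrow> y \<in> N i \<Longrightarrow> key i x = key i y \<Longrightarrow> x = y"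
proof (cases i)
  case 0
  then show "x \<in> N i \<Longrightarrow> y \<in> N i \<Longrightarrow> x = y" using layer_0 by simp
next
  case (Suc j)
  assume *: "x \<in> N i" "y \<in> N i" "key i x = key i y"
  have "x < n" "y < n" using * layer_less by fastforce+
  then have "key i x mod n = x" "key i y mod n = y" unfolding Suc by simp_all
  then show "x = y" using *(3) by metis
qed

text \<open>On a key-increasing sequence the first and last entries have the least common ancestor of
  the greatest height \<open>d\<close>; this height is attained between some two consecutive entries, hence by
  every window around them.\<close>
lemma window:
  assumes "\<And>j. j \<le> q \<Longrightarrow> f j \<in> N i" and "\<And>j. j < q \<Longrightarrow> key i (f j) < key i (f (Suc j))" and "1 \<le> q"
    and len: "\<And>d. 1 \<le> d \<Longrightarrow> d \<le> i \<Longrightarrow> 1 \<le> len d \<and> len d \<le> q"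
  obtains d a where "1 \<le> d" "d \<le> i" "a + len d \<le> q"
    "(par ^^ d) (f a) = (par ^^ d) (f (a + len d))"
    "(par ^^ (d - 1)) (f a) \<noteq> (par ^^ (d - 1)) (f (a + len d))"
proof -
  let ?P = "\<lambda>d. key i (f 0) div n ^ d = key i (f q) div n ^ d"
  have mono: "key i (f a) \<le> key i (f b)" if "a \<le> b" "b \<le> q" for a b
    using strict_increasing_upto[of q "\<lambda>j. key i (f j)" a b] assms(2) that
    by (cases "a = b") auto
  \<comment> \<open>At height \<open>i\<close> every vertex of the layer has the root as its
    ancestor.\<close>
  have "?P i" using key_div[of "f 0" i i] key_div[of "f q" i i] assms(1) by simp
  define d where "d = (LEAST d. ?P d)"
  have d: "?P d" "d \<le> i" unfolding d_def using \<open>?P i\<close> by (auto intro: LeastI Least_le)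
  have "key i (f 0) < key i (f q)"
    using strict_increasing_upto[of q "\<lambda>j. key i (f j)" 0 q] assms(2,3) by simp
  then have d1: "1 \<le> d" using d(1) by (cases d) auto
  then have nP: "\<not> ?P (d - 1)" using not_less_Least[of "d - 1" ?P] unfolding d_def[symmetric] by simp
  define g where "g = (\<lambda>j. key i (f j) div n ^ (d - 1))"
  have gm: "g a \<le> g b" if "a \<le> b" "b \<le> q" for a b
    unfolding g_def using mono[OF that] by (rule div_le_mono)
  have "\<exists>j<q. g j < g (Suc j)"
  proof (rule ccontr)
    assume "\<not> ?thesis"
    then have eq: "g (Suc j) = g j" if "j < q" for j using gm[of j "Suc j"] that by force
    have "j \<le> q \<Longrightarrow> g j = g 0" for j by (induction j) (simp_all add: eq)
    then have "g q = g 0" by blast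
    then show False using nP unfolding g_def by simp
  qed
  then obtain j where j: "j < q" "g j < g (Suc j)" by blast
  have l: "1 \<le> len d" "len d \<le> q" using len[OF d1 d(2)] by auto
  \<comment> \<open>The window has to contain both \<open>j\<close> and \<open>Suc j\<close> and to
    end by \<open>q\<close>; the minimum shifts it to the left near the end of the sequence.\<close>
  define a where "a = min j (q - len d)"
  have a: "a \<le> j" "a + len d \<le> q" "Suc j \<le> a + len d" unfolding a_def using l j by auto
  have "g a < g (a + len d)" using gm[of a j] gm[of "Suc j" "a + len d"] a j by simp
  then have ne: "(par ^^ (d - 1)) (f a) \<noteq> (par ^^ (d - 1)) (f (a + len d))"
    unfolding g_def using key_div[of _ i "d - 1"] assms(1) a d(2) by auto
  have "key i (f a) div n ^ d = key i (f (a + len d)) div n ^ d"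
    using d(1) div_le_mono[OF mono[of 0 a]] div_le_mono[OF mono[of a "a + len d"]]
      div_le_mono[OF mono[of "a + len d" q]] a
    by (metis le_add1 le_antisym le_trans le_refl zero_le)
  then have "key (i - d) ((par ^^ d) (f a)) = key (i - d) ((par ^^ d) (f (a + len d)))"
    using key_div[of _ i d] assms(1) a d(2) by auto
  then have "(par ^^ d) (f a) = (par ^^ d) (f (a + len d))"
    using key_inj ancestor_in_layer assms(1) a d(2) by (metis le_add1 le_trans)
  then show ?thesis using that d1 d(2) a ne by blast
qed

text \<open>Ancestors that agree at some height agree at all greater ones, so differing at height
  \<open>d - 1\<close> keeps the two tree paths disjoint up to the common ancestor. They avoid
  \<open>P\<close>, which meets no layer before \<open>i\<close>. The cycle has the edges of
  \<open>P\<close> and \<open>d\<close> edges from each tree path.\<close>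

lemma path_closes_to_cycle:
  assumes P: "P \<noteq> []" "distinct P" "successively E P" and ends: "hd P \<in> N i" "last P \<in> N i"
    and low: "\<And>j. j < i \<Longrightarrow> set P \<inter> N j = {}" and d: "1 \<le> d" "d \<le> i"
    and eq: "(par ^^ d) (hd P) = (par ^^ d) (last P)"
    and ne: "(par ^^ (d - 1)) (hd P) \<noteq> (par ^^ (d - 1)) (last P)"
  shows "\<exists>xs. cycle_list E xs \<and> length xs = length P - 1 + 2 * d \<and> set xs \<subseteq> set P \<union> (\<Union>j. N j)"
proof -
  define x where "x = hd P"
  define y where "y = last P"
  \<comment> \<open>\<open>Q\<close> climbs from \<open>y\<close> up to and including the common
    ancestor, \<open>R\<close> from \<open>x\<close> stops just before it, so that the ancestor is
    listed once.\<close>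
  define Q where "Q = map (\<lambda>j. (par ^^ j) y) [1..<d + 1]"
  define R where "R = map (\<lambda>j. (par ^^ j) x) [1..<d]"
  have xy: "x \<in> N i" "y \<in> N i" "(par ^^ d) x = (par ^^ d) y"
    "(par ^^ (d - 1)) x \<noteq> (par ^^ (d - 1)) y"
    using ends eq ne unfolding x_def y_def by auto
  have anc: "(par ^^ j) x \<in> N (i - j)" "(par ^^ j) y \<in> N (i - j)" if "j \<le> d" for j
    using ancestor_in_layer xy that d by auto
  have step: "E ((par ^^ j) x) ((par ^^ Suc j) x)" "E ((par ^^ j) y) ((par ^^ Suc j) y)" if "j < d" for j
    using anc[of j] par[of _ "i - Suc j"] that d by (auto simp: Suc_diff_Suc)
  have layer_eq: "j = j'" if "j \<le> d" "j' \<le> d" "a \<in> N (i - j)" "a \<in> N (i - j')" for j j' a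
  proof -
    have "i - j = i - j'" using layers_disjoint[of "i - j" "i - j'"] that by blast
    then show ?thesis using that d by simp
  qed
  have "inj_on (\<lambda>j. (par ^^ j) y) {1..<d + 1}"
  proof (rule inj_onI)
    fix j j' assume "j \<in> {1..<d + 1}" "j' \<in> {1..<d + 1}" "(par ^^ j) y = (par ^^ j') y"
    then show "j = j'" using layer_eq[of j j' "(par ^^ j) y"] anc(2)[of j] anc(2)[of j'] by simp
  qed
  then have dQ: "distinct Q" unfolding Q_def distinct_map set_upt by simp
  have "inj_on (\<lambda>j. (par ^^ j) x) {1..<d}"
  proof (rule inj_onI)
    fix j j' assume "j \<in> {1..<d}" "j' \<in> {1..<d}" "(par ^^ j) x = (par ^^ j') x"
    then show "j = j'" using layer_eq[of j j' "(par ^^ j) x"] anc(1)[of j] anc(1)[of j'] by simp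
  qed
  then have dR: "distinct R" unfolding R_def distinct_map set_upt by simp
  have QR: "set Q \<inter> set R = {}"
  proof (rule ccontr)
    assume "\<not> ?thesis"
    then obtain j j' where j: "j \<le> d" "1 \<le> j'" "j' < d" "(par ^^ j) y = (par ^^ j') x"
      unfolding Q_def R_def by (fastforce simp del: upt_Suc)
    then have "j = j'" using anc(1)[of j'] anc(2)[of j] by (intro layer_eq[of j j' "(par ^^ j) y"]) auto
    then have "(par ^^ (d - 1 - j')) ((par ^^ j') x) = (par ^^ (d - 1 - j')) ((par ^^ j') y)"
      using j by simp
    then have "(par ^^ (d - 1)) x = (par ^^ (d - 1)) y"
      using j unfolding funpow_add[THEN fun_cong, unfolded o_apply, symmetric] by simp
    then show False using xy by simp
  qed
  have lowQR: "a \<in> (\<Union>j<i. N j)" if "a \<in> set Q \<union> set R" for a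
  proof -
    have "\<exists>j. 1 \<le> j \<and> j \<le> d \<and> (a = (par ^^ j) y \<or> a = (par ^^ j) x)"
      using that d(1) unfolding Q_def R_def set_map set_upt by auto
    then obtain j where "1 \<le> j" "j \<le> d" "a \<in> N (i - j)" using anc by blast
    moreover from this have "i - j < i" using d by simp
    ultimately show ?thesis by blast
  qed
  then have PQR: "set P \<inter> (set Q \<union> set R) = {}" using low by blast
  have sQ: "successively E Q" unfolding Q_def successively_conv_nth
    using step(2) by (auto simp del: upt_Suc funpow.simps)
  have sR: "successively E (rev R)"
  proof -
    have "successively E R" unfolding R_def successively_conv_nth
      using step(1) by (auto simp del: upt_Suc funpow.simps)
    then have "successively (\<lambda>x y. E y x) R" using sym by (rule successively_mono) auto
    then show ?thesis by (simp add: successively_rev)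
  qed
  have Qne: "Q \<noteq> []" "hd Q = par y" "last Q = (par ^^ d) x"
    unfolding Q_def using d xy by (auto simp: hd_map last_map simp del: upt_Suc)
  have conn: "E (last Q) (last R)" if "R \<noteq> []"
  proof -
    have "last R = (par ^^ (d - 1)) x" "1 < d" using that unfolding R_def by (auto simp: last_map)
    then show ?thesis using step(1)[of "d - 1"] sym Qne by simp
  qed
  define xs where "xs = P @ Q @ rev R"
  have l: "last xs = par x"
  proof (cases "R = []")
    case True
    then have "d = 1" using d unfolding R_def by simp
    then show ?thesis using True Qne unfolding xs_def by simp
  next
    case False
    then have "hd R = par x" unfolding R_def by (auto simp: hd_map)
    then show ?thesis using False unfolding xs_def by (simp add: last_rev)
  qed
  have "cycle_list E xs" unfolding cycle_list_def
  proof (intro conjI)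
    show "xs \<noteq> []" using P unfolding xs_def by simp
    show "distinct xs" using P dQ dR QR PQR unfolding xs_def by auto
    show "successively E xs"
      unfolding xs_def using P sQ sR Qne conn step(2)[of 0] d
      by (auto simp: successively_append_iff hd_rev y_def)
    show "E (last xs) (hd xs)"
      unfolding l using P step(1)[of 0] d sym unfolding xs_def by (simp add: x_def)
  qed
  moreover have "length xs = length P - 1 + 2 * d"
    using d P unfolding xs_def Q_def R_def by (cases P) auto
  moreover have "set xs \<subseteq> set P \<union> (\<Union>j. N j)" using lowQR unfolding xs_def by auto
  ultimately show ?thesis by blast
qed

lemma key_increasing_inj:
  assumes "\<And>j. j < q \<Longrightarrow> key i (f j) < key i (f (Suc j))" "b \<le> q"
  shows "inj_on f {a..b}"
proof (rule inj_onI)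
  fix x y assume *: "x \<in> {a..b}" "y \<in> {a..b}" "f x = f y"
  show "x = y"
  proof (rule ccontr)
    assume "x \<noteq> y"
    then consider "x < y" | "y < x" by linarith
    then show False
      using strict_increasing_upto[of q "\<lambda>j. key i (f j)", OF assms(1)] * assms(2)
      by cases fastforce+
  qed
qed

text \<open>A window of \<open>2 * l + 1 - 2 * d\<close> edges leaves exactly \<open>2 * d\<close>
  edges for the two tree paths. Its length is positive for all heights \<open>d \<le> i\<close>
  because \<open>i \<le> l\<close>, and at most \<open>2 * l - 1\<close> because
  \<open>1 \<le> d\<close>.\<close>

lemma no_long_increasing_path:
  assumes free: "\<And>xs. cycle_list E xs \<Longrightarrow> set xs \<subseteq> (\<Union>j. N j) \<Longrightarrow> length xs \<noteq> 2 * l + 1"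
    and "1 \<le> l" "i \<le> l" "2 * l - 1 \<le> q" and f: "\<And>j. j \<le> q \<Longrightarrow> f j \<in> N i"
    and inc: "\<And>j. j < q \<Longrightarrow> key i (f j) < key i (f (Suc j))"
    and adj: "\<And>j. j < q \<Longrightarrow> E (f j) (f (Suc j))"
  shows False
proof -
  let ?len = "\<lambda>d. 2 * l + 1 - 2 * d"
  have q1: "1 \<le> q" using assms(2,4) by simp
  have len: "1 \<le> ?len d \<and> ?len d \<le> q" if "1 \<le> d" "d \<le> i" for d
    using that assms(3,4) by auto
  obtain d a where d: "1 \<le> d" "d \<le> i" "a + ?len d \<le> q"
    "(par ^^ d) (f a) = (par ^^ d) (f (a + ?len d))"
    "(par ^^ (d - 1)) (f a) \<noteq> (par ^^ (d - 1)) (f (a + ?len d))"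
    by (rule window[where f = f and len = ?len, OF f inc q1 len])
  define b where "b = a + ?len d"
  have ab: "a < b" "b \<le> q" unfolding b_def using d assms(3) by auto
  define P where "P = map f [a..<Suc b]"
  have hl: "P \<noteq> []" "hd P = f a" "last P = f b" unfolding P_def using ab
    by (auto simp: hd_map last_map simp del: upt_Suc)
  have sP: "set P \<subseteq> N i" using f ab unfolding P_def by auto
  have "\<exists>xs. cycle_list E xs \<and> length xs = length P - 1 + 2 * d \<and> set xs \<subseteq> set P \<union> (\<Union>j. N j)"
  proof (rule path_closes_to_cycle)
    show "distinct P" unfolding P_def distinct_map
      using key_increasing_inj[of q i f b a] inc ab by (simp add: atLeastLessThanSuc_atLeastAtMost del: upt_Suc)
    show "successively E P" unfolding P_def successively_conv_nth
      using adj ab by (auto simp del: upt_Suc)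
    show "set P \<inter> N j = {}" if "j < i" for j using sP layers_disjoint[of i j] that by auto
    show "hd P \<in> N i" "last P \<in> N i" using f ab hl by auto
    show "(par ^^ d) (hd P) = (par ^^ d) (last P)"
      "(par ^^ (d - 1)) (hd P) \<noteq> (par ^^ (d - 1)) (last P)"
      using d(4,5) unfolding hl b_def .
    show "P \<noteq> []" "1 \<le> d" "d \<le> i" using hl(1) d(1,2) .
  qed
  moreover have "length P - 1 + 2 * d = 2 * l + 1"
    unfolding P_def b_def using d assms(3) by simp
  ultimately obtain xs where xs: "cycle_list E xs" "length xs = 2 * l + 1"
    "set xs \<subseteq> set P \<union> (\<Union>j. N j)" by auto
  then have "set xs \<subseteq> (\<Union>j. N j)" using sP by blast
  then show False using free xs by blast
qed

text \<open>The colour of a vertex is the length of a longest key-increasing path ending there.\<close>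
lemma odd_layer_colouring:
  assumes free: "\<And>xs. cycle_list E xs \<Longrightarrow> set xs \<subseteq> (\<Union>j. N j) \<Longrightarrow> length xs \<noteq> 2 * l + 1"
    and "1 \<le> l" "i \<le> l" and irr: "\<And>x. \<not> E x x"
  obtains col :: "nat \<Rightarrow> nat" where "\<And>x. x \<in> N i \<Longrightarrow> col x < 2 * l - 1"
    "\<And>x y. x \<in> N i \<Longrightarrow> y \<in> N i \<Longrightarrow> E x y \<Longrightarrow> col x \<noteq> col y"
proof -
  define R where "R = (\<lambda>x q. \<exists>f. f q = x \<and> (\<forall>j\<le>q. f j \<in> N i) \<and>
    (\<forall>j<q. key i (f j) < key i (f (Suc j)) \<and> E (f j) (f (Suc j))))"
  have bnd: "q < 2 * l - 1" if R: "R x q" for x q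
  proof (rule ccontr)
    assume "\<not> q < 2 * l - 1"
    then have q: "2 * l - 1 \<le> q" by simp
    obtain f where "\<forall>j\<le>q. f j \<in> N i"
      "\<forall>j<q. key i (f j) < key i (f (Suc j)) \<and> E (f j) (f (Suc j))"
      using R unfolding R_def by blast
    then show False
      by (intro no_long_increasing_path[where l = l and i = i and f = f and q = q, OF free assms(2,3) q]) auto
  qed
  define col where "col = (\<lambda>x. GREATEST q. R x q)"
  have R0: "R x 0" if "x \<in> N i" for x unfolding R_def using that by (intro exI[of _ "\<lambda>_. x"]) simp
  have bnd': "\<forall>q. R x q \<longrightarrow> q \<le> 2 * l" for x using bnd[of x] by fastforce
  have col: "R x (col x)" if "x \<in> N i" for x
    unfolding col_def by (rule GreatestI_nat[where P = "R x" and k = 0 and b = "2 * l"]) (use R0[OF that] bnd' in auto)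
  have ge: "q \<le> col x" if "R x q" for x q
    unfolding col_def by (rule Greatest_le_nat[where P = "R x" and b = "2 * l"]) (use that bnd' in auto)
  \<comment> \<open>This is the Gallai-Roy argument for the orientation of the layer by increasing
    key: a longest path to \<open>x\<close> extends along the edge to \<open>y\<close>, with
    increasing keys excluding a repetition.\<close>
  have less: "col x < col y" if xy: "x \<in> N i" "y \<in> N i" "E x y" "key i x < key i y" for x y
  proof -
    obtain f where f: "f (col x) = x" "\<And>j. j \<le> col x \<Longrightarrow> f j \<in> N i"
      "\<And>j. j < col x \<Longrightarrow> key i (f j) < key i (f (Suc j)) \<and> E (f j) (f (Suc j))"
      using col[OF xy(1)] unfolding R_def by blast
    have "R y (Suc (col x))" unfolding R_def
      using f xy by (intro exI[of _ "f(Suc (col x) := y)"]) (auto simp: less_Suc_eq)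
    then show ?thesis using ge by fastforce
  qed
  show ?thesis
  proof (rule that[of col])
    show "col x < 2 * l - 1" if "x \<in> N i" for x using bnd col that by blast
    show "col x \<noteq> col y" if "x \<in> N i" "y \<in> N i" "E x y" for x y
    proof -
      have "key i x \<noteq> key i y" using key_inj[OF that(1,2)] that(3) irr by auto
      then show ?thesis using less[of x y] less[of y x] that sym by (metis less_irrefl linorder_neqE_nat)
    qed
  qed
qed

end

subsection \<open>Breadth-first layers and odd cycles\<close>

primrec ball :: "('a \<Rightarrow> 'a \<Rightarrow> bool) \<Rightarrow> 'a set \<Rightarrow> 'a \<Rightarrow> nat \<Rightarrow> 'a set" where
  "ball E U v 0 = {v}"
| "ball E U v (Suc j) = ball E U v j \<union> {u\<in>U. \<exists>b\<in>ball E U v j. E b u}"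

text \<open>The case \<open>j = 0\<close> is separate because \<open>0 - 1 = 0\<close> would make
  the difference of balls empty.\<close>

definition layer :: "('a \<Rightarrow> 'a \<Rightarrow> bool) \<Rightarrow> 'a set \<Rightarrow> 'a \<Rightarrow> nat \<Rightarrow> 'a set" where
  "layer E U v j = (if j = 0 then {v} else ball E U v j - ball E U v (j - 1))"

lemma ball_mono: "i \<le> j \<Longrightarrow> ball E U v i \<subseteq> ball E U v j"
  by (rule lift_Suc_mono_le[of "ball E U v"]) auto

lemma ball_subset: "v \<in> U \<Longrightarrow> ball E U v j \<subseteq> U"
  by (induction j) auto

lemma layer_subset_ball: "layer E U v j \<subseteq> ball E U v j"
  unfolding layer_def by auto

lemma ball_eq_layers: "ball E U v j = (\<Union>i\<le>j. layer E U v i)"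
proof (induction j)
  case (Suc j)
  have "ball E U v (Suc j) = ball E U v j \<union> layer E U v (Suc j)"
    unfolding layer_def by auto
  then show ?case using Suc by (simp add: atMost_Suc Un_commute del: ball.simps)
qed (simp add: layer_def)

lemma layer_disjoint:
  assumes "i \<noteq> j" shows "layer E U v i \<inter> layer E U v j = {}"
proof -
  have *: "layer E U v i \<inter> layer E U v j = {}" if "i < j" for i j
  proof -
    have "layer E U v i \<subseteq> ball E U v (j - 1)"
    proof -
      have "i \<le> j - 1" using that by simp
      then show ?thesis using layer_subset_ball ball_mono by (metis subset_trans)
    qed
    then show ?thesis using that unfolding layer_def[of E U v j] by auto
  qed
  show ?thesis using *[of i j] *[of j i] assms by (cases "i < j") auto
qed

lemma layer_parent:
  assumes "u \<in> layer E U v (Suc j)" shows "\<exists>p\<in>layer E U v j. E p u"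
proof -
  obtain b where b: "b \<in> ball E U v j" "E b u" "u \<notin> ball E U v j" "u \<in> U"
    using assms unfolding layer_def by auto
  have "b \<in> layer E U v j"
  proof (cases j)
    case (Suc i)
    have "b \<notin> ball E U v i" using b(2-4) unfolding Suc by auto
    then show ?thesis using b(1) unfolding layer_def Suc by simp
  qed (use b in \<open>simp add: layer_def\<close>)
  then show ?thesis using b by blast
qed

lemma layer_neighbour:
  assumes "x \<in> layer E U v i" "y \<in> U" "E x y"
  shows "\<exists>j\<le>Suc i. y \<in> layer E U v j"
proof -
  have "y \<in> ball E U v (Suc i)" using assms layer_subset_ball by fastforce
  then show ?thesis unfolding ball_eq_layers by blast
qed

lemma layered_tree_bfs:
  assumes sym: "\<And>u v. E u v \<Longrightarrow> E v u" and "U \<subseteq> {0..<n}" "v \<in> U"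
  shows "\<exists>par. layered_tree E (layer E U v) par v n"
proof -
  \<comment> \<open>The choice does not fix the index of the layer; disjointness of the layers
    identifies whichever index it used with the given one.\<close>
  define par where "par = (\<lambda>u. SOME p. \<exists>j. u \<in> layer E U v (Suc j) \<and> p \<in> layer E U v j \<and> E p u)"
  have "layered_tree E (layer E U v) par v n"
  proof
    show "layer E U v 0 = {v}" by (simp add: layer_def)
    show "layer E U v j \<subseteq> {0..<n}" for j
      using layer_subset_ball[of E U v j] ball_subset[OF assms(3), of E j] assms(2) by simp
    show "par u \<in> layer E U v j \<and> E u (par u)" if u: "u \<in> layer E U v (Suc j)" for u j
    proof -
      have "\<exists>p. \<exists>j. u \<in> layer E U v (Suc j) \<and> p \<in> layer E U v j \<and> E p u"
        using u layer_parent by fast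
      from someI_ex[OF this] obtain j' where j':
        "u \<in> layer E U v (Suc j')" "par u \<in> layer E U v j'" "E (par u) u"
        unfolding par_def by blast
      then have "j' = j" using layer_disjoint[of "Suc j" "Suc j'" E U v] u by blast
      then show ?thesis using j' sym by blast
    qed
    show "layer E U v i \<inter> layer E U v j = {}" if "i \<noteq> j" for i j
      using that by (rule layer_disjoint)
  qed (rule sym)
  then show ?thesis by blast
qed

text \<open>By \<open>odd_layer_colouring\<close> the ball of radius \<open>l\<close> around a
  heaviest vertex is a union of \<open>(l + 1) * (2 * l - 1)\<close> independent classes, so it has
  at most \<open>\<rho> ^ l\<close> vertices, none heavier than the centre. Its weight thus cannot
  grow by more than the factor \<open>\<rho>\<close> in each of the \<open>l\<close> steps. At a
  radius \<open>i < l\<close> where it does not, a heaviest of the at most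
  \<open>l * (2 * l - 1)\<close> classes in the ball is the set to peel off: its neighbours lie in
  the next ball.\<close>

lemma fractional_odd_cycle_free:
  fixes E :: "nat \<Rightarrow> nat \<Rightarrow> bool"
  assumes U: "U \<subseteq> {0..<n}" and sym: "\<And>u v. E u v \<Longrightarrow> E v u" and irr: "\<And>u. \<not> E u u"
    and free: "\<And>xs. cycle_list E xs \<Longrightarrow> set xs \<subseteq> U \<Longrightarrow> length xs \<noteq> 2 * l + 1" and l: "1 \<le> l"
    and ind: "\<And>I. I \<subseteq> U \<Longrightarrow> indep E I \<Longrightarrow> card I < t"
    and \<rho>: "0 < \<rho>" "real ((l + 1) * (2 * l - 1) * t) \<le> \<rho> ^ l"
  shows "fractional E (1 / (real (l * (2 * l - 1)) * \<rho>)) U"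
proof -
  have fU: "finite U" using U by (rule finite_subset) simp
  show ?thesis
  proof (rule fractional_peel[OF fU sym])
    fix W and w :: "nat \<Rightarrow> real" assume W: "W \<subseteq> U" "W \<noteq> {}" "\<forall>v\<in>W. 0 \<le> w v"
    have fW: "finite W" using W(1) fU by (rule finite_subset)
    obtain v where v: "v \<in> W" "\<And>u. u \<in> W \<Longrightarrow> w u \<le> w v"
      using obtains_MAX[OF fW W(2), of w] fW by (metis Max_ge finite_imageI image_eqI)
    define N where "N = layer E W v"
    define B where "B = ball E W v"
    have BW: "B i \<subseteq> W" for i unfolding B_def using ball_subset[OF v(1)] .
    have NW: "N i \<subseteq> W" for i using layer_subset_ball[of E W v i] BW unfolding N_def B_def by blast
    obtain par where "layered_tree E N par v n"
      using layered_tree_bfs[of E W n v] sym v W U unfolding N_def by blast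
    then interpret layered_tree E N par v n .
    have "\<exists>col. (\<forall>x\<in>N i. col x < 2 * l - 1) \<and> (\<forall>x\<in>N i. \<forall>y\<in>N i. E x y \<longrightarrow> col x \<noteq> (col y :: nat))"
      if "i \<le> l" for i
    proof -
      have "length xs \<noteq> 2 * l + 1" if "cycle_list E xs" "set xs \<subseteq> (\<Union>j. N j)" for xs
        using free[OF that(1)] that(2) NW W(1) by blast
      from odd_layer_colouring[OF this l \<open>i \<le> l\<close> irr] show ?thesis by (metis (full_types))
    qed
    then obtain col :: "nat \<Rightarrow> nat \<Rightarrow> nat" where col:
      "\<And>i x. i \<le> l \<Longrightarrow> x \<in> N i \<Longrightarrow> col i x < 2 * l - 1"
      "\<And>i x y. i \<le> l \<Longrightarrow> x \<in> N i \<Longrightarrow> y \<in> N i \<Longrightarrow> E x y \<Longrightarrow> col i x \<noteq> col i y" by metis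
    define K where "K = (\<lambda>(i, a). {x\<in>N i. col i x = a})"
    have indK: "indep E (K (i, a))" if "i \<le> l" for i a
      unfolding indep_def
    proof (intro ballI)
      fix x y assume "x \<in> K (i, a)" "y \<in> K (i, a)"
      then have "x \<in> N i" "y \<in> N i" "col i x = col i y" unfolding K_def by auto
      then show "\<not> E x y" using col(2)[OF that] by blast
    qed
    have KW: "K p \<subseteq> W" for p
    proof (cases p)
      case (Pair i a)
      then show ?thesis using NW[of i] unfolding K_def by auto
    qed
    have Beq: "B i = (\<Union>p\<in>{..i} \<times> {..<2 * l - 1}. K p)" if "i \<le> l" for i
    proof -
      have "N j = (\<Union>a<2 * l - 1. K (j, a))" if "j \<le> l" for j
        using col(1)[OF that] unfolding K_def by auto
      then have "(\<Union>j\<le>i. N j) = (\<Union>j\<le>i. \<Union>a<2 * l - 1. K (j, a))" using that by simp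
      then show ?thesis unfolding B_def ball_eq_layers N_def[symmetric] by auto
    qed
    have "card (B l) \<le> (\<Sum>p\<in>{..l} \<times> {..<2 * l - 1}. card (K p))"
      unfolding Beq[OF order_refl] by (rule card_UN_le) simp
    also have "\<dots> \<le> (\<Sum>p\<in>{..l} \<times> {..<2 * l - 1}. t)"
    proof (rule sum_mono)
      fix p assume "p \<in> {..l} \<times> {..<2 * l - 1}"
      then have "indep E (K p)" using indK by auto
      then show "card (K p) \<le> t" using ind[of "K p"] KW[of p] W(1) by (meson less_imp_le subset_trans)
    qed
    also have "\<dots> = (l + 1) * (2 * l - 1) * t" by simp
    finally have cB: "real (card (B l)) \<le> \<rho> ^ l" using \<rho>(2) by linarith
    have "sum w (B l) \<le> real (card (B l)) * w v" using v BW by (intro sum_bounded_above) blast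
    also have "\<dots> \<le> \<rho> ^ l * w v" using cB W v by (intro mult_right_mono) auto
    finally have wB: "sum w (B l) \<le> \<rho> ^ l * w v" .
    have "\<exists>i<l. sum w (B (Suc i)) \<le> \<rho> * sum w (B i)"
    proof (rule ccontr)
      assume "\<not> ?thesis"
      then have g: "\<rho> * sum w (B i) < sum w (B (Suc i))" if "i < l" for i using that by force
      have "\<rho> ^ i * w v \<le> sum w (B i)" if "i \<le> l" for i
        using that
      proof (induction i)
        case (Suc i)
        have "\<rho> * (\<rho> ^ i * w v) \<le> \<rho> * sum w (B i)" using Suc \<rho>(1) by (intro mult_left_mono) auto
        also have "\<dots> \<le> sum w (B (Suc i))" using g[of i] Suc by simp
        finally show ?case by (simp add: mult.assoc)
      qed (simp add: B_def)
      from this[of "l - 1"] have "\<rho> * (\<rho> ^ (l - 1) * w v) \<le> \<rho> * sum w (B (l - 1))"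
        using \<rho>(1) by (intro mult_left_mono) auto
      also have "\<dots> < sum w (B l)" using g[of "l - 1"] l by simp
      finally show False using wB l by (cases l) (auto simp: mult.assoc)
    qed
    then obtain i where i: "i < l" "sum w (B (Suc i)) \<le> \<rho> * sum w (B i)" by blast
    let ?m = "real (l * (2 * l - 1))"
    have m0: "0 < ?m" using l by simp
    have "\<exists>p\<in>{..i} \<times> {..<2 * l - 1}. sum w (B i) / ?m \<le> sum w (K p)"
    proof (rule ccontr)
      assume "\<not> ?thesis"
      then have s: "(\<Sum>p\<in>{..i} \<times> {..<2 * l - 1}. sum w (K p)) <
          real (card ({..i} \<times> {..<2 * l - 1})) * (sum w (B i) / ?m)"
      proof (intro sum_bounded_above_strict)
        show "sum w (K p) < sum w (B i) / ?m" if "p \<in> {..i} \<times> {..<2 * l - 1}" for p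
          using \<open>\<not> (\<exists>p\<in>_. _)\<close> that by (meson not_le)
        show "0 < card ({..i} \<times> {..<2 * l - 1})" using l by (simp add: card_cartesian_product)
      qed
      have "sum w (B i) \<le> (\<Sum>p\<in>{..i} \<times> {..<2 * l - 1}. sum w (K p))"
      proof -
        have "sum w (B i) = sum w (\<Union>p\<in>{..i} \<times> {..<2 * l - 1}. K p)" using Beq i by simp
        also have "\<dots> = (\<Sum>p\<in>{..i} \<times> {..<2 * l - 1}. sum w (K p))"
        proof (rule sum.UNION_disjoint)
          show "\<forall>p\<in>{..i} \<times> {..<2 * l - 1}. finite (K p)"
            using finite_subset[OF KW fW] by simp
          show "\<forall>p\<in>{..i} \<times> {..<2 * l - 1}. \<forall>p'\<in>{..i} \<times> {..<2 * l - 1}. p \<noteq> p' \<longrightarrow> K p \<inter> K p' = {}"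
          proof (intro ballI impI)
            fix p p' :: "nat \<times> nat" assume "p \<noteq> p'"
            obtain i a where p: "p = (i, a)" by (cases p)
            obtain i' a' where p': "p' = (i', a')" by (cases p')
            show "K p \<inter> K p' = {}"
            proof (cases "i = i'")
              case True
              then show ?thesis using \<open>p \<noteq> p'\<close> unfolding p p' K_def by auto
            next
              case False
              then show ?thesis using layers_disjoint[OF False] unfolding p p' K_def by auto
            qed
          qed
        qed simp
        finally show ?thesis by simp
      qed
      also note s
      also have "real (card ({..i} \<times> {..<2 * l - 1})) * (sum w (B i) / ?m) \<le> ?m * (sum w (B i) / ?m)"
      proof (rule mult_right_mono)
        have "card ({..i} \<times> {..<2 * l - 1}) \<le> l * (2 * l - 1)"
          unfolding card_cartesian_product using i by (intro mult_le_mono) auto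
        then show "real (card ({..i} \<times> {..<2 * l - 1})) \<le> ?m" by linarith
        have "0 \<le> sum w (B i)" using W(3) BW by (intro sum_nonneg) blast
        then show "0 \<le> sum w (B i) / ?m" using m0 by (intro divide_nonneg_pos)
      qed
      also have "?m * (sum w (B i) / ?m) = sum w (B i)" using m0 by (simp only: nonzero_mult_div_cancel_left times_divide_eq_right less_numeral_extra)
      finally show False by simp
    qed
    then obtain a where a: "sum w (B i) / ?m \<le> sum w (K a)" "a \<in> {..i} \<times> {..<2 * l - 1}" by blast
    have "sum w (B (Suc i)) / \<rho> \<le> sum w (B i)"
      using i(2) \<rho>(1) by (simp add: pos_divide_le_eq mult.commute)
    then have "sum w (B (Suc i)) / \<rho> / ?m \<le> sum w (B i) / ?m" by (intro divide_right_mono) auto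
    with a(1) have wK: "1 / (?m * \<rho>) * sum w (B (Suc i)) \<le> sum w (K a)"
      by (simp add: mult.commute)
    have KB: "K a \<subseteq> B i" using Beq[of i] i a(2) by auto
    have "\<forall>x\<in>K a. \<forall>y\<in>W. E x y \<longrightarrow> y \<in> B (Suc i)" using KB unfolding B_def by auto
    moreover have "indep E (K a)" using indK a(2) i by auto
    moreover have "v \<in> B (Suc i)" using ball_mono[of 0 "Suc i" E W v] unfolding B_def by auto
    moreover have "B i \<subseteq> B (Suc i)" unfolding B_def by (rule ball_mono) simp
    ultimately show "\<exists>I B. I \<subseteq> B \<and> B \<subseteq> W \<and> B \<noteq> {} \<and> indep E I \<and>
        (\<forall>x\<in>I. \<forall>y\<in>W. E x y \<longrightarrow> y \<in> B) \<and> 1 / (?m * \<rho>) * sum w B \<le> sum w I"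
      using wK KB BW by (intro exI[of _ "K a"] exI[of _ "B (Suc i)"]) blast
  qed
qed

subsection \<open>Even cycles\<close>

text \<open>With \<open>D\<close> read as the edges of a bipartite graph, the members are the edges
  from which a zigzag path with \<open>2 * p\<close> further edges can climb in both
  coordinates.\<close>

primrec stair :: "(nat \<times> nat) set \<Rightarrow> (nat \<Rightarrow> nat) \<Rightarrow> nat \<Rightarrow> (nat \<times> nat) set" where
  "stair D g 0 = D"
| "stair D g (Suc p) = {(y, z) \<in> D. \<exists>y' z'. g y < g y' \<and> (y', z) \<in> D \<and> z < z' \<and> (y', z') \<in> stair D g p}"

text \<open>Passing from \<open>stair D g p\<close> to the set \<open>T\<close> of the proof loses
  at most one pair for each member of \<open>Y\<close>, that with the largest second entry; passing
  from \<open>T\<close> to the next staircase set loses at most one for each member of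
  \<open>Z\<close>, that with the largest \<open>g\<close>. Injectivity of \<open>g\<close> makes
  pairs with equal second entry comparable.\<close>

lemma card_stair:
  assumes "finite Y" "finite Z" "D \<subseteq> Y \<times> Z" "inj_on g Y"
  shows "card D \<le> card (stair D g p) + p * (card Y + card Z)"
proof (induction p)
  case (Suc p)
  have fin: "finite D" using assms(3) by (rule finite_subset) (simp add: assms(1,2))
  have sub: "stair D g q \<subseteq> D" for q by (cases q) auto
  define T where "T = {(y, z) \<in> D. \<exists>z'>z. (y, z') \<in> stair D g p}"
  have TD: "T \<subseteq> D" unfolding T_def by auto
  have fT: "finite T" using TD fin by (rule finite_subset)
  have "card (stair D g p - T) \<le> card Y"
  proof (rule card_inj_on_le[of fst])
    show "inj_on fst (stair D g p - T)"
    proof (rule inj_onI)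
      fix a b assume a: "a \<in> stair D g p - T" and b: "b \<in> stair D g p - T" and e: "fst a = fst b"
      obtain y z z' where ab: "a = (y, z)" "b = (y, z')" using e by (metis prod.collapse)
      have "\<not> z < z'" "\<not> z' < z" using a b sub unfolding ab T_def by auto
      then show "a = b" unfolding ab by simp
    qed
    show "fst ` (stair D g p - T) \<subseteq> Y" using sub assms(3) by force
  qed (rule assms(1))
  moreover have "card (stair D g p) \<le> card (stair D g p - T) + card T"
    using diff_card_le_card_Diff[OF fT, of "stair D g p"] by simp
  moreover have "card (T - stair D g (Suc p)) \<le> card Z"
  proof (rule card_inj_on_le[of snd])
    show "inj_on snd (T - stair D g (Suc p))"
    proof (rule inj_onI)
      fix a b assume a: "a \<in> T - stair D g (Suc p)" and b: "b \<in> T - stair D g (Suc p)" and e: "snd a = snd b"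
      obtain y y' z where ab: "a = (y, z)" "b = (y', z)" using e by (metis prod.collapse)
      have D: "(y, z) \<in> D" "(y', z) \<in> D" using a b TD unfolding ab by auto
      have "\<not> g y < g y'" "\<not> g y' < g y" using a b D unfolding ab T_def by auto
      then have "g y = g y'" by simp
      then show "a = b" using D assms(3,4) unfolding ab inj_on_def by blast
    qed
    show "snd ` (T - stair D g (Suc p)) \<subseteq> Z" using TD assms(3) by force
  qed (rule assms(2))
  moreover have "card T \<le> card (T - stair D g (Suc p)) + card (stair D g (Suc p))"
    using diff_card_le_card_Diff[OF finite_subset[OF sub fin, of "Suc p"], of T] by simp
  ultimately show ?case using Suc.IH by simp
qed simp

lemma stair_sequence:
  assumes "(y, z) \<in> stair D g p"
  shows "\<exists>ys zs. ys 0 = y \<and> zs 0 = z \<and> (\<forall>j\<le>p. (ys j, zs j) \<in> D) \<and>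
    (\<forall>j<p. (ys (Suc j), zs j) \<in> D \<and> g (ys j) < g (ys (Suc j)) \<and> zs j < zs (Suc j))"
  using assms
proof (induction p arbitrary: y z)
  case 0
  then show ?case by (intro exI[of _ "\<lambda>_. y"] exI[of _ "\<lambda>_. z"]) simp
next
  case (Suc p)
  then obtain y' z' where s: "(y, z) \<in> D" "g y < g y'" "(y', z) \<in> D" "z < z'" "(y', z') \<in> stair D g p"
    by auto
  from Suc.IH[OF s(5)] obtain ys zs where h: "ys 0 = y'" "zs 0 = z'" "\<forall>j\<le>p. (ys j, zs j) \<in> D"
    "\<forall>j<p. (ys (Suc j), zs j) \<in> D \<and> g (ys j) < g (ys (Suc j)) \<and> zs j < zs (Suc j)" by blast
  let ?ys = "case_nat y ys" and ?zs = "case_nat z zs"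
  have "(?ys j, ?zs j) \<in> D" if "j \<le> Suc p" for j using that s h by (cases j) auto
  moreover have "(?ys (Suc j), ?zs j) \<in> D \<and> g (?ys j) < g (?ys (Suc j)) \<and> ?zs j < ?zs (Suc j)"
    if "j < Suc p" for j using that s h by (cases j) auto
  ultimately show ?case by (intro exI[of _ ?ys] exI[of _ ?zs]) simp
qed

context layered_tree
begin

text \<open>Zigzagging between two layers along a staircase keeps the even positions key-increasing.\<close>
lemma card_edges_between_layers:
  assumes free: "\<And>xs. cycle_list E xs \<Longrightarrow> set xs \<subseteq> (\<Union>j. N j) \<Longrightarrow> length xs \<noteq> 2 * l"
    and "2 \<le> l" "i < l"
  shows "card {(y, z). y \<in> N i \<and> z \<in> N (Suc i) \<and> E y z} \<le> (l - 1) * (card (N i) + card (N (Suc i)))"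
proof (rule ccontr)
  define D where "D = {(y, z). y \<in> N i \<and> z \<in> N (Suc i) \<and> E y z}"
  assume "\<not> ?thesis"
  then have big: "(l - 1) * (card (N i) + card (N (Suc i))) < card D" unfolding D_def by simp
  have fN: "finite (N j)" for j using layer_less by (rule finite_subset) simp
  have "card D \<le> card (stair D (key i) (l - 1)) + (l - 1) * (card (N i) + card (N (Suc i)))"
    using fN by (intro card_stair) (auto simp: D_def inj_on_def intro: key_inj)
  then have "stair D (key i) (l - 1) \<noteq> {}" using big by auto
  then obtain y z where yz: "(y, z) \<in> stair D (key i) (l - 1)" by auto
  obtain ys zs where st: "\<And>j. j \<le> l - 1 \<Longrightarrow> (ys j, zs j) \<in> D"
    "\<And>j. j < l - 1 \<Longrightarrow> (ys (Suc j), zs j) \<in> D"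
    "\<And>j. j < l - 1 \<Longrightarrow> key i (ys j) < key i (ys (Suc j))"
    "\<And>j. j < l - 1 \<Longrightarrow> zs j < zs (Suc j)"
    using stair_sequence[OF yz] by blast
  have ysN: "ys j \<in> N i" if "j \<le> l - 1" for j using st(1)[OF that] unfolding D_def by simp
  have zsN: "zs j \<in> N (Suc i)" if "j \<le> l - 1" for j using st(1)[OF that] unfolding D_def by simp
  \<comment> \<open>A window of \<open>l - d\<close> staircase steps is a path with
    \<open>2 * (l - d)\<close> edges, to which the tree paths add \<open>2 * d\<close>.\<close>
  let ?len = "\<lambda>d. l - d"
  have q1: "1 \<le> l - 1" using assms(2) by simp
  have len: "1 \<le> ?len d \<and> ?len d \<le> l - 1" if "1 \<le> d" "d \<le> i" for d
    using that assms(3) by auto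
  obtain d a where d: "1 \<le> d" "d \<le> i" "a + ?len d \<le> l - 1"
    "(par ^^ d) (ys a) = (par ^^ d) (ys (a + ?len d))"
    "(par ^^ (d - 1)) (ys a) \<noteq> (par ^^ (d - 1)) (ys (a + ?len d))"
    by (rule window[where f = ys and len = ?len, OF ysN st(3) q1 len])
  define b where "b = a + ?len d"
  have ab: "a < b" "b \<le> l - 1" unfolding b_def using d assms(3) by auto
  \<comment> \<open>Even positions lie in layer \<open>i\<close> and odd ones in layer
    \<open>Suc i\<close>. The path starts and ends at even positions, where the keys control the
    common ancestor.\<close>
  define h where "h = (\<lambda>j. if even j then ys (j div 2) else zs (j div 2))"
  define P where "P = map h [2 * a..<Suc (2 * b)]"
  have hl: "P \<noteq> []" "hd P = ys a" "last P = ys b" unfolding P_def h_def using ab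
    by (auto simp: hd_map last_map simp del: upt_Suc)
  have hN: "h j \<in> N i \<union> N (Suc i)" if "j \<le> 2 * b" for j
    using ysN[of "j div 2"] zsN[of "j div 2"] that ab unfolding h_def by auto
  have "set P = h ` {2 * a..2 * b}"
    unfolding P_def by (simp add: atLeastLessThanSuc_atLeastAtMost del: upt_Suc)
  then have sP: "set P \<subseteq> N i \<union> N (Suc i)" using hN by (simp add: image_subset_iff)
  have yinj: "inj_on ys {a..b}" using key_increasing_inj[of "l - 1" i ys b a] st(3) ab by simp
  have zinj: "zs j \<noteq> zs j'" if "j < j'" "j' \<le> l - 1" for j j'
    using strict_increasing_upto[of "l - 1" zs j j'] st(4) that by auto
  have "inj_on h {2 * a..2 * b}"
  proof (rule inj_onI)
    fix j j' assume j: "j \<in> {2 * a..2 * b}" "j' \<in> {2 * a..2 * b}" "h j = h j'"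
    have m: "j div 2 \<in> {a..b}" "j' div 2 \<in> {a..b}" using j by auto
    have "N i \<inter> N (Suc i) = {}" by (rule layers_disjoint) simp
    then have ev: "even j \<longleftrightarrow> even j'"
      using j(3) ysN[of "j div 2"] zsN[of "j div 2"] ysN[of "j' div 2"] zsN[of "j' div 2"] m ab
      unfolding h_def by (auto split: if_splits)
    have "j div 2 = j' div 2"
    proof (cases "even j")
      case True
      then have "ys (j div 2) = ys (j' div 2)" using ev j(3) unfolding h_def by simp
      then show ?thesis using yinj m unfolding inj_on_def by blast
    next
      case False
      then have "zs (j div 2) = zs (j' div 2)" using ev j(3) unfolding h_def by simp
      moreover have "j div 2 \<le> l - 1" "j' div 2 \<le> l - 1" using m ab by auto
      ultimately show ?thesis
        using zinj[of "j div 2" "j' div 2"] zinj[of "j' div 2" "j div 2"] by linarith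
    qed
    then show "j = j'" using ev by presburger
  qed
  then have dP: "distinct P" unfolding P_def distinct_map
    by (simp add: atLeastLessThanSuc_atLeastAtMost del: upt_Suc)
  have step: "E (h j) (h (Suc j))" if "j < 2 * b" for j
  proof (cases "even j")
    case True
    then obtain c where c: "j = 2 * c" by auto
    then show ?thesis using st(1)[of c] that ab unfolding h_def D_def by auto
  next
    case False
    then obtain c where c: "j = 2 * c + 1" by (elim oddE)
    then have "E (ys (Suc c)) (zs c)" using st(2)[of c] that ab unfolding D_def by auto
    then show ?thesis using sym c unfolding h_def by simp
  qed
  have "\<exists>xs. cycle_list E xs \<and> length xs = length P - 1 + 2 * d \<and> set xs \<subseteq> set P \<union> (\<Union>j. N j)"
  proof (rule path_closes_to_cycle)
    show "distinct P" by (rule dP)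
    show "successively E P" unfolding P_def successively_conv_nth
      using step by (auto simp del: upt_Suc)
    show "set P \<inter> N j = {}" if "j < i" for j
      using sP layers_disjoint[of i j] layers_disjoint[of "Suc i" j] that by auto
    show "hd P \<in> N i" "last P \<in> N i" using ysN ab hl by auto
    show "(par ^^ d) (hd P) = (par ^^ d) (last P)"
      "(par ^^ (d - 1)) (hd P) \<noteq> (par ^^ (d - 1)) (last P)"
      using d(4,5) unfolding hl b_def .
    show "P \<noteq> []" "1 \<le> d" "d \<le> i" using hl(1) d(1,2) .
  qed
  moreover have "length P - 1 + 2 * d = 2 * l"
    unfolding P_def b_def using d(2) assms(3) by (simp add: diff_mult_distrib2)
  ultimately obtain xs where xs: "cycle_list E xs" "length xs = 2 * l"
    "set xs \<subseteq> set P \<union> (\<Union>j. N j)" by auto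
  then have "set xs \<subseteq> (\<Union>j. N j)" using sP by blast
  then show False using free xs by blast
qed

end

text \<open>In a cut with the most edges, moving one vertex to the other side gains nothing, so at
  least half of its edges cross. \<open>C s\<close> consists of ordered pairs, whence the factor 2
  in \<open>cnt\<close>.\<close>

lemma max_cut:
  assumes "finite U" and sym: "\<And>u v. E u v \<Longrightarrow> E v u" and irr: "\<And>u. \<not> E u u"
  shows "\<exists>s :: 'a \<Rightarrow> bool. \<forall>v\<in>U. card {u\<in>U. E v u} \<le> 2 * card {u\<in>U. E v u \<and> s u \<noteq> s v}"
proof -
  define C where "C = (\<lambda>s. {(x, y) \<in> U \<times> U. E x y \<and> s x \<noteq> (s y :: bool)})"
  have "card (C s) < Suc (card (U \<times> U))" for s
    using assms(1) unfolding C_def by (intro le_imp_less_Suc card_mono) auto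
  then obtain s where s: "\<And>s'. card (C s') \<le> card (C s)"
    using ex_has_greatest_nat[of "\<lambda>_. True" "\<lambda>_. True" "\<lambda>s. card (C s)" "Suc (card (U \<times> U))"] by auto
  show ?thesis
  proof (intro exI[of _ s] ballI)
    fix v assume v: "v \<in> U"
    define R where "R = {(x, y) \<in> U \<times> U. E x y \<and> s x \<noteq> s y \<and> x \<noteq> v \<and> y \<noteq> v}"
    define A where "A = {u\<in>U. E v u \<and> s u \<noteq> s v}"
    define A' where "A' = {u\<in>U. E v u \<and> s u = s v}"
    have fin: "finite R" "finite A" "finite A'"
      using assms(1) unfolding R_def A_def A'_def by (auto intro: finite_subset[of _ "U \<times> U"])
    have vA: "v \<notin> A" "v \<notin> A'" using irr unfolding A_def A'_def by auto
    have cnt: "card (R \<union> ({v} \<times> T \<union> T \<times> {v})) = card R + 2 * card T"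
      if "finite T" "v \<notin> T" for T
    proof -
      have "card ({v} \<times> T \<union> T \<times> {v}) = 2 * card T"
        using that by (subst card_Un_disjoint) (auto simp: card_cartesian_product)
      moreover have "R \<inter> ({v} \<times> T \<union> T \<times> {v}) = {}" unfolding R_def by auto
      ultimately show ?thesis using fin(1) that(1) by (simp add: card_Un_disjoint)
    qed
    have 1: "C s = R \<union> ({v} \<times> A \<union> A \<times> {v})"
      using v sym irr unfolding C_def R_def A_def by auto
    have 2: "C (s(v := \<not> s v)) = R \<union> ({v} \<times> A' \<union> A' \<times> {v})"
      using v sym irr unfolding C_def R_def A'_def by (auto split: if_splits)
    have "card A' \<le> card A"
      using s[of "s(v := \<not> s v)"] cnt[OF fin(2) vA(1)] cnt[OF fin(3) vA(2)] unfolding 1 2 by simp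
    moreover have "{u\<in>U. E v u} = A \<union> A'" "A \<inter> A' = {}" unfolding A_def A'_def by auto
    ultimately show "card {u\<in>U. E v u} \<le> 2 * card {u\<in>U. E v u \<and> s u \<noteq> s v}"
      using fin unfolding A_def[symmetric] by (simp add: card_Un_disjoint)
  qed
qed

text \<open>A maximum cut gives a bipartite subgraph \<open>H\<close> of minimum degree at least
  \<open>k / 2\<close>. No edge of \<open>H\<close> lies within a breadth-first layer, so all
  degrees come from edges between consecutive layers. By \<open>card_edges_between_layers\<close>
  these are too few unless each layer before layer \<open>l\<close> is followed by one larger by the
  factor \<open>k / (4 * l)\<close>.\<close>

lemma even_cycle_free_card:
  fixes E :: "nat \<Rightarrow> nat \<Rightarrow> bool"
  assumes U: "U \<subseteq> {0..<n}" "U \<noteq> {}" and sym: "\<And>u v. E u v \<Longrightarrow> E v u" and irr: "\<And>u. \<not> E u u"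
    and free: "\<And>xs. cycle_list E xs \<Longrightarrow> set xs \<subseteq> U \<Longrightarrow> length xs \<noteq> 2 * l" and l: "2 \<le> l"
    and deg: "\<And>v. v \<in> U \<Longrightarrow> k \<le> card {u\<in>U. E v u}" and k: "12 * l \<le> k"
  shows "(real k / real (4 * l)) ^ l \<le> real (card U)"
proof -
  have fU: "finite U" using U(1) by (rule finite_subset) simp
  obtain s where s: "\<forall>v\<in>U. card {u\<in>U. E v u} \<le> 2 * card {u\<in>U. E v u \<and> s u \<noteq> (s v :: bool)}"
    using max_cut[OF fU, of E, OF sym irr] by blast
  define H where "H = (\<lambda>x y. E x y \<and> s y \<noteq> s x)"
  have symH: "H u v \<Longrightarrow> H v u" for u v using sym unfolding H_def by auto
  obtain v where v: "v \<in> U" using U(2) by blast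
  define N where "N = layer H U v"
  obtain par where "layered_tree H N par v n"
    using layered_tree_bfs[of H U n v] symH v U unfolding N_def by blast
  then interpret layered_tree H N par v n .
  have NU: "N i \<subseteq> U" for i
    using layer_subset_ball[of H U v i] ball_subset[OF v, of H i] unfolding N_def by blast
  have fN: "finite (N i)" for i using NU fU by (rule finite_subset)
  have freeH: "length xs \<noteq> 2 * l" if "cycle_list H xs" "set xs \<subseteq> (\<Union>j. N j)" for xs
  proof -
    have "cycle_list E xs"
      using that(1) successively_mono[of H xs E] unfolding cycle_list_def H_def by blast
    then show ?thesis using free that(2) NU by blast
  qed
  have parity: "x \<in> N i \<Longrightarrow> s x = (s v \<noteq> odd i)" for x i
  proof (induction i arbitrary: x)
    case 0
    then show ?case using layer_0 by simp
  next
    case (Suc i)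
    then have "par x \<in> N i" "H x (par x)" using par by auto
    then show ?case using Suc.IH[of "par x"] unfolding H_def by auto
  qed
  define e where "e = (\<lambda>i. card {(y, z). y \<in> N i \<and> z \<in> N (Suc i) \<and> H y z})"
  have e: "e i \<le> l * (card (N i) + card (N (Suc i)))" if "i < l" for i
    unfolding e_def using card_edges_between_layers[OF freeH l that]
    by (rule order_trans) (assumption | intro mult_le_mono1 diff_le_self)+
  have nb: "{y\<in>U. H x y} \<subseteq> {y\<in>N (Suc i). H x y} \<union> (if i = 0 then {} else {y\<in>N (i - 1). H x y})"
    if xi: "x \<in> N i" for x i
  proof
    fix y assume y: "y \<in> {y\<in>U. H x y}"
    obtain j where j: "j \<le> Suc i" "y \<in> N j"
      using layer_neighbour[of x H U v i y] xi y unfolding N_def by auto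
    obtain j' where j': "j' \<le> Suc j" "x \<in> N j'"
      using layer_neighbour[of y H U v j x] j y xi symH NU unfolding N_def by blast
    have "j' = i" using layers_disjoint[of j' i] j' xi by blast
    moreover have "j \<noteq> i" using parity[OF xi] parity[OF j(2)] y unfolding H_def by auto
    ultimately have "j = Suc i \<or> (i \<noteq> 0 \<and> j = i - 1)" using j j' by auto
    then show "y \<in> {y\<in>N (Suc i). H x y} \<union> (if i = 0 then {} else {y\<in>N (i - 1). H x y})"
      using j y by auto
  qed
  have degsum: "k * card (N i) \<le> 2 * (e i + (if i = 0 then 0 else e (i - 1)))" for i
  proof -
    have eq: "(\<Sum>x\<in>N i. card {y\<in>N j. H x y}) = card {(x, y). x \<in> N i \<and> y \<in> N j \<and> H x y}" for i j
    proof -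
      have "{(x, y). x \<in> N i \<and> y \<in> N j \<and> H x y} = (SIGMA x:N i. {y\<in>N j. H x y})" by auto
      then show ?thesis using fN by simp
    qed
    have "k * card (N i) = (\<Sum>x\<in>N i. k)" by simp
    also have "\<dots> \<le> (\<Sum>x\<in>N i. 2 * (card {y\<in>N (Suc i). H x y} +
        (if i = 0 then 0 else card {y\<in>N (i - 1). H x y})))"
    proof (rule sum_mono)
      fix x assume x: "x \<in> N i"
      have "k \<le> 2 * card {y\<in>U. H x y}"
        using deg[of x] s NU[of i] x unfolding H_def by (meson le_trans subsetD)
      also have "card {y\<in>U. H x y} \<le>
          card ({y\<in>N (Suc i). H x y} \<union> (if i = 0 then {} else {y\<in>N (i - 1). H x y}))"
        using nb[OF x] fN by (intro card_mono) auto
      also have "\<dots> \<le> card {y\<in>N (Suc i). H x y} + (if i = 0 then 0 else card {y\<in>N (i - 1). H x y})"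
        using card_Un_le[of "{y\<in>N (Suc i). H x y}" "{y\<in>N (i - 1). H x y}"] by simp
      finally show "k \<le> 2 * (card {y\<in>N (Suc i). H x y} + (if i = 0 then 0 else card {y\<in>N (i - 1). H x y}))"
        by simp
    qed
    also have "\<dots> = 2 * ((\<Sum>x\<in>N i. card {y\<in>N (Suc i). H x y}) +
        (if i = 0 then 0 else (\<Sum>x\<in>N i. card {y\<in>N (i - 1). H x y})))"
      by (simp add: sum_distrib_left[symmetric] sum.distrib)
    also have "\<dots> = 2 * (e i + (if i = 0 then 0 else e (i - 1)))"
    proof (cases i)
      case (Suc i')
      have "{(x, y). x \<in> N i \<and> y \<in> N i' \<and> H x y} = prod.swap ` {(y, z). y \<in> N i' \<and> z \<in> N (Suc i') \<and> H y z}"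
        unfolding Suc using symH by (auto simp: image_iff)
      then have "card {(x, y). x \<in> N i \<and> y \<in> N i' \<and> H x y} = e i'"
        unfolding e_def by (simp add: card_image)
      then show ?thesis unfolding eq using Suc by (simp add: e_def)
    qed (simp add: eq e_def)
    finally show ?thesis .
  qed
  \<comment> \<open>The monotonicity carried along lets the current layer absorb the preceding one.
    Its terms then amount to at most \<open>6 * l\<close> per vertex, which is at most half of
    \<open>k\<close>; the other half is left for the next layer.\<close>
  have step: "k * card (N i) \<le> 4 * l * card (N (Suc i)) \<and> card (N i) \<le> card (N (Suc i))"
    if "i < l" for i
    using that
  proof (induction i)
    case 0
    have "k * card (N 0) \<le> 2 * (l * card (N 0)) + 2 * (l * card (N 1))"
      using degsum[of 0] e[OF 0] by (simp add: distrib_left)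
    moreover have "12 * (l * card (N 0)) \<le> k * card (N 0)"
      using mult_le_mono1[OF k, of "card (N 0)"] by simp
    ultimately have "k * card (N 0) \<le> 4 * (l * card (N 1))" "12 * (l * card (N 0)) \<le> 4 * (l * card (N 1))"
      by linarith+
    then show ?case using l by simp
  next
    case (Suc i)
    have IH: "card (N i) \<le> card (N (Suc i))" using Suc by simp
    let ?a = "card (N i)" and ?b = "card (N (Suc i))" and ?c = "card (N (Suc (Suc i)))"
    have "k * ?b \<le> 2 * (l * (?b + ?c) + l * (?a + ?b))"
      using degsum[of "Suc i"] e[OF Suc.prems] e[of i] Suc.prems by simp
    also have "\<dots> \<le> 2 * (l * (?b + ?c) + l * (?b + ?b))"
      using IH by (intro mult_le_mono2 add_left_mono) simp
    finally have "k * ?b \<le> 6 * (l * ?b) + 2 * (l * ?c)" by (simp add: distrib_left)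
    moreover have "12 * (l * ?b) \<le> k * ?b" using mult_le_mono1[OF k, of ?b] by simp
    ultimately have "k * ?b \<le> 4 * (l * ?c)" "12 * (l * ?b) \<le> 4 * (l * ?c)" by linarith+
    then show ?case using l by simp
  qed
  have grow: "real k / real (4 * l) * real (card (N i)) \<le> real (card (N (Suc i)))" if "i < l" for i
  proof -
    have "real (k * card (N i)) \<le> real (4 * l * card (N (Suc i)))" using step[OF that] by linarith
    then show ?thesis using l by (simp add: field_simps)
  qed
  have "(real k / real (4 * l)) ^ i \<le> real (card (N i))" if "i \<le> l" for i
    using that
  proof (induction i)
    case 0
    then show ?case using layer_0 by simp
  next
    case (Suc i)
    have "(real k / real (4 * l)) ^ Suc i = real k / real (4 * l) * (real k / real (4 * l)) ^ i" by simp
    also have "\<dots> \<le> real k / real (4 * l) * real (card (N i))"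
      using Suc by (intro mult_left_mono) auto
    also have "\<dots> \<le> real (card (N (Suc i)))" using grow[of i] Suc.prems by simp
    finally show ?case .
  qed
  then have "(real k / real (4 * l)) ^ l \<le> real (card (N l))" by blast
  also have "\<dots> \<le> real (card U)" using card_mono[OF fU NU] by simp
  finally show ?thesis .
qed

subsection \<open>Exploring linked components of a random assignment\<close>

text \<open>Fubini for independent coordinates: the lists on \<open>A\<close> can be exposed before
  those on \<open>B\<close>.\<close>

lemma sum_PiE_Un:
  assumes "A \<inter> B = {}"
  shows "(\<Sum>L\<in>Pi\<^sub>E (A \<union> B) F. h L) =
    (\<Sum>L1\<in>Pi\<^sub>E A F. \<Sum>L2\<in>Pi\<^sub>E B F. h (\<lambda>v. if v \<in> A then L1 v else L2 v))"
proof -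
  have "(\<Sum>L\<in>Pi\<^sub>E (A \<union> B) F. h L) =
    (\<Sum>(L1, L2)\<in>Pi\<^sub>E A F \<times> Pi\<^sub>E B F. h (\<lambda>v. if v \<in> A then L1 v else L2 v))"
  proof (rule sum.reindex_bij_witness[of _ "\<lambda>(L1, L2) v. if v \<in> A then L1 v else L2 v"
          "\<lambda>L. (restrict L A, restrict L B)"])
    fix L assume L: "L \<in> Pi\<^sub>E (A \<union> B) F"
    have eq: "(\<lambda>v. if v \<in> A then restrict L A v else restrict L B v) = L"
      using PiE_arb[OF L] by (auto simp: fun_eq_iff)
    then show "(case (restrict L A, restrict L B) of (L1, L2) \<Rightarrow> \<lambda>v. if v \<in> A then L1 v else L2 v) = L"
      by simp
    show "(restrict L A, restrict L B) \<in> Pi\<^sub>E A F \<times> Pi\<^sub>E B F" using L by (auto simp: PiE_iff)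
    show "(case (restrict L A, restrict L B) of (L1, L2) \<Rightarrow> h (\<lambda>v. if v \<in> A then L1 v else L2 v)) = h L"
      using eq by simp
  next
    fix q assume "q \<in> Pi\<^sub>E A F \<times> Pi\<^sub>E B F"
    then obtain L1 L2 where q: "q = (L1, L2)" "L1 \<in> Pi\<^sub>E A F" "L2 \<in> Pi\<^sub>E B F" by auto
    have "restrict (\<lambda>v. if v \<in> A then L1 v else L2 v) A = L1"
      using PiE_arb[OF q(2)] by (auto simp: fun_eq_iff restrict_def)
    moreover have "restrict (\<lambda>v. if v \<in> A then L1 v else L2 v) B = L2"
      using PiE_arb[OF q(3)] assms by (auto simp: fun_eq_iff restrict_def)
    ultimately show "(restrict (case q of (L1, L2) \<Rightarrow> \<lambda>v. if v \<in> A then L1 v else L2 v) A,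
        restrict (case q of (L1, L2) \<Rightarrow> \<lambda>v. if v \<in> A then L1 v else L2 v) B) = q"
      using q by simp
    show "(case q of (L1, L2) \<Rightarrow> \<lambda>v. if v \<in> A then L1 v else L2 v) \<in> Pi\<^sub>E (A \<union> B) F"
      using q by (auto simp: PiE_iff extensional_def)
  qed
  then show ?thesis by (simp add: sum.cartesian_product)
qed

text \<open>This is reachability: an \<open>H\<close>-path leads from \<open>A\<close> to each
  vertex of \<open>W\<close> with all vertices after its start in \<open>W\<close>. Closed sets
  \<open>S\<close> replace paths, which makes both the exploration step and the argument for
  critical sets direct.\<close>

definition attached :: "('a \<Rightarrow> 'a \<Rightarrow> bool) \<Rightarrow> 'a set \<Rightarrow> 'a set \<Rightarrow> bool" where
  "attached H A W \<longleftrightarrow> (\<forall>S. A \<subseteq> S \<longrightarrow> (\<forall>u\<in>S \<inter> (A \<union> W). \<forall>w\<in>W. H u w \<longrightarrow> w \<in> S) \<longrightarrow> W \<subseteq> S)"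

lemma attached_empty: "attached H {} W \<Longrightarrow> W = {}"
  unfolding attached_def by (drule spec[of _ "{}"]) auto

text \<open>One step of the exploration: \<open>a\<close> is finished and its neighbours in
  \<open>W\<close> become active. They belong to \<open>S\<close>, so adding \<open>a\<close> turns
  a set closed for the new pair into one closed for the old pair.\<close>

lemma attached_step:
  assumes "attached H (insert a A) W" "a \<notin> W"
  shows "attached H (A \<union> {w\<in>W. H a w}) (W - {w\<in>W. H a w})"
  unfolding attached_def
proof (intro allI impI)
  fix S assume S: "A \<union> {w\<in>W. H a w} \<subseteq> S"
    and cl: "\<forall>u\<in>S \<inter> (A \<union> {w\<in>W. H a w} \<union> (W - {w\<in>W. H a w})). \<forall>w\<in>W - {w\<in>W. H a w}. H u w \<longrightarrow> w \<in> S"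
  have "w \<in> insert a S" if "u \<in> insert a S \<inter> (insert a A \<union> W)" "w \<in> W" "H u w" for u w
    using that S cl by (cases "u = a"; cases "H a w") auto
  moreover have "insert a A \<subseteq> insert a S" using S by auto
  ultimately have "W \<subseteq> insert a S"
    using assms(1) unfolding attached_def by (metis (no_types, lifting))
  then show "W - {w\<in>W. H a w} \<subseteq> S" using assms(2) by auto
qed

lemma attached_mono:
  assumes "attached H A W" "\<And>u v. H u v \<Longrightarrow> H' u v"
  shows "attached H' A W"
  using assms unfolding attached_def by meson

lemma sum_Pow_power:
  assumes "finite N" shows "(\<Sum>B\<in>Pow N. t ^ card B) = (1 + t :: real) ^ card N"
proof -
  have "(\<Sum>B\<in>Pow N. t ^ card B) = (\<Sum>B\<in>Pow N. (\<Prod>b\<in>B. t) * (\<Prod>b\<in>N - B. 1))" by simp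
  also have "\<dots> = (\<Prod>b\<in>N. t + 1)" using prod_add[OF assms, of "\<lambda>_. t" "\<lambda>_. 1"] by simp
  finally show ?thesis by (simp add: add.commute)
qed

definition link :: "('a \<Rightarrow> 'a \<Rightarrow> bool) \<Rightarrow> ('b \<Rightarrow> 'b \<Rightarrow> bool) \<Rightarrow> ('a \<Rightarrow> 'b) \<Rightarrow> 'a \<Rightarrow> 'a \<Rightarrow> bool" where
  "link E hit L = (\<lambda>u v. E u v \<and> hit (L u) (L v))"

text \<open>Exposing the links of one vertex of \<open>A\<close> at a time dominates the exploration of the linked
  component by a Galton-Watson process; the weight \<open>exp 1\<close> per active vertex solves
  \<open>exp (x / exp 1) \<le> x\<close>, whence the critical factor \<open>exp 1\<close>.\<close>
lemma expected_attached_sets: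
  fixes E :: "'a \<Rightarrow> 'a \<Rightarrow> bool" and hit :: "'b \<Rightarrow> 'b \<Rightarrow> bool" and p P :: real
  assumes X: "finite X" "\<And>x. x \<in> X \<Longrightarrow> real (card {y\<in>X. hit x y}) \<le> p * real (card X)"
    and p: "0 \<le> p" "0 < P" "real \<Delta> * p \<le> P"
    and "finite A" "finite R" "A \<inter> R = {}" "\<And>a. a \<in> A \<union> R \<Longrightarrow> card {u\<in>R. E a u} \<le> \<Delta>"
    and "\<And>a. a \<in> A \<Longrightarrow> L0 a \<in> X"
  shows "(\<Sum>L\<in>Pi\<^sub>E R (\<lambda>_. X). real (card {W. W \<subseteq> R \<and> card W = s \<and>
      attached (link E hit (\<lambda>v. if v \<in> R then L v else L0 v)) A W}))
    \<le> exp 1 ^ card A * (exp 1 * P) ^ s * real (card X) ^ card R"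
  using assms(6-)
proof (induction "card A + card R" arbitrary: A R L0 s rule: less_induct)
  case less
  note fA = less.prems(1) and fR = less.prems(2) and AR = less.prems(3)
    and deg = less.prems(4) and L0 = less.prems(5)
  have fP: "finite (Pi\<^sub>E T (\<lambda>_. X))" if "finite T" for T :: "'a set"
    using that X(1) by (intro finite_PiE) auto
  have cP: "card (Pi\<^sub>E T (\<lambda>_. Y)) = card Y ^ card T" if "finite T" for T :: "'a set" and Y :: "'b set"
    using that by (simp add: card_PiE)
  show ?case
  proof (cases "A = {}")
    case True
    \<comment> \<open>With no active vertex the exploration has ended: only the empty set counts,
      and only for \<open>s = 0\<close>.\<close>
    have "real (card {W. W \<subseteq> R \<and> card W = s \<and> attached H A W}) \<le> (exp 1 * P) ^ s" for H
    proof -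
      have sub: "{W. W \<subseteq> R \<and> card W = s \<and> attached H A W} \<subseteq> (if s = 0 then {{}} else {})"
        using attached_empty unfolding True by fastforce
      have "card {W. W \<subseteq> R \<and> card W = s \<and> attached H A W} \<le> (if s = 0 then 1 else 0)"
        using card_mono[OF _ sub] by (cases "s = 0") auto
      also have "real \<dots> \<le> (exp 1 * P) ^ s" using p by auto
      finally show ?thesis by simp
    qed
    then have "(\<Sum>L\<in>Pi\<^sub>E R (\<lambda>_. X). real (card {W. W \<subseteq> R \<and> card W = s \<and>
        attached (link E hit (\<lambda>v. if v \<in> R then L v else L0 v)) A W})) \<le>
        real (card (Pi\<^sub>E R (\<lambda>_. X))) * (exp 1 * P) ^ s"
      by (intro sum_bounded_above)
    then show ?thesis unfolding True cP[OF fR] by (simp add: mult.commute)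
  next
    case False
    then obtain a where a: "a \<in> A" by blast
    define A' where "A' = A - {a}"
    have A': "A = insert a A'" "a \<notin> A'" "finite A'" "card A = Suc (card A')"
      using a fA card.remove[OF fA a] unfolding A'_def by auto
    have aR: "a \<notin> R" using AR a by auto
    define N where "N = {u\<in>R. E a u}"
    have fN: "finite N" "N \<subseteq> R" using fR unfolding N_def by auto
    define M where "M = (\<lambda>L v. if v \<in> R then L v else L0 v)"
    define c where "c = (\<lambda>B L. real (card {W. W \<subseteq> R - B \<and> card W = s - card B \<and>
      attached (link E hit (M L)) (A' \<union> B) W}))"
    \<comment> \<open>Only the hits on \<open>B\<close> are recorded. Nothing is asked of the other
      neighbours of \<open>a\<close>, so the lists on \<open>R - B\<close> stay uniform and
      independent and the induction hypothesis applies to them. Restricting to \<open>Bs\<close>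
      keeps \<open>s - card B\<close> from being truncated.\<close>
    define ok where "ok = (\<lambda>B (L :: 'a \<Rightarrow> 'b). \<forall>b\<in>B. hit (L0 a) (L b))"
    define Bs where "Bs = {B. B \<subseteq> N \<and> card B \<le> s}"
    have fBs: "finite Bs" unfolding Bs_def using fN(1) by auto
    have fin: "finite {W. W \<subseteq> T \<and> Q W}" if "finite T" for T :: "'a set" and Q
      using that by auto
    have split: "real (card {W. W \<subseteq> R \<and> card W = s \<and> attached (link E hit (M L)) A W}) \<le>
        (\<Sum>B\<in>Bs. of_bool (ok B L) * c B L)" for L
    proof -
      let ?T = "\<lambda>B. (\<lambda>W. B \<union> W) ` {W. W \<subseteq> R - B \<and> card W = s - card B \<and>
        attached (link E hit (M L)) (A' \<union> B) W}"
      have "{W. W \<subseteq> R \<and> card W = s \<and> attached (link E hit (M L)) A W} \<subseteq> (\<Union>B\<in>{B\<in>Bs. ok B L}. ?T B)"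
      proof
        fix W assume "W \<in> {W. W \<subseteq> R \<and> card W = s \<and> attached (link E hit (M L)) A W}"
        then have W: "W \<subseteq> R" "card W = s" "attached (link E hit (M L)) (insert a A') W"
          using A' by auto
        have fW: "finite W" using W(1) fR by (rule finite_subset)
        define B where "B = {w\<in>W. link E hit (M L) a w}"
        have B: "B \<subseteq> W" "finite B" using fW unfolding B_def by auto
        have "attached (link E hit (M L)) (A' \<union> B) (W - B)"
          unfolding B_def using W aR by (intro attached_step) auto
        moreover have "B \<subseteq> N" "ok B L"
          using W(1) aR unfolding B_def N_def ok_def link_def M_def by auto
        moreover have "card B \<le> s" "card (W - B) = s - card B"
          using card_mono[OF fW B(1)] card_Diff_subset[OF B(2,1)] W(2) by auto
        moreover have "W = B \<union> (W - B)" using B(1) by auto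
        ultimately show "W \<in> (\<Union>B\<in>{B\<in>Bs. ok B L}. ?T B)"
          using W(1) unfolding Bs_def by (intro UN_I[of B] image_eqI[of _ _ "W - B"]) auto
      qed
      then have "card {W. W \<subseteq> R \<and> card W = s \<and> attached (link E hit (M L)) A W} \<le>
          card (\<Union>B\<in>{B\<in>Bs. ok B L}. ?T B)"
        using fBs fin[of "R - _"] fR by (intro card_mono) auto
      also have "\<dots> \<le> (\<Sum>B\<in>{B\<in>Bs. ok B L}. card (?T B))" using fBs by (intro card_UN_le) auto
      also have "\<dots> \<le> (\<Sum>B\<in>{B\<in>Bs. ok B L}. card {W. W \<subseteq> R - B \<and> card W = s - card B \<and>
        attached (link E hit (M L)) (A' \<union> B) W})"
        using fR by (intro sum_mono card_image_le fin) auto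
      finally have "real (card {W. W \<subseteq> R \<and> card W = s \<and> attached (link E hit (M L)) A W}) \<le>
        (\<Sum>B\<in>{B\<in>Bs. ok B L}. c B L)" unfolding c_def by (simp add: of_nat_sum[symmetric] del: of_nat_sum)
      also have "\<dots> = (\<Sum>B\<in>Bs. of_bool (ok B L) * c B L)"
        using fBs by (simp add: sum.If_cases of_bool_def if_distrib if_distribR Int_def cong: if_cong)
      finally show ?thesis .
    qed
    let ?x = "exp 1 :: real" and ?K = "real (card X)"
    have summand: "(\<Sum>L\<in>Pi\<^sub>E R (\<lambda>_. X). of_bool (ok B L) * c B L) \<le>
      ?x ^ card A' * (?x * P) ^ s * ?K ^ card R * (p / P) ^ card B" if B: "B \<in> Bs" for B
    proof -
      have BN: "B \<subseteq> R" "finite B" "card B \<le> s" using B fN finite_subset[of B N] unfolding Bs_def by auto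
      have RB: "R = B \<union> (R - B)" "card R = card B + card (R - B)" "finite (R - B)"
        using BN fR card_mono[of R B] by (auto simp: card_Diff_subset)
      have "(\<Sum>L\<in>Pi\<^sub>E R (\<lambda>_. X). of_bool (ok B L) * c B L) =
        (\<Sum>L1\<in>Pi\<^sub>E B (\<lambda>_. X). \<Sum>L2\<in>Pi\<^sub>E (R - B) (\<lambda>_. X).
          of_bool (ok B (\<lambda>v. if v \<in> B then L1 v else L2 v)) * c B (\<lambda>v. if v \<in> B then L1 v else L2 v))"
        by (subst RB(1), rule sum_PiE_Un) auto
      also have "\<dots> = (\<Sum>L1\<in>Pi\<^sub>E B (\<lambda>_. X). of_bool (ok B L1) *
          (\<Sum>L2\<in>Pi\<^sub>E (R - B) (\<lambda>_. X). c B (\<lambda>v. if v \<in> B then L1 v else L2 v)))"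
        by (simp add: ok_def sum_distrib_left cong: ball_cong)
      also have "\<dots> \<le> (\<Sum>L1\<in>Pi\<^sub>E B (\<lambda>_. X). of_bool (ok B L1) *
          (?x ^ card (A' \<union> B) * (?x * P) ^ (s - card B) * ?K ^ card (R - B)))"
      proof (intro sum_mono mult_left_mono)
        fix L1 assume L1: "L1 \<in> Pi\<^sub>E B (\<lambda>_. X)"
        let ?L0 = "\<lambda>v. if v \<in> B then L1 v else L0 v"
        have "(\<Sum>L2\<in>Pi\<^sub>E (R - B) (\<lambda>_. X). c B (\<lambda>v. if v \<in> B then L1 v else L2 v)) =
          (\<Sum>L2\<in>Pi\<^sub>E (R - B) (\<lambda>_. X). real (card {W. W \<subseteq> R - B \<and> card W = s - card B \<and>
            attached (link E hit (\<lambda>v. if v \<in> R - B then L2 v else ?L0 v)) (A' \<union> B) W}))"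
        proof (rule sum.cong)
          fix L2
          have "M (\<lambda>v. if v \<in> B then L1 v else L2 v) = (\<lambda>v. if v \<in> R - B then L2 v else ?L0 v)"
            using BN unfolding M_def by (auto simp: fun_eq_iff)
          then show "c B (\<lambda>v. if v \<in> B then L1 v else L2 v) =
            real (card {W. W \<subseteq> R - B \<and> card W = s - card B \<and>
            attached (link E hit (\<lambda>v. if v \<in> R - B then L2 v else ?L0 v)) (A' \<union> B) W})"
            unfolding c_def by simp
        qed simp
        also have "\<dots> \<le> ?x ^ card (A' \<union> B) * (?x * P) ^ (s - card B) * ?K ^ card (R - B)"
        proof (rule less.hyps)
          have "A' \<inter> B = {}" using AR BN A' by auto
          then show "card (A' \<union> B) + card (R - B) < card A + card R"
            using A' BN RB by (simp add: card_Un_disjoint)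
          show "finite (A' \<union> B)" "finite (R - B)" using A' BN RB by auto
          show "(A' \<union> B) \<inter> (R - B) = {}" using AR A' by auto
          show "card {u \<in> R - B. E b u} \<le> \<Delta>" if "b \<in> A' \<union> B \<union> (R - B)" for b
          proof -
            have "card {u \<in> R - B. E b u} \<le> card {u \<in> R. E b u}" using fR by (intro card_mono) auto
            also have "\<dots> \<le> \<Delta>" using that BN A' by (intro deg) auto
            finally show ?thesis .
          qed
          show "(if b \<in> B then L1 b else L0 b) \<in> X" if "b \<in> A' \<union> B" for b
            using that L0 L1 A' by (auto simp: PiE_iff)
        qed
        finally show "(\<Sum>L2\<in>Pi\<^sub>E (R - B) (\<lambda>_. X). c B (\<lambda>v. if v \<in> B then L1 v else L2 v)) \<le>
          ?x ^ card (A' \<union> B) * (?x * P) ^ (s - card B) * ?K ^ card (R - B)" .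
      qed simp
      also have "\<dots> = real (card {L1\<in>Pi\<^sub>E B (\<lambda>_. X). ok B L1}) *
          (?x ^ card (A' \<union> B) * (?x * P) ^ (s - card B) * ?K ^ card (R - B))"
        using fP[OF BN(2)] by (simp add: sum_distrib_right[symmetric] sum.If_cases of_bool_def Int_def)
      also have "\<dots> \<le> (p * ?K) ^ card B *
          (?x ^ card (A' \<union> B) * (?x * P) ^ (s - card B) * ?K ^ card (R - B))"
      proof (rule mult_right_mono)
        have "{L1\<in>Pi\<^sub>E B (\<lambda>_. X). ok B L1} = Pi\<^sub>E B (\<lambda>_. {y\<in>X. hit (L0 a) y})"
          unfolding ok_def by (auto simp: PiE_iff extensional_def)
        then have "real (card {L1\<in>Pi\<^sub>E B (\<lambda>_. X). ok B L1}) = real (card {y\<in>X. hit (L0 a) y}) ^ card B"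
          using cP[OF BN(2)] by simp
        also have "\<dots> \<le> (p * ?K) ^ card B" using X(2) L0 a by (intro power_mono) auto
        finally show "real (card {L1\<in>Pi\<^sub>E B (\<lambda>_. X). ok B L1}) \<le> (p * ?K) ^ card B" .
      qed (use p in auto)
      \<comment> \<open>The factor \<open>exp 1\<close> of each vertex of \<open>B\<close> as an
        active vertex makes up for the one it loses in \<open>(?x * P) ^ (s - card B)\<close>; what
        remains of it is \<open>p / P\<close>.\<close>
      also have "\<dots> = ?x ^ card A' * (?x * P) ^ s * ?K ^ card R * (p / P) ^ card B"
      proof -
        have "A' \<inter> B = {}" using AR BN A' by auto
        then have 1: "?x ^ card (A' \<union> B) = ?x ^ card A' * ?x ^ card B"
          using A' BN by (simp add: card_Un_disjoint power_add)
        have 2: "(?x * P) ^ s = (?x * P) ^ card B * (?x * P) ^ (s - card B)"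
          using BN(3) by (simp add: power_add[symmetric])
        have 3: "?K ^ card R = ?K ^ card B * ?K ^ card (R - B)" unfolding RB(2) by (rule power_add)
        have 4: "(p / P) ^ card B * P ^ card B = p ^ card B"
          using p(2) by (simp add: power_mult_distrib[symmetric])
        show ?thesis unfolding 1 2 3 by (simp only: power_mult_distrib 4[symmetric] mult_ac)
      qed
      finally show ?thesis .
    qed
    have "(\<Sum>L\<in>Pi\<^sub>E R (\<lambda>_. X). real (card {W. W \<subseteq> R \<and> card W = s \<and> attached (link E hit (M L)) A W})) \<le>
      (\<Sum>L\<in>Pi\<^sub>E R (\<lambda>_. X). \<Sum>B\<in>Bs. of_bool (ok B L) * c B L)"
      by (intro sum_mono split)
    also have "\<dots> = (\<Sum>B\<in>Bs. \<Sum>L\<in>Pi\<^sub>E R (\<lambda>_. X). of_bool (ok B L) * c B L)" by (rule sum.swap)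
    also have "\<dots> \<le> (\<Sum>B\<in>Bs. ?x ^ card A' * (?x * P) ^ s * ?K ^ card R * (p / P) ^ card B)"
      by (intro sum_mono summand)
    also have "\<dots> \<le> (\<Sum>B\<in>Pow N. ?x ^ card A' * (?x * P) ^ s * ?K ^ card R * (p / P) ^ card B)"
      using fN p unfolding Bs_def by (intro sum_mono2) auto
    also have "\<dots> = ?x ^ card A' * (?x * P) ^ s * ?K ^ card R * (1 + p / P) ^ card N"
      using sum_Pow_power[OF fN(1), of "p / P"] by (simp add: sum_distrib_left[symmetric])
    \<comment> \<open>All choices of \<open>B\<close> together contribute at most
      \<open>exp (\<Delta> * p / P) \<le> exp 1\<close>, which is exactly the weight of
      \<open>a\<close> itself.\<close>
    also have "\<dots> \<le> ?x ^ card A' * (?x * P) ^ s * ?K ^ card R * ?x"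
    proof (rule mult_left_mono)
      have "(1 + p / P) ^ card N \<le> exp (p / P) ^ card N"
        using p by (intro power_mono exp_ge_add_one_self) auto
      also have "\<dots> = exp (real (card N) * (p / P))" by (rule exp_of_nat_mult[symmetric])
      also have "\<dots> \<le> exp 1"
      proof -
        have "real (card N) * p \<le> real \<Delta> * p" using deg[of a] a p unfolding N_def by (intro mult_right_mono) auto
        then show ?thesis using p by (simp add: field_simps)
      qed
      finally show "(1 + p / P) ^ card N \<le> ?x" .
    qed (use p in auto)
    also have "\<dots> = ?x ^ card A * (?x * P) ^ s * ?K ^ card R" using A' by (simp add: mult_ac)
    finally show ?thesis unfolding M_def .
  qed
qed

subsection \<open>Critical subgraphs of a list assignment\<close>

lemma critical_subset:
  assumes "finite V" "\<not> lcol E V L"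
  obtains U where "U \<subseteq> V" "\<not> lcol E U L" "\<And>W. W \<subset> U \<Longrightarrow> lcol E W L"
proof -
  have fin: "finite {U. U \<subseteq> V \<and> \<not> lcol E U L}" using assms(1) by simp
  obtain U where U: "U \<subseteq> V" "\<not> lcol E U L"
    and min: "\<And>W. W \<subseteq> V \<Longrightarrow> \<not> lcol E W L \<Longrightarrow> W \<subseteq> U \<Longrightarrow> U = W"
    using finite_has_minimal2[OF fin, of V] assms(2) by auto
  show ?thesis using that[OF U] min U(1) by (metis order.strict_iff_order order_trans)
qed

text \<open>If a closed set \<open>S\<close> containing \<open>v\<close> missed part of
  \<open>U\<close>, then \<open>U \<inter> S\<close> and \<open>U - S\<close> would be proper
  subsets of \<open>U\<close>, hence colourable. Edges between them join vertices with disjoint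
  lists, so the two colourings would combine.\<close>

lemma critical_attached:
  assumes sym: "\<And>u v. E u v \<Longrightarrow> E v u" and v: "v \<in> U" and U: "\<not> lcol E U L"
    and min: "\<And>W. W \<subset> U \<Longrightarrow> lcol E W L"
  shows "attached (link E (\<lambda>x y. x \<inter> y \<noteq> {}) L) {v} (U - {v})"
  unfolding attached_def
proof (intro allI impI)
  fix S assume vS: "{v} \<subseteq> S" and cl: "\<forall>u\<in>S \<inter> ({v} \<union> (U - {v})). \<forall>w\<in>U - {v}.
    link E (\<lambda>x y. x \<inter> y \<noteq> {}) L u w \<longrightarrow> w \<in> S"
  show "U - {v} \<subseteq> S"
  proof (rule ccontr)
    assume n: "\<not> ?thesis"
    have "lcol E (U \<inter> S) L" "lcol E (U - S) L" using n vS v by (auto intro!: min)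
    then obtain c1 c2 where c1: "\<forall>x\<in>U \<inter> S. c1 x \<in> L x"
      "\<forall>x\<in>U \<inter> S. \<forall>y\<in>U \<inter> S. E x y \<longrightarrow> c1 x \<noteq> c1 y"
      and c2: "\<forall>x\<in>U - S. c2 x \<in> L x" "\<forall>x\<in>U - S. \<forall>y\<in>U - S. E x y \<longrightarrow> c2 x \<noteq> c2 y"
      unfolding lcol_def by blast
    have dis: "L x \<inter> L y = {}" if "x \<in> U \<inter> S" "y \<in> U - S" "E x y" for x y
      using cl that v vS unfolding link_def by blast
    let ?c = "\<lambda>x. if x \<in> S then c1 x else c2 x"
    have "?c x \<noteq> ?c y" if xy: "x \<in> U" "y \<in> U" "E x y" for x y
    proof -
      consider "x \<in> S" "y \<in> S" | "x \<notin> S" "y \<notin> S" | "x \<in> S" "y \<notin> S" | "x \<notin> S" "y \<in> S" by blast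
      then show ?thesis
      proof cases
        case 1 then show ?thesis using c1(2) xy by simp
      next
        case 2 then show ?thesis using c2(2) xy by simp
      next
        case 3
        then have "c1 x \<in> L x" "c2 y \<in> L y" "L x \<inter> L y = {}" using c1(1) c2(1) dis xy by auto
        then show ?thesis using 3 by auto
      next
        case 4
        then have "c2 x \<in> L x" "c1 y \<in> L y" "L y \<inter> L x = {}" using c1(1) c2(1) dis sym xy by auto
        then show ?thesis using 4 by auto
      qed
    qed
    moreover have "\<forall>x\<in>U. ?c x \<in> L x" using c1(1) c2(1) by auto
    ultimately have "lcol E U L" unfolding lcol_def by (intro exI[of _ ?c]) blast
    then show False using U by blast
  qed
qed

text \<open>A colour found only at \<open>v\<close> could be given to \<open>v\<close> after
  colouring the rest of \<open>U\<close>. So every colour lies in two lists, and the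
  \<open>k * card U\<close> incidences are counted by colour.\<close>

lemma critical_few_colours:
  assumes sym: "\<And>u v. E u v \<Longrightarrow> E v u" and irr: "\<And>u. \<not> E u u" and fU: "finite U" and U: "\<not> lcol E U L"
    and min: "\<And>W. W \<subset> U \<Longrightarrow> lcol E W L" and L: "\<And>v. v \<in> U \<Longrightarrow> finite (L v) \<and> card (L v) = k"
  shows "2 * card (\<Union>v\<in>U. L v) \<le> k * card U"
proof -
  define C where "C = (\<Union>v\<in>U. L v)"
  have fC: "finite C" unfolding C_def using fU L by blast
  have two: "2 \<le> card {v\<in>U. a \<in> L v}" if a: "a \<in> C" for a
  proof -
    obtain v where v: "v \<in> U" "a \<in> L v" using a unfolding C_def by blast
    have "\<exists>u\<in>U - {v}. a \<in> L u"
    proof (rule ccontr)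
      assume n: "\<not> ?thesis"
      have "lcol E (U - {v}) L" using v by (intro min) blast
      then obtain c where c: "\<forall>x\<in>U - {v}. c x \<in> L x" "\<forall>x\<in>U - {v}. \<forall>y\<in>U - {v}. E x y \<longrightarrow> c x \<noteq> c y"
        unfolding lcol_def by blast
      let ?c = "c(v := a)"
      have na: "\<forall>x\<in>U - {v}. c x \<noteq> a" using n c(1) by metis
      have "?c x \<noteq> ?c y" if "x \<in> U" "y \<in> U" "E x y" for x y
        using that na c(2) irr by (cases "x = v"; cases "y = v") auto
      moreover have "\<forall>x\<in>U. ?c x \<in> L x" using c(1) v by simp
      ultimately have "lcol E U L" unfolding lcol_def by (intro exI[of _ ?c]) blast
      then show False using U by blast
    qed
    then obtain u where "u \<in> U" "u \<noteq> v" "a \<in> L u" by blast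
    then have "{u, v} \<subseteq> {v\<in>U. a \<in> L v}" "card {u, v} = 2" using v by auto
    then show ?thesis using card_mono[of "{v\<in>U. a \<in> L v}" "{u, v}"] fU by simp
  qed
  have "2 * card C = (\<Sum>a\<in>C. 2)" by simp
  also have "\<dots> \<le> (\<Sum>a\<in>C. card {v\<in>U. a \<in> L v})" using two by (rule sum_mono)
  also have "\<dots> = (\<Sum>a\<in>C. \<Sum>v\<in>U. of_bool (a \<in> L v))"
    using fU by (simp add: sum.If_cases of_bool_def Int_def)
  also have "\<dots> = (\<Sum>v\<in>U. \<Sum>a\<in>C. of_bool (a \<in> L v))" by (rule sum.swap)
  also have "\<dots> = (\<Sum>v\<in>U. k)"
  proof (rule sum.cong)
    fix v assume v: "v \<in> U"
    have "(\<Sum>a\<in>C. of_bool (a \<in> L v)) = card {a\<in>C. a \<in> L v}"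
      using fC by (simp add: sum.If_cases of_bool_def Int_def)
    also have "{a\<in>C. a \<in> L v} = L v" using v unfolding C_def by auto
    finally show "(\<Sum>a\<in>C. of_bool (a \<in> L v)) = k" using L[OF v] by simp
  qed simp
  also have "\<dots> = k * card U" by simp
  finally show ?thesis unfolding C_def .
qed

text \<open>The factors of the quotient of binomials are
  \<open>(q - j) / (m - j) \<le> q / m\<close>. This bounds the probability that a random list falls
  into a given palette of \<open>q\<close> colours.\<close>

lemma binomial_ratio:
  assumes "q \<le> m"
  shows "real (q choose k) * real m ^ k \<le> real (m choose k) * real q ^ k"
proof (induction k)
  case (Suc k)
  have rec: "real (Suc k) * real (n choose Suc k) = (real n - real k) * real (n choose k)" if "k \<le> n" for n
  proof -
    have "Suc k * (n choose Suc k) = (n - k) * (n choose k)"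
      using binomial_absorption[of k n] binomial_absorb_comp[of n k] by simp
    then have "real (Suc k * (n choose Suc k)) = real ((n - k) * (n choose k))" by (rule arg_cong)
    then show ?thesis using that by (simp only: of_nat_mult of_nat_diff)
  qed
  show ?case
  proof (cases "k \<le> q")
    case True
    have "real (Suc k) * (real (q choose Suc k) * real m ^ Suc k) =
      ((real q - real k) * real m) * (real (q choose k) * real m ^ k)"
      using rec[OF True] by simp
    also have "\<dots> \<le> ((real m - real k) * real q) * (real (m choose k) * real q ^ k)"
    proof (rule mult_mono[OF _ Suc])
      show "(real q - real k) * real m \<le> (real m - real k) * real q"
        using assms by (simp add: algebra_simps mult_left_mono)
      show "0 \<le> (real m - real k) * real q" using True assms by simp
    qed simp
    also have "\<dots> = real (Suc k) * (real (m choose Suc k) * real q ^ Suc k)"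
      using rec[of m] True assms by simp
    finally show ?thesis by (simp only: mult_le_cancel_left_pos of_nat_0_less_iff zero_less_Suc)
  next
    case False
    then show ?thesis by (simp add: binomial_eq_0)
  qed
qed simp

section \<open>Random lists of \<open>k\<close> colours\<close>

definition ksets :: "nat \<Rightarrow> nat \<Rightarrow> nat set set" where
  "ksets k m = {S. S \<subseteq> {1..m} \<and> card S = k}"

lemma finite_ksets [simp]: "finite (ksets k m)"
  unfolding ksets_def by simp

lemma card_ksets [simp]: "card (ksets k m) = m choose k"
  unfolding ksets_def using n_subsets[of "{1..m}" k] by simp

lemma ksetsD: "S \<in> ksets k m \<Longrightarrow> S \<subseteq> {1..m} \<and> card S = k \<and> finite S"
  unfolding ksets_def using finite_subset[of S "{1..m}"] by simp

text \<open>A given colour lies in the fraction \<open>k / m\<close> of all lists, and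
  \<open>x\<close> offers \<open>k\<close> colours. With \<open>3 * k ^ 2 * \<Delta> \<le> m\<close>
  the expected number of neighbours with meeting lists becomes at most \<open>1 / 3\<close>.\<close>

lemma card_intersecting_ksets:
  assumes "1 \<le> k" "k \<le> m" "x \<in> ksets k m"
  shows "real (card {y\<in>ksets k m. x \<inter> y \<noteq> {}}) \<le> real (k ^ 2) / real m * real (card (ksets k m))"
proof -
  have fx: "finite x" "card x = k" using ksetsD[OF assms(3)] by auto
  have one: "real m * real (card {y\<in>ksets k m. c \<in> y}) \<le> real k * real (m choose k)" if "c \<in> x" for c
  proof -
    have c: "c \<in> {1..m}" using that ksetsD[OF assms(3)] by auto
    have "card {y\<in>ksets k m. c \<in> y} \<le> card {z. z \<subseteq> {1..m} - {c} \<and> card z = k - 1}"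
    proof (rule card_inj_on_le[of "\<lambda>y. y - {c}"])
      show "inj_on (\<lambda>y. y - {c}) {y\<in>ksets k m. c \<in> y}"
        by (rule inj_onI) (metis (no_types, lifting) insert_Diff mem_Collect_eq)
      show "(\<lambda>y. y - {c}) ` {y\<in>ksets k m. c \<in> y} \<subseteq> {z. z \<subseteq> {1..m} - {c} \<and> card z = k - 1}"
        unfolding ksets_def by (auto simp: card_Diff_singleton)
    qed simp
    also have "\<dots> = (m - 1) choose (k - 1)" using n_subsets[of "{1..m} - {c}" "k - 1"] c by simp
    finally have "m * card {y\<in>ksets k m. c \<in> y} \<le> m * ((m - 1) choose (k - 1))" by simp
    also have "\<dots> = k * (m choose k)" using binomial_absorption[of "k - 1" m] assms by simp
    finally have "real (m * card {y\<in>ksets k m. c \<in> y}) \<le> real (k * (m choose k))" by linarith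
    then show ?thesis by simp
  qed
  have "{y\<in>ksets k m. x \<inter> y \<noteq> {}} = (\<Union>c\<in>x. {y\<in>ksets k m. c \<in> y})" by auto
  then have "card {y\<in>ksets k m. x \<inter> y \<noteq> {}} \<le> (\<Sum>c\<in>x. card {y\<in>ksets k m. c \<in> y})"
    using card_UN_le[OF fx(1)] by simp
  then have "real m * real (card {y\<in>ksets k m. x \<inter> y \<noteq> {}}) \<le> real m * (\<Sum>c\<in>x. real (card {y\<in>ksets k m. c \<in> y}))"
    by (intro mult_left_mono) (simp_all add: of_nat_sum[symmetric] del: of_nat_sum)
  also have "\<dots> = (\<Sum>c\<in>x. real m * real (card {y\<in>ksets k m. c \<in> y}))" by (rule sum_distrib_left)
  also have "\<dots> \<le> real (card x) * (real k * real (m choose k))" using one by (rule sum_bounded_above)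
  also have "\<dots> = real (k ^ 2) * real (m choose k)" using fx(2) by (simp add: power2_eq_square)
  finally show ?thesis using assms(1,2) by (simp add: field_simps)
qed

text \<open>Union bound over palettes \<open>Q\<close> of \<open>q = (k * u) div 2\<close> colours:
  there are at most \<open>m ^ q\<close>, and all \<open>u\<close> lists fall into a given one with
  probability at most \<open>(q / m) ^ (k * u)\<close>. Rounding \<open>q\<close> up to
  \<open>k * u / 2\<close> in the exponent and to \<open>k * u\<close> in the base gives the closed
  form.\<close>

lemma card_few_colours:
  assumes "finite V" "U \<subseteq> V" "1 \<le> k" "k \<le> m"
  defines "u \<equiv> card U"
  shows "real (card {L\<in>Pi\<^sub>E V (\<lambda>_. ksets k m). 2 * card (\<Union>v\<in>U. L v) \<le> k * u})
    \<le> real (m choose k) ^ card V * (real (k * u) ^ (k * u) * real m powr - (real (k * u) / 2))"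
proof -
  define q where "q = (k * u) div 2"
  define B where "B = {L\<in>Pi\<^sub>E V (\<lambda>_. ksets k m). 2 * card (\<Union>v\<in>U. L v) \<le> k * u}"
  have fU: "finite U" using assms(2,1) by (rule finite_subset)
  have m: "1 \<le> m" using assms by simp
  have cPi: "card (Pi\<^sub>E V (\<lambda>_. ksets k m)) = (m choose k) ^ card V"
    using assms(1) by (simp add: card_PiE)
  have q2: "real q \<le> real (k * u) / 2" unfolding q_def by linarith
  have "real (card B) \<le> real (m choose k) ^ card V * (real (k * u) ^ (k * u) * real m powr - (real (k * u) / 2))"
  proof (cases "m \<le> q")
    \<comment> \<open>Here palettes of \<open>q\<close> colours may not exist, but the claimed
      factor is at least 1 because \<open>m \<le> k * u\<close>.\<close>
    case True
    have "card B \<le> (m choose k) ^ card V"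
      unfolding B_def cPi[symmetric] using assms(1) by (intro card_mono finite_PiE) auto
    then have "real (card B) \<le> real (m choose k) ^ card V * 1" by (metis mult_1_right of_nat_le_iff of_nat_power)
    also have "\<dots> \<le> real (m choose k) ^ card V * (real (k * u) ^ (k * u) * real m powr - (real (k * u) / 2))"
    proof (rule mult_left_mono)
      have "real m powr (real (k * u) / 2) \<le> real m powr real (k * u)" using m by (intro powr_mono) auto
      also have "\<dots> = real m ^ (k * u)" using m by (subst powr_realpow) auto
      also have "\<dots> \<le> real (k * u) ^ (k * u)"
        using True unfolding q_def by (intro power_mono) linarith+
      finally show "1 \<le> real (k * u) ^ (k * u) * real m powr - (real (k * u) / 2)"
        using m by (simp add: powr_minus field_simps)
    qed simp
    finally show ?thesis .
  next
    case False
    then have qm: "q \<le> m" by simp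
    define F where "F = (\<lambda>Q v. if v \<in> U then {S. S \<subseteq> Q \<and> card S = k} else ksets k m)"
    have cF: "card (Pi\<^sub>E V (F Q)) = (q choose k) ^ u * (m choose k) ^ (card V - u)" if "Q \<in> ksets q m" for Q
    proof -
      have fQ: "finite Q" "card Q = q" using ksetsD[OF that] by auto
      have "card (Pi\<^sub>E V (F Q)) = (\<Prod>v\<in>V. card (F Q v))" by (rule card_PiE[OF assms(1)])
      also have "\<dots> = (\<Prod>v\<in>V. if v \<in> U then q choose k else m choose k)"
        unfolding F_def using n_subsets[OF fQ(1), of k] fQ(2) by (intro prod.cong) auto
      also have "\<dots> = (q choose k) ^ card (V \<inter> U) * (m choose k) ^ card (V \<inter> - U)"
        using assms(1) by (simp add: prod.If_cases)
      also have "V \<inter> U = U" using assms(2) by auto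
      also have "V \<inter> - U = V - U" by auto
      finally show ?thesis using fU assms(2) unfolding u_def by (simp add: card_Diff_subset)
    qed
    have "B \<subseteq> (\<Union>Q\<in>ksets q m. Pi\<^sub>E V (F Q))"
    proof
      fix L assume "L \<in> B"
      then have L: "L \<in> Pi\<^sub>E V (\<lambda>_. ksets k m)" "2 * card (\<Union>v\<in>U. L v) \<le> k * u" unfolding B_def by auto
      let ?C = "\<Union>v\<in>U. L v"
      have C: "?C \<subseteq> {1..m}" using L(1) assms(2) ksetsD unfolding PiE_iff by blast
      have "card ?C \<le> q" using L(2) unfolding q_def by linarith
      then obtain Q where Q: "?C \<subseteq> Q" "Q \<subseteq> {1..m}" "card Q = q"
        using exists_subset_between[of ?C q "{1..m}"] C qm by auto
      have "L \<in> Pi\<^sub>E V (F Q)" using L(1) Q(1) ksetsD unfolding F_def PiE_iff by auto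
      moreover have "Q \<in> ksets q m" using Q unfolding ksets_def by simp
      ultimately show "L \<in> (\<Union>Q\<in>ksets q m. Pi\<^sub>E V (F Q))" by blast
    qed
    moreover have fin: "finite (Pi\<^sub>E V (F Q))" if "Q \<in> ksets q m" for Q
      using ksetsD[OF that] assms(1) unfolding F_def by (intro finite_PiE) auto
    ultimately have "card B \<le> card (\<Union>Q\<in>ksets q m. Pi\<^sub>E V (F Q))" by (intro card_mono) auto
    also have "\<dots> \<le> (\<Sum>Q\<in>ksets q m. card (Pi\<^sub>E V (F Q)))" by (rule card_UN_le[OF finite_ksets])
    also have "\<dots> = (m choose q) * ((q choose k) ^ u * (m choose k) ^ (card V - u))"
      using cF by simp
    finally have "real (card B) \<le> real (m choose q) * (real (q choose k) ^ u * real (m choose k) ^ (card V - u))"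
      by (metis of_nat_le_iff of_nat_mult of_nat_power)
    also have "\<dots> \<le> real m powr (real (k * u) / 2) *
      ((real (m choose k) * (real (k * u) / real m) ^ k) ^ u * real (m choose k) ^ (card V - u))"
    proof (intro mult_mono power_mono)
      have "real (m choose q) \<le> real (m ^ q)" using binomial_le_pow[OF qm] by linarith
      also have "\<dots> = real m powr real q" using m by (simp add: powr_realpow)
      also have "\<dots> \<le> real m powr (real (k * u) / 2)" using m q2 by (intro powr_mono) auto
      finally show "real (m choose q) \<le> real m powr (real (k * u) / 2)" .
      have "real (q choose k) \<le> real (m choose k) * (real q / real m) ^ k"
        using binomial_ratio[OF qm, of k] m by (simp add: field_simps power_divide)
      also have "\<dots> \<le> real (m choose k) * (real (k * u) / real m) ^ k"
        using q2 by (intro mult_left_mono power_mono divide_right_mono) (linarith | simp)+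
      finally show "real (q choose k) \<le> real (m choose k) * (real (k * u) / real m) ^ k" .
    qed auto
    also have "\<dots> = real (m choose k) ^ card V * (real (k * u) ^ (k * u) * real m powr - (real (k * u) / 2))"
    proof -
      have 1: "real (m choose k) ^ u * real (m choose k) ^ (card V - u) = real (m choose k) ^ card V"
        using card_mono[OF assms(1,2)] unfolding u_def by (simp add: power_add[symmetric])
      have "real m powr (real (k * u) / 2) / real m ^ (k * u) =
        real m powr (real (k * u) / 2) / real m powr real (k * u)" using m by (subst powr_realpow) auto
      also have "\<dots> = real m powr - (real (k * u) / 2)"
      proof -
        have "real (k * u) / 2 - real (k * u) = - (real (k * u) / 2)" by linarith
        then show ?thesis unfolding powr_diff[symmetric] by (rule arg_cong)
      qed
      finally have 2: "real m powr - (real (k * u) / 2) = real m powr (real (k * u) / 2) / real m ^ (k * u)" ..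
      show ?thesis unfolding 1[symmetric] 2
        by (simp add: power_mult_distrib power_divide power_mult[symmetric])
    qed
    finally show ?thesis .
  qed
  then show ?thesis unfolding B_def .
qed

subsection \<open>The probability of a bad assignment\<close>

lemma graph_on_sym: "graph_on n E \<Longrightarrow> E u v \<Longrightarrow> E v u"
  and graph_on_irrefl: "graph_on n E \<Longrightarrow> \<not> E u u"
  unfolding graph_on_def by blast+

lemma card_neighbours_le_max_degree:
  assumes "graph_on n E" "a < n"
  shows "card {u\<in>R. E a u} \<le> max_degree n E"
proof -
  have "{u. E a u} \<subseteq> {0..<n}" using assms(1) unfolding graph_on_def by auto
  then have "finite {u. E a u}" by (rule finite_subset) simp
  then have "card {u\<in>R. E a u} \<le> degree E a" unfolding degree_def by (intro card_mono) auto
  also have "\<dots> \<le> max_degree n E" unfolding max_degree_def using assms(2) by (intro Max_ge) auto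
  finally show ?thesis .
qed

text \<open>With a one-element space of lists, where every edge is a link, \<open>p = 1\<close> and
  \<open>P\<close> the maximum degree, \<open>expected_attached_sets\<close> turns into a count of
  connected vertex sets through \<open>v\<close>.\<close>

lemma card_attached_sets:
  assumes "graph_on n E" "1 \<le> max_degree n E" "v < n"
  shows "real (card {W. W \<subseteq> {0..<n} - {v} \<and> card W = s \<and> attached E {v} W})
    \<le> exp 1 * (exp 1 * real (max_degree n E)) ^ s"
proof -
  let ?R = "{0..<n} - {v}"
  have "(\<Sum>L\<in>Pi\<^sub>E ?R (\<lambda>_. {()}). real (card {W. W \<subseteq> ?R \<and> card W = s \<and>
      attached (link E (\<lambda>_ _. True) (\<lambda>w. if w \<in> ?R then L w else ())) {v} W}))
    \<le> exp 1 ^ card {v} * (exp 1 * real (max_degree n E)) ^ s * real (card {()}) ^ card ?R"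
  proof (rule expected_attached_sets[where p = 1 and \<Delta> = "max_degree n E"])
    show "card {u\<in>?R. E a u} \<le> max_degree n E" if "a \<in> {v} \<union> ?R" for a
      using that assms by (intro card_neighbours_le_max_degree) auto
  qed (use assms in auto)
  then show ?thesis by (simp add: link_def card_PiE PiE_singleton)
qed

text \<open>Markov's inequality: the assignments with some such \<open>W\<close> are at most as many
  as the pairs of an assignment and a \<open>W\<close>. Once the list of \<open>v\<close> is fixed,
  \<open>expected_attached_sets\<close> applies with \<open>p = k ^ 2 / m\<close> and
  \<open>P = 1 / 3\<close>.\<close>

lemma card_linked_assignments:
  assumes "graph_on n E" "v < n" "1 \<le> k" "k \<le> m" "3 * k ^ 2 * max_degree n E \<le> m"
  shows "real (card {L\<in>Pi\<^sub>E {0..<n} (\<lambda>_. ksets k m). \<exists>W. W \<subseteq> {0..<n} - {v} \<and> card W = s \<and>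
      attached (link E (\<lambda>x y. x \<inter> y \<noteq> {}) L) {v} W})
    \<le> exp 1 * (exp 1 / 3) ^ s * real (m choose k) ^ n"
proof -
  let ?hit = "\<lambda>x y :: nat set. x \<inter> y \<noteq> {}" and ?X = "ksets k m"
  define R where "R = {0..<n} - {v}"
  have V: "{0..<n} = {v} \<union> R" "finite R" "{v} \<inter> R = {}" using assms(2) unfolding R_def by auto
  have cR: "card R = n - 1" using assms(2) unfolding R_def by simp
  define c where "c = (\<lambda>L. card {W. W \<subseteq> R \<and> card W = s \<and> attached (link E ?hit L) {v} W})"
  have m: "1 \<le> m" using assms by simp
  let ?A = "Pi\<^sub>E {0..<n} (\<lambda>_. ?X)"
  have finA: "finite ?A" by (intro finite_PiE) auto
  have fin: "finite {W. W \<subseteq> R \<and> card W = s \<and> attached (link E ?hit L) {v} W}" for L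
    using V(2) by auto
  have "card {L\<in>?A. \<exists>W. W \<subseteq> R \<and> card W = s \<and> attached (link E ?hit L) {v} W} =
      (\<Sum>L\<in>?A. of_bool (\<exists>W. W \<subseteq> R \<and> card W = s \<and> attached (link E ?hit L) {v} W))"
    using finA by (simp add: sum.If_cases of_bool_def Int_def)
  also have "\<dots> \<le> (\<Sum>L\<in>?A. c L)"
  proof (rule sum_mono)
    fix L
    show "of_bool (\<exists>W. W \<subseteq> R \<and> card W = s \<and> attached (link E ?hit L) {v} W) \<le> c L"
      using card_gt_0_iff[of "{W. W \<subseteq> R \<and> card W = s \<and> attached (link E ?hit L) {v} W}"] fin[of L]
      unfolding c_def of_bool_def by (cases "\<exists>W. W \<subseteq> R \<and> card W = s \<and> attached (link E ?hit L) {v} W") auto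
  qed
  finally have "real (card {L\<in>?A. \<exists>W. W \<subseteq> R \<and> card W = s \<and> attached (link E ?hit L) {v} W})
    \<le> (\<Sum>L\<in>?A. real (c L))" by (simp add: of_nat_sum[symmetric] del: of_nat_sum)
  also have "\<dots> = (\<Sum>L1\<in>Pi\<^sub>E {v} (\<lambda>_. ?X). \<Sum>L2\<in>Pi\<^sub>E R (\<lambda>_. ?X).
      real (c (\<lambda>w. if w \<in> {v} then L1 w else L2 w)))"
    unfolding V(1) by (rule sum_PiE_Un[OF V(3)])
  also have "\<dots> \<le> (\<Sum>L1\<in>Pi\<^sub>E {v} (\<lambda>_. ?X). exp 1 * (exp 1 / 3) ^ s * real (m choose k) ^ card R)"
  proof (rule sum_mono)
    fix L1 assume L1: "L1 \<in> Pi\<^sub>E {v} (\<lambda>_. ?X)"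
    have "(\<Sum>L2\<in>Pi\<^sub>E R (\<lambda>_. ?X). real (c (\<lambda>w. if w \<in> {v} then L1 w else L2 w))) =
      (\<Sum>L2\<in>Pi\<^sub>E R (\<lambda>_. ?X). real (c (\<lambda>w. if w \<in> R then L2 w else L1 w)))"
    proof (rule sum.cong)
      fix L2 assume L2: "L2 \<in> Pi\<^sub>E R (\<lambda>_. ?X)"
      have "(\<lambda>w. if w \<in> {v} then L1 w else L2 w) = (\<lambda>w. if w \<in> R then L2 w else L1 w)"
        using PiE_arb[OF L1] PiE_arb[OF L2] V(3) by (auto simp: fun_eq_iff)
      then show "real (c (\<lambda>w. if w \<in> {v} then L1 w else L2 w)) = real (c (\<lambda>w. if w \<in> R then L2 w else L1 w))"
        by simp
    qed simp
    also have "\<dots> \<le> exp 1 ^ card {v} * (exp 1 * (1 / 3)) ^ s * real (card ?X) ^ card R"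
      unfolding c_def
    proof (rule expected_attached_sets[where p = "real (k ^ 2) / real m" and \<Delta> = "max_degree n E"])
      show "real (card {y \<in> ?X. x \<inter> y \<noteq> {}}) \<le> real (k ^ 2) / real m * real (card ?X)" if "x \<in> ?X" for x
        using card_intersecting_ksets[OF assms(3,4) that] .
      have "real (3 * k ^ 2 * max_degree n E) \<le> real m" using assms(5) by linarith
      then show "real (max_degree n E) * (real (k ^ 2) / real m) \<le> 1 / 3"
        using m by (simp add: field_simps)
      show "card {u\<in>R. E a u} \<le> max_degree n E" if "a \<in> {v} \<union> R" for a
        using that assms(1,2) unfolding R_def by (intro card_neighbours_le_max_degree) auto
      show "L1 a \<in> ?X" if "a \<in> {v}" for a using L1 that by (auto simp: PiE_iff)
    qed (use V in auto)
    finally show "(\<Sum>L2\<in>Pi\<^sub>E R (\<lambda>_. ?X). real (c (\<lambda>w. if w \<in> {v} then L1 w else L2 w)))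
      \<le> exp 1 * (exp 1 / 3) ^ s * real (m choose k) ^ card R" by simp
  qed
  also have "\<dots> = exp 1 * (exp 1 / 3) ^ s * (real (m choose k) * real (m choose k) ^ card R)"
    by (simp add: card_PiE)
  also have "real (m choose k) * real (m choose k) ^ card R = real (m choose k) ^ n"
    unfolding cR using assms(2) by (cases n) auto
  finally show ?thesis unfolding R_def .
qed

text \<open>The sets \<open>W\<close> are counted in the graph itself and not in the random linked
  graph; this costs \<open>(exp 1 * \<Delta>) ^ u\<close> but leaves the event of few colours free
  of conditioning. \<open>S\<close> replaces \<open>u\<close> in the base so that the bound is a
  pure \<open>u\<close>-th power.\<close>

lemma card_few_coloured_attached:
  assumes "graph_on n E" "1 \<le> max_degree n E" "v < n" "1 \<le> k" "k \<le> m" "1 \<le> u" "u \<le> S"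
  shows "real (card {L\<in>Pi\<^sub>E {0..<n} (\<lambda>_. ksets k m). \<exists>W. W \<subseteq> {0..<n} - {v} \<and> card W = u - 1 \<and>
      attached E {v} W \<and> 2 * card (\<Union>w\<in>insert v W. L w) \<le> k * u})
    \<le> (exp 1 * real (max_degree n E) * real (k * S) ^ k * real m powr - (real k / 2)) ^ u * real (m choose k) ^ n"
proof -
  let ?A = "Pi\<^sub>E {0..<n} (\<lambda>_. ksets k m)" and ?D = "real (max_degree n E)"
  define Ws where "Ws = {W. W \<subseteq> {0..<n} - {v} \<and> card W = u - 1 \<and> attached E {v} W}"
  have fW: "finite Ws" unfolding Ws_def by auto
  have finA: "finite ?A" by (intro finite_PiE) auto
  define F where "F = (\<lambda>W. {L\<in>?A. 2 * card (\<Union>w\<in>insert v W. L w) \<le> k * u})"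
  let ?b = "real (m choose k) ^ n * (real (k * u) ^ (k * u) * real m powr - (real (k * u) / 2))"
  have F: "real (card (F W)) \<le> ?b" if "W \<in> Ws" for W
  proof -
    have W: "W \<subseteq> {0..<n} - {v}" "card W = u - 1" using that unfolding Ws_def by auto
    have "finite W" using W(1) by (rule finite_subset) simp
    moreover have "v \<notin> W" using W by auto
    ultimately have "card (insert v W) = u" using W(2) assms(6) by simp
    moreover have "insert v W \<subseteq> {0..<n}" using W(1) assms(3) by auto
    ultimately show ?thesis
      using card_few_colours[of "{0..<n}" "insert v W" k m] assms(4,5) unfolding F_def by simp
  qed
  have "{L\<in>?A. \<exists>W. W \<subseteq> {0..<n} - {v} \<and> card W = u - 1 \<and> attached E {v} W \<and>
      2 * card (\<Union>w\<in>insert v W. L w) \<le> k * u} = (\<Union>W\<in>Ws. F W)"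
    unfolding Ws_def F_def by blast
  then have "real (card {L\<in>?A. \<exists>W. W \<subseteq> {0..<n} - {v} \<and> card W = u - 1 \<and> attached E {v} W \<and>
      2 * card (\<Union>w\<in>insert v W. L w) \<le> k * u}) \<le> real (\<Sum>W\<in>Ws. card (F W))"
    using card_UN_le[OF fW, of F] by (simp only: of_nat_le_iff)
  also have "\<dots> = (\<Sum>W\<in>Ws. real (card (F W)))" by simp
  also have "\<dots> \<le> real (card Ws) * ?b" using F by (rule sum_bounded_above)
  also have "\<dots> \<le> (exp 1 * ?D) ^ u * ((real (k * S) ^ k * real m powr - (real k / 2)) ^ u * real (m choose k) ^ n)"
  proof (rule mult_mono)
    have "real (card Ws) \<le> exp 1 * (exp 1 * ?D) ^ (u - 1)"
      unfolding Ws_def by (rule card_attached_sets[OF assms(1-3)])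
    also have "\<dots> \<le> (exp 1 * ?D) * (exp 1 * ?D) ^ (u - 1)" using assms(2) by (intro mult_right_mono) auto
    also have "\<dots> = (exp 1 * ?D) ^ u" using assms(6) by (cases u) auto
    finally show "real (card Ws) \<le> (exp 1 * ?D) ^ u" .
    have 1: "real m powr - (real (k * u) / 2) = (real m powr - (real k / 2)) ^ u"
      using assms(4,5) by (simp add: powr_power mult.commute)
    have "real (k * u) ^ (k * u) \<le> real (k * S) ^ (k * u)"
    proof (rule power_mono)
      show "real (k * u) \<le> real (k * S)" using mult_le_mono2[OF assms(7), of k] by linarith
    qed simp
    also have "\<dots> = (real (k * S) ^ k) ^ u" by (simp add: power_mult)
    finally show "?b \<le> (real (k * S) ^ k * real m powr - (real k / 2)) ^ u * real (m choose k) ^ n"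
      unfolding 1 power_mult_distrib
      by (subst mult.commute) (intro mult_right_mono, auto)
  qed auto
  finally show ?thesis by (simp add: power_mult_distrib mult_ac)
qed

text \<open>A critical set is rooted at an arbitrary vertex. Sets with at most \<open>S\<close>
  vertices are charged for having few colours; larger ones have at least \<open>S\<close> vertices
  besides the root and are charged for being linked, with \<open>n ^ 2\<close> counting roots and
  sizes.\<close>

lemma colour_prob_bound:
  assumes g: "graph_on n E" and D: "1 \<le> max_degree n E" and k: "1 \<le> k" "k \<le> m"
    and m: "3 * k ^ 2 * max_degree n E \<le> m"
    and small: "\<And>U L :: nat \<Rightarrow> nat set. U \<subseteq> {0..<n} \<Longrightarrow> real (card U) < s0 \<Longrightarrow>
      (\<And>v. v \<in> U \<Longrightarrow> finite (L v) \<and> card (L v) = k) \<Longrightarrow> lcol E U L"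
  shows "1 - colour_prob n E k m \<le>
    real n * (\<Sum>u\<in>{u. 1 \<le> u \<and> u \<le> S \<and> s0 \<le> real u}.
      (exp 1 * real (max_degree n E) * real (k * S) ^ k * real m powr - (real k / 2)) ^ u)
    + real n ^ 2 * (exp 1 * (exp 1 / 3) ^ S)"
proof -
  let ?V = "{0..<n}" and ?hit = "\<lambda>x y :: nat set. x \<inter> y \<noteq> {}"
  let ?A = "Pi\<^sub>E ?V (\<lambda>_. ksets k m)"
  let ?K = "real (m choose k) ^ n"
  define \<beta> where "\<beta> = exp 1 * real (max_degree n E) * real (k * S) ^ k * real m powr - (real k / 2)"
  have A: "list_assignments n k m = ?A" unfolding list_assignments_def ksets_def ..
  have cA: "card ?A = (m choose k) ^ n" by (simp add: card_PiE)
  have K0: "0 < ?K" using k by simp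
  have finA: "finite ?A" by (intro finite_PiE) auto
  have col: "list_colourable n E L \<longleftrightarrow> lcol E ?V L" for L
    unfolding list_colourable_def lcol_def by (simp add: Ball_def)
  define bad where "bad = {L\<in>?A. \<not> lcol E ?V L}"
  define few where "few = (\<lambda>v u. {L\<in>?A. \<exists>W. W \<subseteq> ?V - {v} \<and> card W = u - 1 \<and>
      attached E {v} W \<and> 2 * card (\<Union>w\<in>insert v W. L w) \<le> k * u})"
  define conn where "conn = (\<lambda>v s. {L\<in>?A. \<exists>W. W \<subseteq> ?V - {v} \<and> card W = s \<and>
      attached (link E ?hit L) {v} W})"
  define Us where "Us = {u. 1 \<le> u \<and> u \<le> S \<and> s0 \<le> real u}"
  have fU: "finite Us" unfolding Us_def by simp
  have fin: "finite (few v u)" "finite (conn v u)" for v u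
    using finA unfolding few_def conn_def by auto
  have "bad \<subseteq> (\<Union>v\<in>?V. (\<Union>u\<in>Us. few v u) \<union> (\<Union>s\<in>{S..<n}. conn v s))"
  proof
    fix L assume "L \<in> bad"
    then have L: "L \<in> ?A" "\<not> lcol E ?V L" unfolding bad_def by auto
    obtain U where U: "U \<subseteq> ?V" "\<not> lcol E U L" "\<And>W. W \<subset> U \<Longrightarrow> lcol E W L"
      using critical_subset[of ?V E L] L(2) by auto
    have fin: "finite U" using U(1) by (rule finite_subset) simp
    have kL: "finite (L v) \<and> card (L v) = k" if "v \<in> U" for v
      using that U(1) L(1) ksetsD[of "L v" k m] by (auto simp: PiE_iff)
    have big: "s0 \<le> real (card U)" using small[OF U(1) _ kL] U(2) by force
    have "U \<noteq> {}" using U(2) by auto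
    then obtain v where v: "v \<in> U" by blast
    have u: "1 \<le> card U" "card (U - {v}) = card U - 1" "card U \<le> n"
      using v fin U(1) card_mono[of ?V U] by (auto simp: card_gt_0_iff Suc_le_eq)
    have att: "attached (link E ?hit L) {v} (U - {v})"
      by (rule critical_attached[OF graph_on_sym[OF g] v U(2,3)])
    then have att': "attached E {v} (U - {v})" by (rule attached_mono) (simp add: link_def)
    have cols: "2 * card (\<Union>w\<in>U. L w) \<le> k * card U"
      by (rule critical_few_colours[OF graph_on_sym[OF g] graph_on_irrefl[OF g] fin U(2,3) kL])
    show "L \<in> (\<Union>v\<in>?V. (\<Union>u\<in>Us. few v u) \<union> (\<Union>s\<in>{S..<n}. conn v s))"
    proof (cases "card U \<le> S")
      case True
      have "insert v (U - {v}) = U" using v by auto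
      then have "L \<in> few v (card U)"
        unfolding few_def using L(1) u att' cols U(1)
        by (intro CollectI conjI exI[of _ "U - {v}"]) auto
      moreover have "card U \<in> Us" using True u big unfolding Us_def by simp
      ultimately show ?thesis using v U(1) by blast
    next
      case False
      have "L \<in> conn v (card U - 1)"
        unfolding conn_def using L(1) u att U(1) by (intro CollectI conjI exI[of _ "U - {v}"]) auto
      moreover have "card U - 1 \<in> {S..<n}" using False u by auto
      ultimately show ?thesis using v U(1) by blast
    qed
  qed
  then have "card bad \<le> card (\<Union>v\<in>?V. (\<Union>u\<in>Us. few v u) \<union> (\<Union>s\<in>{S..<n}. conn v s))"
    using fin fU by (intro card_mono) auto
  also have "\<dots> \<le> (\<Sum>v\<in>?V. card ((\<Union>u\<in>Us. few v u) \<union> (\<Union>s\<in>{S..<n}. conn v s)))"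
    by (rule card_UN_le) simp
  also have "\<dots> \<le> (\<Sum>v\<in>?V. (\<Sum>u\<in>Us. card (few v u)) + (\<Sum>s\<in>{S..<n}. card (conn v s)))"
    using fU by (intro sum_mono order_trans[OF card_Un_le] add_mono card_UN_le) auto
  finally have "real (card bad) \<le> (\<Sum>v\<in>?V. (\<Sum>u\<in>Us. real (card (few v u))) + (\<Sum>s\<in>{S..<n}. real (card (conn v s))))"
    by (simp add: of_nat_sum[symmetric] of_nat_add[symmetric] del: of_nat_sum of_nat_add)
  also have "\<dots> \<le> (\<Sum>v\<in>?V. (\<Sum>u\<in>Us. \<beta> ^ u * ?K) + real n * (exp 1 * (exp 1 / 3) ^ S * ?K))"
  proof (intro sum_mono add_mono)
    fix v assume v: "v \<in> ?V"
    show "real (card (few v u)) \<le> \<beta> ^ u * ?K" if "u \<in> Us" for u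
      unfolding few_def \<beta>_def using that v unfolding Us_def
      by (intro card_few_coloured_attached[OF g D _ k]) auto
    have "real (card (conn v s)) \<le> exp 1 * (exp 1 / 3) ^ S * ?K" if "s \<in> {S..<n}" for s
    proof -
      have "real (card (conn v s)) \<le> exp 1 * (exp 1 / 3) ^ s * ?K"
        unfolding conn_def using v by (intro card_linked_assignments[OF g _ k m]) auto
      also have "\<dots> \<le> exp 1 * (exp 1 / 3) ^ S * ?K"
        using that exp_le by (intro mult_right_mono mult_left_mono power_decreasing) auto
      finally show ?thesis .
    qed
    then have "(\<Sum>s\<in>{S..<n}. real (card (conn v s))) \<le> real (card {S..<n}) * (exp 1 * (exp 1 / 3) ^ S * ?K)"
      by (rule sum_bounded_above)
    also have "\<dots> \<le> real n * (exp 1 * (exp 1 / 3) ^ S * ?K)" by (intro mult_right_mono) auto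
    finally show "(\<Sum>s\<in>{S..<n}. real (card (conn v s))) \<le> real n * (exp 1 * (exp 1 / 3) ^ S * ?K)" .
  qed
  also have "\<dots> = (real n * (\<Sum>u\<in>Us. \<beta> ^ u) + real n ^ 2 * (exp 1 * (exp 1 / 3) ^ S)) * ?K"
    by (simp add: sum_distrib_right[symmetric] algebra_simps power2_eq_square)
  finally have bad: "real (card bad) / ?K \<le> real n * (\<Sum>u\<in>Us. \<beta> ^ u) + real n ^ 2 * (exp 1 * (exp 1 / 3) ^ S)"
    using K0 by (simp add: pos_divide_le_eq)
  have "?A = {L\<in>?A. lcol E ?V L} \<union> bad" "{L\<in>?A. lcol E ?V L} \<inter> bad = {}" unfolding bad_def by auto
  then have "card ?A = card {L\<in>?A. lcol E ?V L} + card bad"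
    using finA by (metis card_Un_disjoint finite_Un)
  then have "real (card {L\<in>?A. lcol E ?V L}) + real (card bad) = ?K" unfolding cA by (metis of_nat_add of_nat_power)
  then have "real (card bad) = ?K - real (card {L\<in>?A. lcol E ?V L})" by linarith
  then have "real (card bad) / ?K = 1 - real (card {L\<in>?A. lcol E ?V L}) / ?K"
    using divide_self[of ?K] K0 by (simp only: diff_divide_distrib less_irrefl)
  also have "\<dots> = 1 - colour_prob n E k m" unfolding colour_prob_def A col cA by simp
  finally show ?thesis using bad unfolding Us_def \<beta>_def by simp
qed

section \<open>Passing to the limit\<close>

lemma colour_prob_le_1: "colour_prob n E k m \<le> 1"
proof -
  have "finite (list_assignments n k m)" unfolding list_assignments_def by (intro finite_PiE) auto
  then have "card {L \<in> list_assignments n k m. list_colourable n E L} \<le> card (list_assignments n k m)"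
    by (intro card_mono) auto
  then show ?thesis unfolding colour_prob_def by (intro divide_le_eq_1[THEN iffD2]) auto
qed

lemma colour_prob_edgeless:
  assumes "graph_on n E" "max_degree n E = 0" "1 \<le> k" "k \<le> m"
  shows "colour_prob n E k m = 1"
proof -
  have A: "list_assignments n k m = Pi\<^sub>E {0..<n} (\<lambda>_. ksets k m)"
    unfolding list_assignments_def ksets_def ..
  have noedge: "\<not> E u v" if "u < n" for u v
  proof
    assume "E u v"
    then have "card {w\<in>{v}. E u w} = 1" by (simp add: Collect_conv_if)
    then show False using card_neighbours_le_max_degree[OF assms(1) that, of "{v}"] assms(2) by simp
  qed
  have "list_colourable n E L" if "L \<in> list_assignments n k m" for L
  proof -
    have "\<forall>v<n. \<exists>c. c \<in> L v"
    proof (intro allI impI)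
      fix v assume "v < n"
      then have "card (L v) = k" using that ksetsD[of "L v" k m] unfolding A by (auto simp: PiE_iff)
      then show "\<exists>c. c \<in> L v" using assms(3) by (metis card.empty ex_in_conv not_one_le_zero)
    qed
    then show ?thesis using noedge unfolding list_colourable_def by metis
  qed
  then have "{L \<in> list_assignments n k m. list_colourable n E L} = list_assignments n k m" by blast
  moreover have "card (list_assignments n k m) \<noteq> 0" unfolding A using assms by (simp add: card_PiE)
  ultimately show ?thesis unfolding colour_prob_def by simp
qed

text \<open>Critical sets of more than logarithmic size do not occur because the linked components are
  subcritical. A smaller critical set with \<open>u\<close> vertices costs \<open>n powr (- \<gamma> * k * u / 2)\<close>, and half of
  this pays for the choice of a root, since \<open>u \<ge> 4 / (\<gamma> * k)\<close>.\<close>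
lemma aas_colourable_if_small_choosable:
  fixes \<gamma> :: real
  assumes \<gamma>: "0 < \<gamma>" and k: "1 \<le> k" and g: "\<And>n. graph_on n (G n)" and mk: "\<And>n. k \<le> m n"
    and m3: "\<And>n. 3 * k ^ 2 * max_degree n (G n) \<le> m n"
    and ev: "eventually (\<lambda>n. real n powr \<gamma> * real (max_degree n (G n)) powr (2 / real k) < real (m n)) sequentially"
    and small: "\<And>n U L. U \<subseteq> {0..<n} \<Longrightarrow> real (card U) < 4 / (\<gamma> * real k) \<Longrightarrow>
      (\<And>v. v \<in> U \<Longrightarrow> finite (L v) \<and> card (L v) = k) \<Longrightarrow> lcol (G n) U (L :: nat \<Rightarrow> nat set)"
  shows "aas_colourable G k m"
proof -
  \<comment> \<open>For \<open>S \<ge> C * ln n\<close> this gives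
    \<open>(exp 1 / 3) ^ S \<le> 1 / n ^ 3\<close>, which leaves \<open>exp 1 / n\<close> after the
    factor \<open>n ^ 2\<close>.\<close>
  define C where "C = 3 / ln (3 / exp (1 :: real))"
  \<comment> \<open>Strictness is needed for a positive \<open>ln (3 / exp 1)\<close>; it follows
    from \<open>(21 / 16) ^ 4 < 3\<close>.\<close>
  have "exp 1 = exp (1 / 4 :: real) ^ 4" by (simp add: exp_of_nat_mult[symmetric])
  also have "\<dots> \<le> (1 + 1 / 4 + (1 / 4)\<^sup>2) ^ 4" by (intro power_mono exp_bound) auto
  also have "\<dots> < (3 :: real)" by (simp add: power2_eq_square eval_nat_numeral)
  finally have e3: "exp 1 < (3 :: real)" .
  then have l3: "0 < ln (3 / exp (1 :: real))" by (intro ln_gt_zero) simp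
  have C: "0 < C" unfolding C_def using l3 by simp
  define s where "s = (\<lambda>n :: nat. C * ln (real n) + 1)"
  \<comment> \<open>The lists contribute \<open>n powr - (2 * a)\<close>. One \<open>a\<close> pays
    for the root, as \<open>1 \<le> a * u\<close>; the other makes \<open>\<delta>\<close> tend to 0
    in spite of the logarithms.\<close>
  define a where "a = \<gamma> * real k / 4"
  have a: "0 < a" unfolding a_def using \<gamma> k by simp
  define \<delta> where "\<delta> = (\<lambda>n :: nat. exp 1 * (real k * s n) ^ k * real n powr - a)"
  define h where "h = (\<lambda>n :: nat. s n * \<delta> n + exp 1 / real n)"
  have slim: "(\<lambda>n :: nat. (C * ln (real n) + 1) powr b * real n powr - a) \<longlonglongrightarrow> 0" if "0 < b" for b
    using C a that by real_asymp
  have spow: "eventually (\<lambda>n. (C * ln (real n) + 1) powr (real j) = s n ^ j) sequentially" for j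
    using eventually_ge_at_top[of 1]
  proof eventually_elim
    case (elim n)
    then have "0 < C * ln (real n) + 1" using C by (simp add: add_nonneg_pos)
    then show ?case unfolding s_def by (simp add: powr_realpow)
  qed
  have lim: "(\<lambda>n. s n ^ j * real n powr - a) \<longlonglongrightarrow> 0" if "0 < j" for j
    by (rule Lim_transform_eventually[OF slim[of "real j"]])
       (use that spow[of j] in \<open>auto elim: eventually_mono\<close>)
  have "(\<lambda>n. exp 1 * real k ^ k * (s n ^ k * real n powr - a)) \<longlonglongrightarrow> exp 1 * real k ^ k * 0"
    using k by (intro tendsto_mult tendsto_const lim) auto
  then have \<delta>0: "\<delta> \<longlonglongrightarrow> 0" unfolding \<delta>_def power_mult_distrib by (simp add: mult_ac)
  have "(\<lambda>n. exp 1 * real k ^ k * (s n ^ Suc k * real n powr - a) + exp 1 / real n) \<longlonglongrightarrow>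
      exp 1 * real k ^ k * 0 + 0"
    by (intro tendsto_add tendsto_mult tendsto_const lim lim_const_over_n) simp
  then have h0: "h \<longlonglongrightarrow> 0" unfolding h_def \<delta>_def power_mult_distrib by (simp add: mult_ac)
  have \<delta>1: "eventually (\<lambda>n. \<delta> n < 1) sequentially" using \<delta>0 by (rule order_tendstoD) simp
  have "eventually (\<lambda>n. 1 - h n \<le> colour_prob n (G n) k (m n)) sequentially"
    using ev \<delta>1 eventually_ge_at_top[of 1]
  proof eventually_elim
    case (elim n)
    let ?D = "real (max_degree n (G n))"
    have n: "1 \<le> real n" using elim by simp
    have s1: "1 \<le> s n" unfolding s_def using C n by simp
    have \<delta>n: "0 \<le> \<delta> n" unfolding \<delta>_def using s1 by simp
    \<comment> \<open>The estimate of \<open>\<beta>\<close> divides by \<open>?D\<close>, so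
      edgeless graphs are separated.\<close>
    show ?case
    proof (cases "max_degree n (G n) = 0")
      case True
      have "0 \<le> h n" unfolding h_def using \<delta>n s1 by (intro add_nonneg_nonneg mult_nonneg_nonneg) auto
      then show ?thesis using colour_prob_edgeless[OF g True k mk] by simp
    next
      case False
      then have D: "1 \<le> max_degree n (G n)" by simp
      define S where "S = nat \<lceil>C * ln (real n)\<rceil>"
      have Cl: "0 \<le> C * ln (real n)" using C n by simp
      have S: "C * ln (real n) \<le> real S" "real S \<le> s n" unfolding S_def s_def using Cl by linarith+
      define \<beta> where "\<beta> = exp 1 * ?D * real (k * S) ^ k * real (m n) powr - (real k / 2)"
      have "real (m n) powr - (real k / 2) \<le> (real n powr \<gamma> * ?D powr (2 / real k)) powr - (real k / 2)"
        using elim(1) D n by (intro powr_mono2') auto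
      also have "\<dots> = real n powr (- (2 * a)) * ?D powr - 1"
        using D n k by (simp add: powr_mult powr_powr a_def field_simps)
      finally have mp: "real (m n) powr - (real k / 2) \<le> real n powr (- (2 * a)) / ?D"
        using D by (simp add: powr_minus_divide)
      have \<beta>: "\<beta> \<le> exp 1 * (real k * s n) ^ k * real n powr (- (2 * a))"
      proof -
        have "\<beta> \<le> exp 1 * ?D * (real k * s n) ^ k * (real n powr (- (2 * a)) / ?D)"
          unfolding \<beta>_def using S(2) s1 mp
          by (intro mult_mono power_mono mult_nonneg_nonneg) (auto intro!: mult_left_mono)
        then show ?thesis using D by (simp add: field_simps)
      qed
      have summand: "real n * \<beta> ^ u \<le> \<delta> n" if u: "1 \<le> u" "4 / (\<gamma> * real k) \<le> real u" for u
      proof -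
        have \<beta>0: "0 \<le> \<beta>" unfolding \<beta>_def by simp
        have "1 \<le> a * real u" using u(2) \<gamma> k unfolding a_def by (simp add: field_simps)
        then have "real n powr 1 \<le> real n powr (a * real u)" using n by (intro powr_mono) auto
        also have "\<dots> = (real n powr a) ^ u" using n by (simp add: powr_power mult.commute)
        finally have "real n * \<beta> ^ u \<le> (real n powr a) ^ u * (exp 1 * (real k * s n) ^ k * real n powr (- (2 * a))) ^ u"
          using \<beta> \<beta>0 n by (intro mult_mono power_mono) auto
        also have "\<dots> = (exp 1 * (real k * s n) ^ k * (real n powr a * real n powr (- (2 * a)))) ^ u"
          unfolding power_mult_distrib[symmetric] by (simp add: mult_ac)
        also have "real n powr a * real n powr (- (2 * a)) = real n powr - a"
          unfolding powr_add[symmetric] by simp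
        also have "(exp 1 * (real k * s n) ^ k * real n powr - a) ^ u = \<delta> n ^ u" unfolding \<delta>_def ..
        also have "\<dots> \<le> \<delta> n ^ 1" using u(1) \<delta>n elim(2) by (intro power_decreasing) auto
        finally show ?thesis by simp
      qed
      let ?Us = "{u. 1 \<le> u \<and> u \<le> S \<and> 4 / (\<gamma> * real k) \<le> real u}"
      have "1 - colour_prob n (G n) k (m n) \<le>
        real n * (\<Sum>u\<in>?Us. \<beta> ^ u) + real n ^ 2 * (exp 1 * (exp 1 / 3) ^ S)"
        unfolding \<beta>_def by (rule colour_prob_bound[OF g D k mk m3 small])
      also have "real n * (\<Sum>u\<in>?Us. \<beta> ^ u) = (\<Sum>u\<in>?Us. real n * \<beta> ^ u)" by (rule sum_distrib_left)
      also have "\<dots> \<le> real (card ?Us) * \<delta> n" using summand by (intro sum_bounded_above) auto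
      also have "\<dots> \<le> s n * \<delta> n"
      proof (rule mult_right_mono)
        have "card ?Us \<le> card {1..S}" by (intro card_mono) auto
        then show "real (card ?Us) \<le> s n" using S(2) by simp
      qed (rule \<delta>n)
      also have "real n ^ 2 * (exp 1 * (exp 1 / 3) ^ S) \<le> exp 1 / real n"
      proof -
        have "(exp 1 / 3 :: real) = exp (- ln (3 / exp 1))" by (simp add: exp_minus)
        then have "(exp 1 / 3 :: real) ^ S = exp (real S * - ln (3 / exp 1))"
          by (simp only: exp_of_nat_mult)
        also have "real S * - ln (3 / exp 1) = - (real S * ln (3 / exp 1))" by simp
        also have "exp (- (real S * ln (3 / exp 1))) \<le> exp (- (3 * ln (real n)))"
        proof -
          have "3 * ln (real n) = C * ln (real n) * ln (3 / exp 1)" unfolding C_def using l3 by simp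
          also have "\<dots> \<le> real S * ln (3 / exp 1)" using S(1) l3 by (intro mult_right_mono) auto
          finally show ?thesis by simp
        qed
        also have "\<dots> = 1 / real n ^ 3"
        proof -
          have "3 * ln (real n) = ln (real n ^ 3)" using n by (simp add: ln_realpow)
          then show ?thesis using n by (simp add: exp_minus inverse_eq_divide)
        qed
        finally have "real n ^ 2 * (exp 1 * (exp 1 / 3) ^ S) \<le> real n ^ 2 * (exp 1 * (1 / real n ^ 3))"
          by (intro mult_left_mono) auto
        also have "\<dots> = exp 1 / real n" using n by (simp add: power2_eq_square power3_eq_cube)
        finally show ?thesis .
      qed
      finally show ?thesis unfolding h_def by linarith
    qed
  qed
  then show ?thesis unfolding aas_colourable_def
  proof (rule tendsto_sandwich)
    show "eventually (\<lambda>n. colour_prob n (G n) k (m n) \<le> 1) sequentially"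
      by (rule always_eventually) (simp add: colour_prob_le_1)
    show "(\<lambda>n. 1 - h n) \<longlonglongrightarrow> 1" using tendsto_diff[OF tendsto_const h0, of 1] by simp
  qed (rule tendsto_const)
qed

subsection \<open>Choosability of small graphs without the forbidden subgraph\<close>

text \<open>With \<open>t\<close> just above \<open>2 * card V / k\<close>, stripping uses at most
  half of each list. The remaining \<open>k div 2\<close> colours suffice if
  \<open>card V * exp (- q * (k div 2)) < 1\<close>; the factor 3 instead of 2 in the hypothesis
  absorbs the rounding, as \<open>k \<le> 3 * (k div 2)\<close>.\<close>

lemma choosable_if_fractional:
  assumes V: "finite V" and k: "3 \<le> k" and q: "0 \<le> q" "q \<le> 1"
    and frac: "\<And>t U. 0 < t \<Longrightarrow> real t \<le> 2 * real (card V) / real k + 1 \<Longrightarrow> U \<subseteq> V \<Longrightarrow>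
      (\<And>I. I \<subseteq> U \<Longrightarrow> indep E I \<Longrightarrow> card I < t) \<Longrightarrow> fractional E q U"
    and ln: "3 * ln (real (card V)) < q * real k"
    and L: "\<And>v. v \<in> V \<Longrightarrow> finite (L v) \<and> card (L v) = k"
  shows "lcol E V L"
proof -
  define t where "t = nat \<lfloor>2 * real (card V) / real k\<rfloor> + 1"
  have "0 \<le> 2 * real (card V) / real k" by simp
  then have t: "0 < t" "real t \<le> 2 * real (card V) / real k + 1" "2 * real (card V) / real k \<le> real t"
    unfolding t_def by linarith+
  show ?thesis
  proof (rule strip_lcol[OF V q t(1), where k = "k div 2"])
    show "fractional E q U" if "U \<subseteq> V" "\<And>I. I \<subseteq> U \<Longrightarrow> indep E I \<Longrightarrow> card I < t" for U
      using frac[OF t(1,2) that] .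
    have "real (card V) / real t \<le> real k / 2" using t(1,3) k by (simp add: field_simps)
    then show "finite (L v) \<and> real (k div 2) + real (card V) / real t \<le> real (card (L v))"
      if "v \<in> V" for v using L[OF that] by linarith
    show "real (card V) * (1 - q) ^ (k div 2) < 1"
    proof (cases "V = {}")
      case False
      then have N: "0 < real (card V)" using V by (simp add: card_gt_0_iff)
      have "(1 - q) ^ (k div 2) \<le> exp (- q) ^ (k div 2)"
        using exp_ge_add_one_self[of "- q"] q by (intro power_mono) auto
      also have "\<dots> = exp (real (k div 2) * - q)" by (rule exp_of_nat_mult[symmetric])
      also have "\<dots> < exp (- ln (real (card V)))"
      proof -
        have "real k \<le> 3 * real (k div 2)" using k by linarith
        then have "q * real k \<le> q * (3 * real (k div 2))" using q by (intro mult_left_mono) auto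
        then show ?thesis using ln by (simp add: mult.commute)
      qed
      also have "\<dots> = 1 / real (card V)" using N by (simp add: exp_minus inverse_eq_divide)
      finally show ?thesis using N by (simp add: field_simps)
    qed simp
  qed
qed

lemma fractional_antimono:
  assumes "fractional E q U" "q' \<le> q"
  shows "fractional E q' U"
  unfolding fractional_def
proof (intro allI impI)
  fix w :: "'a \<Rightarrow> real" assume w: "\<forall>v\<in>U. 0 \<le> w v"
  then obtain I where I: "I \<subseteq> U" "indep E I" "q * sum w U \<le> sum w I"
    using assms(1) unfolding fractional_def by blast
  have "q' * sum w U \<le> q * sum w U"
    using assms(2) w by (intro mult_right_mono sum_nonneg) auto
  then show "\<exists>I\<subseteq>U. indep E I \<and> q' * sum w U \<le> sum w I" using I by (meson order_trans)
qed

lemma not_has_cliqueD: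
  assumes "\<not> has_clique n E r" "K \<subseteq> {0..<n}" "card K = r"
  shows "\<exists>x\<in>K. \<exists>y\<in>K. x \<noteq> y \<and> \<not> E x y"
proof (rule ccontr)
  assume K: "\<not> ?thesis"
  have "finite K" using assms(2) by (rule finite_subset) simp
  then obtain f where f: "bij_betw f {0..<r} K" using ex_bij_betw_nat_finite assms(3) by blast
  then have inj: "inj_on f {0..<r}" and im: "f ` {0..<r} = K" unfolding bij_betw_def by auto
  have "E (f i) (f j)" if "i < r" "j < r" "i \<noteq> j" for i j
  proof -
    have "f i \<noteq> f j" using inj_onD[OF inj, of i j] that by auto
    moreover have "f i \<in> K" "f j \<in> K" using im that by auto
    ultimately show ?thesis using K by blast
  qed
  then have "has_clique n E r"
    unfolding has_clique_def using inj im assms(2) by (intro exI[of _ f]) simp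
  then show False using assms(1) by simp
qed

lemma not_has_cycleD:
  "\<not> has_cycle n E len \<Longrightarrow> U \<subseteq> {0..<n} \<Longrightarrow> cycle_list E xs \<Longrightarrow> set xs \<subseteq> U \<Longrightarrow> length xs \<noteq> len"
  using cycle_list_has_cycle[of E xs n] by blast

lemma clique_free_choosable:
  assumes g: "graph_on n E" and free: "\<not> has_clique n E (p + 2)" and k: "3 \<le> k" and U: "U \<subseteq> {0..<n}"
    and ln: "3 * ln (real (card U)) * (2 * real (card U) / real k + 1) ^ p < real k"
    and L: "\<And>v. v \<in> U \<Longrightarrow> finite (L v) \<and> card (L v) = k"
  shows "lcol E U L"
proof (rule choosable_if_fractional[OF _ k _ _ _ _ L])
  define T where "T = 2 * real (card U) / real k + 1"
  have T: "1 \<le> T" unfolding T_def by simp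
  show fU: "finite U" using U by (rule finite_subset) simp
  have Tp: "1 \<le> T ^ p" using T by (rule one_le_power)
  show "0 \<le> 1 / T ^ p" "1 / T ^ p \<le> 1" using Tp by simp_all
  show "3 * ln (real (card U)) < 1 / T ^ p * real k"
    using ln Tp unfolding T_def[symmetric] by (simp add: field_simps)
  fix t W assume t: "0 < t" "real t \<le> 2 * real (card U) / real k + 1" and W: "W \<subseteq> U"
    and ind: "\<And>I. I \<subseteq> W \<Longrightarrow> indep E I \<Longrightarrow> card I < t"
  have "fractional E (1 / real (t ^ (p + 2 - 2))) W"
  proof (rule fractional_clique_free[OF _ t(1) graph_on_sym[OF g] graph_on_irrefl[OF g]])
    show "finite W" using W fU by (rule finite_subset)
    show "\<exists>x\<in>K. \<exists>y\<in>K. x \<noteq> y \<and> \<not> E x y" if "K \<subseteq> W" "card K = p + 2" for K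
      using that W U by (intro not_has_cliqueD[OF free]) auto
  qed (use ind in auto)
  moreover have "1 / T ^ p \<le> 1 / real (t ^ (p + 2 - 2))"
    using t T unfolding T_def[symmetric] by (simp add: frac_le power_mono)
  ultimately show "fractional E (1 / T ^ p) W"
    by (rule fractional_antimono)
qed

text \<open>\<open>\<rho>\<close> is the \<open>l\<close>-th root of the bound that
  \<open>fractional_odd_cycle_free\<close> demands for the largest admissible \<open>t\<close>.
  Raising the condition on \<open>q\<close> to the power \<open>l\<close> keeps roots out of the
  hypothesis.\<close>

lemma odd_cycle_free_choosable:
  assumes g: "graph_on n E" and free: "\<not> has_cycle n E (2 * l + 1)" and l: "1 \<le> l"
    and k: "3 \<le> k" and U: "U \<subseteq> {0..<n}"
    and ln: "(3 * ln (real (card U)) * real (l * (2 * l - 1))) ^ l *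
      (real ((l + 1) * (2 * l - 1)) * (2 * real (card U) / real k + 1)) < real k ^ l"
    and L: "\<And>v. v \<in> U \<Longrightarrow> finite (L v) \<and> card (L v) = k"
  shows "lcol E U L"
proof (rule choosable_if_fractional[OF _ k _ _ _ _ L])
  define b where "b = real (l * (2 * l - 1))"
  define M where "M = real ((l + 1) * (2 * l - 1)) * (2 * real (card U) / real k + 1)"
  define \<rho> where "\<rho> = root l M"
  have ge1: "1 \<le> x * y" if "1 \<le> x" "1 \<le> y" for x y :: real
    using mult_mono[OF that] that by simp
  have "1 \<le> l * (2 * l - 1)" using l by (simp add: Suc_le_eq)
  then have b: "1 \<le> b" unfolding b_def by linarith
  have "1 \<le> (l + 1) * (2 * l - 1)" using l by (simp add: Suc_le_eq)
  then have "1 \<le> real ((l + 1) * (2 * l - 1))" by linarith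
  then have M: "1 \<le> M" unfolding M_def by (rule ge1) simp
  have \<rho>: "1 \<le> \<rho>" "\<rho> ^ l = M"
    unfolding \<rho>_def using M l real_root_pow_pos2[of l M] by simp_all
  have b\<rho>: "1 \<le> b * \<rho>" by (rule ge1[OF b \<rho>(1)])
  show fU: "finite U" using U by (rule finite_subset) simp
  show "0 \<le> 1 / (b * \<rho>)" "1 / (b * \<rho>) \<le> 1" using b\<rho> by simp_all
  have "(3 * ln (real (card U)) * b * \<rho>) ^ l < real k ^ l"
    using ln unfolding power_mult_distrib[of _ \<rho>] \<rho>(2) M_def b_def .
  then have "3 * ln (real (card U)) * b * \<rho> < real k" by (rule power_less_imp_less_base) simp
  then show "3 * ln (real (card U)) < 1 / (b * \<rho>) * real k"
    using b\<rho> by (simp add: pos_less_divide_eq mult.assoc)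
  fix t W assume t: "0 < t" "real t \<le> 2 * real (card U) / real k + 1" and W: "W \<subseteq> U"
    and ind: "\<And>I. I \<subseteq> W \<Longrightarrow> indep E I \<Longrightarrow> card I < t"
  show "fractional E (1 / (b * \<rho>)) W"
    unfolding b_def
  proof (rule fractional_odd_cycle_free[OF _ graph_on_sym[OF g] graph_on_irrefl[OF g] _ l])
    show "W \<subseteq> {0..<n}" using W U by simp
    then show "length xs \<noteq> 2 * l + 1" if "cycle_list E xs" "set xs \<subseteq> W" for xs
      using not_has_cycleD[OF free _ that] by blast
    show "card I < t" if "I \<subseteq> W" "indep E I" for I using ind that .
    show "0 < \<rho>" using \<rho> by simp
    have "real ((l + 1) * (2 * l - 1)) * real t \<le> M" unfolding M_def using t by (intro mult_left_mono) auto
    then show "real ((l + 1) * (2 * l - 1) * t) \<le> \<rho> ^ l" unfolding \<rho>(2) by simp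
  qed
qed

text \<open>A subset with minimum degree at least \<open>k\<close> would have too many vertices by
  \<open>even_cycle_free_card\<close>, so the induced graph is degenerate.\<close>

lemma even_cycle_free_choosable:
  assumes g: "graph_on n E" and free: "\<not> has_cycle n E (2 * l)" and l: "2 \<le> l"
    and k: "12 * l \<le> k" and U: "U \<subseteq> {0..<n}"
    and small: "real (card U) < (real k / real (4 * l)) ^ l"
    and L: "\<And>v. v \<in> U \<Longrightarrow> finite (L v) \<and> card (L v) = k"
  shows "lcol E U L"
proof (rule degenerate_lcol[OF _ graph_on_sym[OF g] graph_on_irrefl[OF g] _ L])
  show fU: "finite U" using U by (rule finite_subset) simp
  fix W assume W: "W \<subseteq> U" "W \<noteq> {}"
  show "\<exists>v\<in>W. card {u \<in> W. E v u} < k"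
  proof (rule ccontr)
    assume "\<not> ?thesis"
    then have deg: "k \<le> card {u \<in> W. E v u}" if "v \<in> W" for v using that by force
    have Wn: "W \<subseteq> {0..<n}" using W U by simp
    have "(real k / real (4 * l)) ^ l \<le> real (card W)"
      by (rule even_cycle_free_card[OF Wn W(2) graph_on_sym[OF g] graph_on_irrefl[OF g]
            not_has_cycleD[OF free Wn] l deg k])
    also have "\<dots> \<le> real (card U)" using card_mono[OF fU W(1)] by simp
    finally show False using small by simp
  qed
qed

section \<open>From thresholds on the number of vertices to the exponents of
  \<open>n\<close>\<close>

lemma powr_mult_self: "0 < k \<Longrightarrow> k powr a * k = k powr (a + 1)" for k :: real
  by (simp add: powr_add)

lemma powr_minus_of_nat: "0 < k \<Longrightarrow> k powr - real j = 1 / k ^ j" for k :: real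
  by (simp add: powr_minus_divide powr_realpow)

text \<open>\<open>small\<close> amounts to \<open>N ^ p * ln k < (4 / c) ^ p * k ^ (p + 1)\<close>,
  the order at which \<open>ln N * (N / k) ^ p\<close> reaches \<open>k\<close>. Splitting the
  \<open>p\<close>-th power costs \<open>2 ^ p\<close>. The part with \<open>N\<close> is at most
  \<open>k / 4\<close>, since \<open>384 = 16 * 24\<close> gives
  \<open>6 * (16 / c) ^ p \<le> 6 / 24\<close>; the other part is below \<open>k / 2\<close> by the
  last condition on \<open>k\<close>.\<close>

lemma clique_numerics:
  fixes N k c :: real
  assumes p: "1 \<le> p" and c: "384 \<le> c" and k: "1 \<le> k" "1 \<le> ln k" "12 * 2 ^ p * ln k < k" and N: "1 \<le> N"
    and small: "N < 4 / (c * k powr (- ((2 * real p + 1) / real p)) * ln k powr (1 / real p) * k)"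
  shows "3 * ln N * (2 * N / k + 1) ^ p < k"
proof -
  define g where "g = c * k powr (- ((2 * real p + 1) / real p)) * ln k powr (1 / real p) * k"
  have g0: "0 < g" unfolding g_def using c k(1,2) by (intro mult_pos_pos) auto
  have "k powr (- ((2 * real p + 1) / real p)) * k = k powr (- ((2 * real p + 1) / real p) + 1)"
    using k(1) by (intro powr_mult_self) simp
  also have "- ((2 * real p + 1) / real p) + 1 = - ((real p + 1) / real p)" using p by (simp add: field_simps)
  finally have g: "g = c * (k powr (- ((real p + 1) / real p)) * ln k powr (1 / real p))"
    unfolding g_def by (simp add: mult_ac)
  have "(k powr (- ((real p + 1) / real p))) ^ p = k powr - (real p + 1)"
    using p k by (simp add: powr_power)
  also have "- (real p + 1) = - real (p + 1)" by simp
  also have "k powr - real (p + 1) = 1 / k ^ (p + 1)" using k(1) by (intro powr_minus_of_nat) simp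
  finally have 1: "(k powr (- ((real p + 1) / real p))) ^ p = 1 / k ^ (p + 1)" .
  have 2: "(ln k powr (1 / real p)) ^ p = ln k" using p k(2) by (subst powr_power) auto
  have gp: "g ^ p = c ^ p * ln k / k ^ (p + 1)" unfolding g power_mult_distrib 1 2 by simp
  have "(N * g) ^ p \<le> 4 ^ p"
    using small g0 N unfolding g_def[symmetric] by (intro power_mono) (auto simp: pos_less_divide_eq)
  then have "N ^ p * (c ^ p * ln k) \<le> 4 ^ p * k ^ (p + 1)"
    unfolding power_mult_distrib gp using k by (simp add: field_simps)
  then have Np: "N ^ p * ln k \<le> (4 / c) ^ p * k ^ (p + 1)"
    using c by (simp add: power_divide field_simps)
  \<comment> \<open>A crude polynomial bound, from \<open>p + 1 \<le> 2 * p\<close>, is enough to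
    replace \<open>ln N\<close> by \<open>2 * ln k\<close>.\<close>
  have "N ^ p \<le> N ^ p * ln k" using k N by simp
  also note Np
  also have "(4 / c) ^ p * k ^ (p + 1) \<le> 1 * k ^ (2 * p)"
    using c k p by (intro mult_mono power_le_one power_increasing) auto
  finally have "N ^ p \<le> (k ^ 2) ^ p" by (simp add: power_mult)
  then have "N \<le> k ^ 2" using p N k by (simp add: power_mono_iff)
  then have "ln N \<le> ln (k ^ 2)" using N by (intro ln_le_cancel_iff[THEN iffD2]) linarith+
  then have lnN: "ln N \<le> 2 * ln k" using k by (simp add: ln_realpow)
  have "(2 * N / k + 1) ^ p \<le> (2 * max (2 * N / k) 1) ^ p" using k N by (intro power_mono) auto
  also have "\<dots> = 2 ^ p * (max (2 * N / k) 1) ^ p" by (rule power_mult_distrib)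
  also have "\<dots> \<le> 2 ^ p * ((2 * N / k) ^ p + 1)"
    using k N by (intro mult_left_mono) (auto simp: max_def)
  finally have "3 * ln N * (2 * N / k + 1) ^ p \<le> 3 * (2 * ln k) * (2 ^ p * ((2 * N / k) ^ p + 1))"
    using lnN N k by (intro mult_mono) auto
  also have "\<dots> = 6 * 4 ^ p * (N ^ p * ln k) / k ^ p + 6 * 2 ^ p * ln k"
  proof -
    have "(4 :: real) ^ p = 2 ^ p * 2 ^ p" by (simp flip: power_mult_distrib)
    then show ?thesis by (simp add: power_mult_distrib power_divide algebra_simps)
  qed
  also have "6 * 4 ^ p * (N ^ p * ln k) / k ^ p \<le> 6 * 4 ^ p * ((4 / c) ^ p * k ^ (p + 1)) / k ^ p"
    using Np k by (intro divide_right_mono mult_left_mono) auto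
  also have "\<dots> = 6 * (16 / c) ^ p * k" using k by (simp add: power_mult_distrib[symmetric] field_simps flip: power_divide)
  also have "\<dots> \<le> 6 * (1 / 24) * k"
  proof -
    have "(16 / c) ^ p \<le> (16 / c) ^ 1" using c p by (intro power_decreasing) auto
    also have "\<dots> \<le> 1 / 24" using c by (simp add: field_simps)
    finally show ?thesis using k by (intro mult_right_mono mult_left_mono) auto
  qed
  finally show ?thesis using k(3) k(1) by simp
qed

text \<open>\<open>small\<close> amounts to \<open>N * c * ln k ^ l < 4 * k ^ (l + 1)\<close>, and
  \<open>A\<close> collects the constants after \<open>ln N \<le> (l + 1) * ln k\<close>. The part
  with \<open>N\<close> is at most \<open>k ^ l / 2\<close> by \<open>16 * A \<le> c\<close>, the
  other is below it by the last condition on \<open>k\<close>.\<close>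

lemma odd_cycle_numerics:
  fixes N k c A b d :: real
  assumes c: "4 \<le> c" "16 * A \<le> c" and k: "1 \<le> k" "1 \<le> ln k" "2 * A * ln k ^ l < k ^ l" and N: "1 \<le> N"
    and d: "0 \<le> b" "0 \<le> d" "A = (3 * (real l + 1) * b) ^ l * d"
    and small: "N < 4 / (c * k powr (- (real l + 2)) * ln k ^ l * k)"
  shows "(3 * ln N * b) ^ l * (d * (2 * N / k + 1)) < k ^ l"
proof -
  have A0: "0 \<le> A" unfolding d(3) using d by simp
  have "k powr (- (real l + 2)) * k = k powr (- (real l + 2) + 1)" using k(1) by (intro powr_mult_self) simp
  also have "- (real l + 2) + 1 = - real (l + 1)" by simp
  also have "k powr - real (l + 1) = 1 / k ^ (l + 1)"
    using k(1) by (intro powr_minus_of_nat) simp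
  finally have kp: "k powr (- (real l + 2)) * k = 1 / k ^ (l + 1)" .
  have "c * k powr (- (real l + 2)) * ln k ^ l * k = c * ln k ^ l * (k powr (- (real l + 2)) * k)"
    by (simp only: mult_ac)
  also have "\<dots> = c * ln k ^ l / k ^ (l + 1)" unfolding kp by simp
  finally have eq: "c * k powr (- (real l + 2)) * ln k ^ l * k = c * ln k ^ l / k ^ (l + 1)" .
  then have Nb: "N * (c * ln k ^ l) < 4 * k ^ (l + 1)"
  proof -
    have "N < 4 * k ^ (l + 1) / (c * ln k ^ l)"
      using small unfolding eq by (simp only: divide_divide_eq_right)
    moreover have "0 < c * ln k ^ l" using c(1) k(2) by (intro mult_pos_pos zero_less_power) auto
    ultimately show ?thesis by (simp only: pos_less_divide_eq)
  qed
  have lk: "1 \<le> ln k ^ l" using k(2) by (rule one_le_power)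
  have "N * 4 \<le> N * (c * ln k ^ l)"
    using N c lk mult_mono[of 4 c 1 "ln k ^ l"] by (intro mult_left_mono) auto
  then have "N \<le> k ^ (l + 1)" using Nb by simp
  then have "ln N \<le> ln (k ^ (l + 1))" using N by (intro ln_le_cancel_iff[THEN iffD2]) linarith+
  also have "\<dots> = (real l + 1) * ln k" using k by (subst ln_realpow) (auto simp: add.commute)
  finally have lnN: "ln N \<le> (real l + 1) * ln k" .
  have "0 \<le> (real l + 1) * ln k" using k(2) by (intro mult_nonneg_nonneg) auto
  then have "(3 * ln N * b) ^ l \<le> (3 * ((real l + 1) * ln k) * b) ^ l"
    using lnN N d(1) by (intro power_mono mult_mono) auto
  then have "(3 * ln N * b) ^ l * (d * (2 * N / k + 1)) \<le> (3 * ((real l + 1) * ln k) * b) ^ l * (d * (2 * N / k + 1))"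
    using d(2) N k(1) by (intro mult_right_mono) auto
  also have "\<dots> = A * ln k ^ l * (2 * N / k + 1)" unfolding d(3) power_mult_distrib by (simp add: mult_ac)
  also have "\<dots> = 2 * A * (N * ln k ^ l) / k + A * ln k ^ l" using k(1) by (simp add: field_simps)
  also have "2 * A * (N * ln k ^ l) / k \<le> k ^ l / 2"
  proof -
    have "16 * A * (N * ln k ^ l) \<le> c * (N * ln k ^ l)" using c N lk by (intro mult_right_mono) auto
    also have "\<dots> \<le> 4 * k ^ (l + 1)" using Nb by (simp add: mult_ac)
    finally have "4 * (A * (N * ln k ^ l)) \<le> k ^ (l + 1)" by simp
    then show ?thesis using k(1) by (simp add: field_simps)
  qed
  finally show ?thesis using k(3) by simp
qed

text \<open>\<open>small\<close> amounts to \<open>N < 4 * k ^ l / c\<close>, and the bound on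
  \<open>c\<close> is what the growth factor \<open>k / (4 * l)\<close> over \<open>l\<close> layers
  requires.\<close>

lemma even_cycle_numerics:
  fixes N k c :: real
  assumes c: "4 * (4 * real l) ^ l \<le> c" and l: "1 \<le> l" and k: "1 \<le> k"
    and small: "N < 4 / (c * k powr (- (real l + 1)) * k)"
  shows "N < (k / real (4 * l)) ^ l"
proof -
  have c0: "0 < c" using c l by (intro less_le_trans[OF _ c]) simp
  have "k powr (- (real l + 1)) * k = k powr (- (real l + 1) + 1)" using k by (intro powr_mult_self) simp
  also have "- (real l + 1) + 1 = - real l" by simp
  also have "k powr - real l = 1 / k ^ l" using k by (intro powr_minus_of_nat) simp
  finally have "c * k powr (- (real l + 1)) * k = c / k ^ l" by (simp add: mult_ac)
  then have "N < 4 * k ^ l / c" using small by simp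
  also have "\<dots> \<le> 4 * k ^ l / (4 * (4 * real l) ^ l)" using c c0 l k by (intro divide_left_mono) auto
  also have "\<dots> = (k / real (4 * l)) ^ l" by (simp add: power_divide)
  finally show ?thesis .
qed

section \<open>Assembling the three cases\<close>

lemma ratio_to_inftyD:
  assumes "ratio_to_infty f g" shows "eventually (\<lambda>n. g n < f n) sequentially"
  using assms unfolding ratio_to_infty_def by (auto dest: spec[of _ 1])

text \<open>The condition \<open>k \<le> m n\<close> guarantees that lists exist: on edgeless graphs
  the bound by the maximum degree would allow \<open>m n < k\<close>, leaving no list assignment and
  the quotient 0 / 0 in \<open>colour_prob\<close>.\<close>

theorem mainTheorem3:
  fixes r l :: nat
  assumes "r \<ge> 3" and "l \<ge> 2"
  shows "\<exists>c::real. c > 0 \<and> (\<exists>k0::nat. \<forall>k\<ge>k0.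
     \<forall>(G :: nat \<Rightarrow> nat \<Rightarrow> nat \<Rightarrow> bool) (m :: nat \<Rightarrow> nat).
       (\<forall>n. graph_on n (G n)) \<longrightarrow>
       (\<forall>n. m n \<ge> k) \<longrightarrow>
       (\<forall>n. m n \<ge> 3 * k^2 * max_degree n (G n)) \<longrightarrow>
       ((\<forall>n. \<not> has_clique n (G n) r) \<and>
          ratio_to_infty (\<lambda>n. real (m n))
            (\<lambda>n. real n powr (c * real k powr (- ((2 * real r - 3) / (real r - 2)))
                                 * ln (real k) powr (1 / (real r - 2)))
                 * real (max_degree n (G n)) powr (2 / real k))
          \<longrightarrow> aas_colourable G k m) \<and>
       ((\<forall>n. \<not> has_cycle n (G n) (2 * l + 1)) \<and>
          ratio_to_infty (\<lambda>n. real (m n))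
            (\<lambda>n. real n powr (c * real k powr (- (real l + 2)) * ln (real k) ^ l)
                 * real (max_degree n (G n)) powr (2 / real k))
          \<longrightarrow> aas_colourable G k m) \<and>
       ((\<forall>n. \<not> has_cycle n (G n) (2 * l)) \<and>
          ratio_to_infty (\<lambda>n. real (m n))
            (\<lambda>n. real n powr (c * real k powr (- (real l + 1)))
                 * real (max_degree n (G n)) powr (2 / real k))
          \<longrightarrow> aas_colourable G k m))"
proof -
  define p where "p = r - 2"
  have p: "1 \<le> p" "r = p + 2" using assms(1) unfolding p_def by auto
  define b where "b = real (l * (2 * l - 1))"
  define d where "d = real ((l + 1) * (2 * l - 1))"
  define A where "A = (3 * (real l + 1) * b) ^ l * d"
  have bd: "0 \<le> b" "0 \<le> d" unfolding b_def d_def by simp_all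
  then have A: "0 \<le> A" unfolding A_def by simp
  \<comment> \<open>One constant serves all cases: the summands are those demanded by
    \<open>clique_numerics\<close>, \<open>odd_cycle_numerics\<close> and
    \<open>even_cycle_numerics\<close>.\<close>
  define c where "c = 384 + 16 * A + 4 * (4 * real l) ^ l"
  have c: "384 \<le> c" "16 * A \<le> c" "4 * (4 * real l) ^ l \<le> c" unfolding c_def using A by auto
  have l1: "(\<lambda>k :: nat. ln (real k) / real k) \<longlonglongrightarrow> 0" by real_asymp
  have e1: "eventually (\<lambda>k :: nat. ln (real k) / real k < 1 / (12 * 2 ^ p)) sequentially"
    using l1 by (rule order_tendstoD) simp
  have "(\<lambda>k :: nat. 2 * A * (ln (real k) / real k) ^ l) \<longlonglongrightarrow> 2 * A * 0 ^ l"
    by (intro tendsto_mult tendsto_power l1 tendsto_const)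
  then have e2: "eventually (\<lambda>k :: nat. 2 * A * (ln (real k) / real k) ^ l < 1) sequentially"
    by (rule order_tendstoD) (use assms(2) in \<open>simp add: power_0_left\<close>)
  have e3: "eventually (\<lambda>k :: nat. 1 \<le> ln (real k)) sequentially" by real_asymp
  have "eventually (\<lambda>k :: nat. 12 * l \<le> k \<and> 3 \<le> k \<and> 1 \<le> ln (real k) \<and> 12 * 2 ^ p * ln (real k) < real k \<and>
      2 * A * ln (real k) ^ l < real k ^ l) sequentially"
    using e1 e2 e3 eventually_ge_at_top[of "12 * l"] eventually_ge_at_top[of 3]
  proof eventually_elim
    case (elim k)
    have k: "0 < real k" using elim by simp
    then have "0 < real k ^ l" by simp
    then show ?case using elim k by (simp add: field_simps power_divide)
  qed
  then obtain k0 where k0: "\<And>k. k0 \<le> k \<Longrightarrow> 12 * l \<le> k \<and> 3 \<le> k \<and> 1 \<le> ln (real k) \<and>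
      12 * 2 ^ p * ln (real k) < real k \<and> 2 * A * ln (real k) ^ l < real k ^ l"
    unfolding eventually_sequentially by blast
  show ?thesis
  proof (intro exI[of _ c] conjI exI[of _ k0] allI impI; (elim conjE)?)
    show "0 < c" using c by simp
  next
    fix k G and m :: "nat \<Rightarrow> nat"
    assume k: "k0 \<le> k" and g: "\<forall>n. graph_on n (G n)" and mk: "\<forall>n. k \<le> m n"
      and m3: "\<forall>n. 3 * k^2 * max_degree n (G n) \<le> m n"
      and free: "\<forall>n. \<not> has_clique n (G n) r"
      and ratio: "ratio_to_infty (\<lambda>n. real (m n))
            (\<lambda>n. real n powr (c * real k powr (- ((2 * real r - 3) / (real r - 2)))
                                 * ln (real k) powr (1 / (real r - 2)))
                 * real (max_degree n (G n)) powr (2 / real k))"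
    note kk = k0[OF k]
    have e: "2 * real r - 3 = 2 * real p + 1" "real r - 2 = real p"
      unfolding p(2) by simp_all
    show "aas_colourable G k m"
    proof (rule aas_colourable_if_small_choosable)
      show "0 < c * real k powr (- ((2 * real r - 3) / (real r - 2))) * ln (real k) powr (1 / (real r - 2))"
        using c(1) kk by (intro mult_pos_pos) auto
      show "eventually (\<lambda>n. real n powr (c * real k powr (- ((2 * real r - 3) / (real r - 2))) * ln (real k) powr (1 / (real r - 2)))
          * real (max_degree n (G n)) powr (2 / real k) < real (m n)) sequentially"
        using ratio by (rule ratio_to_inftyD)
      fix n U and L :: "nat \<Rightarrow> nat set"
      assume U: "U \<subseteq> {0..<n}" and small: "real (card U) < 4 / (c * real k powr (- ((2 * real r - 3) / (real r - 2))) *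
          ln (real k) powr (1 / (real r - 2)) * real k)"
        and L: "\<And>v. v \<in> U \<Longrightarrow> finite (L v) \<and> card (L v) = k"
      show "lcol (G n) U L"
      \<comment> \<open>The logarithmic estimates assume \<open>1 \<le> N\<close>, so the empty set
        is treated separately.\<close>
      proof (cases "card U = 0")
        case True
        moreover have "finite U" using U by (rule finite_subset) simp
        ultimately show ?thesis by simp
      next
        case False
        show ?thesis
        proof (rule clique_free_choosable[OF g[rule_format] _ _ U _ L])
          show "\<not> has_clique n (G n) (p + 2)" using free p(2) by simp
          show "3 \<le> k" using kk by simp
          show "3 * ln (real (card U)) * (2 * real (card U) / real k + 1) ^ p < real k"
          proof (rule clique_numerics[OF p(1) c(1)])
            show "real (card U) < 4 / (c * real k powr (- ((2 * real p + 1) / real p)) * ln (real k) powr (1 / real p) * real k)"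
              using small unfolding e .
          qed (use kk False in auto)
        qed
      qed
    qed (use kk g mk m3 in auto)
  next
    fix k G and m :: "nat \<Rightarrow> nat"
    assume k: "k0 \<le> k" and g: "\<forall>n. graph_on n (G n)" and mk: "\<forall>n. k \<le> m n"
      and m3: "\<forall>n. 3 * k^2 * max_degree n (G n) \<le> m n"
      and free: "\<forall>n. \<not> has_cycle n (G n) (2 * l + 1)"
      and ratio: "ratio_to_infty (\<lambda>n. real (m n))
            (\<lambda>n. real n powr (c * real k powr (- (real l + 2)) * ln (real k) ^ l)
                 * real (max_degree n (G n)) powr (2 / real k))"
    note kk = k0[OF k]
    show "aas_colourable G k m"
    proof (rule aas_colourable_if_small_choosable)
      show "0 < c * real k powr (- (real l + 2)) * ln (real k) ^ l"
        using c(1) kk by (intro mult_pos_pos zero_less_power) auto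
      show "eventually (\<lambda>n. real n powr (c * real k powr (- (real l + 2)) * ln (real k) ^ l)
          * real (max_degree n (G n)) powr (2 / real k) < real (m n)) sequentially"
        using ratio by (rule ratio_to_inftyD)
      fix n U and L :: "nat \<Rightarrow> nat set"
      assume U: "U \<subseteq> {0..<n}"
        and small: "real (card U) < 4 / (c * real k powr (- (real l + 2)) * ln (real k) ^ l * real k)"
        and L: "\<And>v. v \<in> U \<Longrightarrow> finite (L v) \<and> card (L v) = k"
      show "lcol (G n) U L"
      proof (cases "card U = 0")
        case True
        moreover have "finite U" using U by (rule finite_subset) simp
        ultimately show ?thesis by simp
      next
        case False
        show ?thesis
        proof (rule odd_cycle_free_choosable[OF g[rule_format] _ _ _ U _ L])
          show "\<not> has_cycle n (G n) (2 * l + 1)" using free by simp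
          show "1 \<le> l" "3 \<le> k" using kk assms(2) by simp_all
          show "(3 * ln (real (card U)) * real (l * (2 * l - 1))) ^ l *
            (real ((l + 1) * (2 * l - 1)) * (2 * real (card U) / real k + 1)) < real k ^ l"
            unfolding b_def[symmetric] d_def[symmetric]
            by (rule odd_cycle_numerics[OF _ c(2) _ _ _ _ bd A_def small]) (use c kk False in auto)
        qed
      qed
    qed (use kk g mk m3 in auto)
  next
    fix k G and m :: "nat \<Rightarrow> nat"
    assume k: "k0 \<le> k" and g: "\<forall>n. graph_on n (G n)" and mk: "\<forall>n. k \<le> m n"
      and m3: "\<forall>n. 3 * k^2 * max_degree n (G n) \<le> m n"
      and free: "\<forall>n. \<not> has_cycle n (G n) (2 * l)"
      and ratio: "ratio_to_infty (\<lambda>n. real (m n))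
            (\<lambda>n. real n powr (c * real k powr (- (real l + 1)))
                 * real (max_degree n (G n)) powr (2 / real k))"
    note kk = k0[OF k]
    show "aas_colourable G k m"
    proof (rule aas_colourable_if_small_choosable)
      show "0 < c * real k powr (- (real l + 1))" using c(1) kk by (intro mult_pos_pos) auto
      show "eventually (\<lambda>n. real n powr (c * real k powr (- (real l + 1)))
          * real (max_degree n (G n)) powr (2 / real k) < real (m n)) sequentially"
        using ratio by (rule ratio_to_inftyD)
      fix n U and L :: "nat \<Rightarrow> nat set"
      assume U: "U \<subseteq> {0..<n}" and small: "real (card U) < 4 / (c * real k powr (- (real l + 1)) * real k)"
        and L: "\<And>v. v \<in> U \<Longrightarrow> finite (L v) \<and> card (L v) = k"
      show "lcol (G n) U L"
      proof (rule even_cycle_free_choosable[OF g[rule_format] _ assms(2) _ U _ L])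
        show "\<not> has_cycle n (G n) (2 * l)" using free by simp
        show "12 * l \<le> k" using kk by simp
        show "real (card U) < (real k / real (4 * l)) ^ l"
          by (rule even_cycle_numerics[OF c(3) _ _ small]) (use kk assms(2) in auto)
      qed
    qed (use kk g mk m3 in auto)
  qed
qed

end
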